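(* Let $\Gamma$ be a discrete group, let $p\in[1,\infty)$, and let $H$ be a $\mathbb{C}[\Gamma]$ bimodule such that for every $\xi$ in some dense subset of $H$ the coefficient $T_\xi$ is in $\mathcal{S}_p$. Then for any integer $n\ge1$ with $n\ge\frac p2$ the bimodule $H^{\otimes n}_\Gamma$ is quasi-contained in the coarse bimodule $\ell_2(\Gamma)\otimes\ell_2(\Gamma)$.
   Context: Inner products are linear in the first variable. For a discrete group $\Gamma$ with identity $e$, $\mathbb{C}[\Gamma]$ is the $\ast$-algebra spanned by the left translations $\lambda_g$ on $\ell_2(\Gamma)$, with trace $\tau(x)=\langle x\delta_e,\delta_e\rangle$, and is viewed inside $\ell_2(\Gamma)$ via $x\mapsto x\delta_e$. A $\mathbb{C}[\Gamma]$ bimodule is a Hilbert space $H$ with commuting left and right $\ast$-actions of $\mathbb{C}[\Gamma]$ (equivalently commuting left and right unitary actions of $\Gamma$). For $\xi\in H$ the coefficient $T_\xi$, if it exists, is the unique map $T_\xi:\mathbb{C}[\Gamma]\to\mathbb{C}[\Gamma]$ with $\tau(T_\xi(x)y)=\langle x\xi y,\xi\rangle$ for all $x,y\in\mathbb{C}[\Gamma]$; it is in $\mathcal{S}_p$ if it exists and extends to a bounded operator on $\ell_2(\Gamma)$ in the Schatten class $\mathcal{S}_p(\ell_2(\Gamma))$. $H_1\otimes_\Gamma H_2$ is the Hilbert space $H_1\otimes H_2$ with actions $s(\xi\otimes\eta)t=s\xi t\otimes s\eta t$, $s,t\in\Gamma$, extended linearly, and $H^{\otimes n}_\Gamma$ is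 the $n$-fold such tensor power. The coarse bimodule is $\ell_2(\Gamma)\otimes\ell_2(\Gamma)$ with $x(\xi\otimes\eta)y=x\xi\otimes\eta y$ (left and right translation actions on $\ell_2(\Gamma)$). A bimodule $H$ is quasi-contained in $K$ if it is (isomorphic to) a subbimodule of $\bigoplus_{i\in I}K$ for some index set $I$. *)

theory Defs
  imports
    "HOL-Analysis.Analysis"
    "HOL-Library.Function_Algebras"
    "HOL-Library.Poly_Mapping"
begin

section \<open>Complex Hilbert spaces\<close>

class complex_vector = ab_group_add +
  fixes scaleC :: "complex \<Rightarrow> 'a \<Rightarrow> 'a"
  assumes scaleC_add_right: "scaleC c (x + y) = scaleC c x + scaleC c y"
    and scaleC_add_left: "scaleC (c + d) x = scaleC c x + scaleC d x"
    and scaleC_scaleC: "scaleC c (scaleC d x) = scaleC (c * d) x"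
    and scaleC_one: "scaleC 1 x = x"

global_interpretation complex_vector:
  vector_space "scaleC :: complex \<Rightarrow> 'a \<Rightarrow> 'a::complex_vector"
  by unfold_locales (simp_all add: scaleC_add_right scaleC_add_left scaleC_scaleC scaleC_one)

instantiation complex :: complex_vector
begin
definition scaleC_complex :: "complex \<Rightarrow> complex \<Rightarrow> complex" where
  "scaleC_complex c z = c * z"
instance by standard (simp_all add: scaleC_complex_def algebra_simps)
end

instantiation "fun" :: (type, complex_vector) complex_vector
begin
definition scaleC_fun :: "complex \<Rightarrow> ('a \<Rightarrow> 'b) \<Rightarrow> 'a \<Rightarrow> 'b" where
  "scaleC_fun c f = (\<lambda>x. scaleC c (f x))"
instance
  by standard (simp_all add: scaleC_fun_def fun_eq_iff
      scaleC_add_right scaleC_add_left scaleC_scaleC scaleC_one)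
end

text \<open>
  A space is a linear subspace of an ambient complex vector space together with an inner product
  that is only meaningful on that subspace. Every complex Hilbert space is of this form, with its
  own type as the ambient space. Carriers are needed because the dimension of an n-fold tensor
  power may depend on n.
\<close>

record 'a inner_space =
  vecs :: "'a set"
  cinner :: "'a \<Rightarrow> 'a \<Rightarrow> complex"

definition hnorm :: "('a, 'm) inner_space_scheme \<Rightarrow> 'a \<Rightarrow> real" where
  "hnorm H x = sqrt (Re (cinner H x x))"

locale hilbert_space =
  fixes H :: "('a::complex_vector, 'm) inner_space_scheme"
  assumes subspace_vecs: "complex_vector.subspace (vecs H)"
    and cinner_add_left: "\<lbrakk>x \<in> vecs H; y \<in> vecs H; z \<in> vecs H\<rbrakk> \<Longrightarrow>
      cinner H (x + y) z = cinner H x z + cinner H y z"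
    and cinner_scaleC_left: "\<lbrakk>x \<in> vecs H; y \<in> vecs H\<rbrakk> \<Longrightarrow>
      cinner H (scaleC c x) y = c * cinner H x y"
    and cinner_commute: "\<lbrakk>x \<in> vecs H; y \<in> vecs H\<rbrakk> \<Longrightarrow> cinner H x y = cnj (cinner H y x)"
    and cinner_nonneg: "x \<in> vecs H \<Longrightarrow> 0 \<le> Re (cinner H x x)"
    and cinner_definite: "\<lbrakk>x \<in> vecs H; cinner H x x = 0\<rbrakk> \<Longrightarrow> x = 0"
    and complete: "\<lbrakk>\<And>k. X k \<in> vecs H;
        \<And>e. e > 0 \<Longrightarrow> \<exists>N. \<forall>k\<ge>N. \<forall>l\<ge>N. hnorm H (X k - X l) < e\<rbrakk> \<Longrightarrow>
      \<exists>x\<in>vecs H. (\<lambda>k. hnorm H (X k - x)) \<longlonglongrightarrow> 0"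

definition linear_between ::
  "('a::complex_vector, 'm) inner_space_scheme \<Rightarrow> ('b::complex_vector, 'n) inner_space_scheme \<Rightarrow>
    ('a \<Rightarrow> 'b) \<Rightarrow> bool" where
  "linear_between H K A \<longleftrightarrow>
     (\<forall>x\<in>vecs H. A x \<in> vecs K) \<and>
     (\<forall>x\<in>vecs H. \<forall>y\<in>vecs H. A (x + y) = A x + A y) \<and>
     (\<forall>c. \<forall>x\<in>vecs H. A (scaleC c x) = scaleC c (A x))"

definition bounded_operator ::
  "('a::complex_vector, 'm) inner_space_scheme \<Rightarrow> ('a \<Rightarrow> 'a) \<Rightarrow> bool" where
  "bounded_operator H A \<longleftrightarrow>
     linear_between H H A \<and> (\<exists>C. \<forall>x\<in>vecs H. hnorm H (A x) \<le> C * hnorm H x)"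

definition isometric_between ::
  "('a::complex_vector, 'm) inner_space_scheme \<Rightarrow> ('b::complex_vector, 'n) inner_space_scheme \<Rightarrow>
    ('a \<Rightarrow> 'b) \<Rightarrow> bool" where
  "isometric_between H K U \<longleftrightarrow>
     linear_between H K U \<and>
     (\<forall>x\<in>vecs H. \<forall>y\<in>vecs H. cinner K (U x) (U y) = cinner H x y)"

definition dense_in :: "('a::complex_vector, 'm) inner_space_scheme \<Rightarrow> 'a set \<Rightarrow> bool" where
  "dense_in H D \<longleftrightarrow>
     D \<subseteq> vecs H \<and> (\<forall>x\<in>vecs H. \<forall>e>0. \<exists>d\<in>D. hnorm H (x - d) < e)"

definition closed_subspace ::
  "('a::complex_vector, 'm) inner_space_scheme \<Rightarrow> 'a set \<Rightarrow> bool" where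
  "closed_subspace H S \<longleftrightarrow>
     S \<subseteq> vecs H \<and> complex_vector.subspace S \<and>
     (\<forall>X x. (\<forall>k. X k \<in> S) \<and> x \<in> vecs H \<and> (\<lambda>k. hnorm H (X k - x)) \<longlonglongrightarrow> 0 \<longrightarrow> x \<in> S)"


section \<open>Schatten classes\<close>

definition orthonormal_on ::
  "('a, 'm) inner_space_scheme \<Rightarrow> 'k set \<Rightarrow> ('k \<Rightarrow> 'a) \<Rightarrow> bool" where
  "orthonormal_on H J u \<longleftrightarrow>
     (\<forall>j\<in>J. u j \<in> vecs H) \<and>
     (\<forall>j\<in>J. \<forall>k\<in>J. cinner H (u j) (u k) = (if j = k then 1 else 0))"

text \<open>
  The singular value decomposition (canonical expansion) of an operator: orthonormal
  families \<open>u\<close>, \<open>v\<close> and positive numbers \<open>\<sigma>\<close>, indexed by a finite or infinite set \<open>J\<close>, such that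
  \<open>A x = (\<Sum>k\<in>J. \<sigma> k \<langle>x, u k\<rangle> v k)\<close> in norm. The operator is compact iff it admits such an
  expansion whose \<open>\<sigma>\<close> is finite or tends to 0, and then \<open>\<sigma>\<close> lists the nonzero singular values,
  i.e. eigenvalues of \<open>\<bar>A\<bar>\<close>, with multiplicity. So \<open>(\<Sum>k\<in>J. \<sigma> k powr p)\<close> is the trace of the p-th power of \<open>\<bar>A\<bar>\<close>.
\<close>

definition singular_system ::
  "('a::complex_vector, 'm) inner_space_scheme \<Rightarrow> ('a \<Rightarrow> 'a) \<Rightarrow>
    nat set \<Rightarrow> (nat \<Rightarrow> real) \<Rightarrow> (nat \<Rightarrow> 'a) \<Rightarrow> (nat \<Rightarrow> 'a) \<Rightarrow> bool" where
  "singular_system H A J \<sigma> u v \<longleftrightarrow>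
     orthonormal_on H J u \<and> orthonormal_on H J v \<and> (\<forall>k\<in>J. \<sigma> k > 0) \<and>
     (\<forall>x\<in>vecs H.
        ((\<lambda>F. hnorm H (A x - (\<Sum>k\<in>F. scaleC (complex_of_real (\<sigma> k) * cinner H x (u k)) (v k))))
          \<longlongrightarrow> 0) (finite_subsets_at_top J))"

definition schatten_class ::
  "real \<Rightarrow> ('a::complex_vector, 'm) inner_space_scheme \<Rightarrow> ('a \<Rightarrow> 'a) set" where
  "schatten_class p H =
     {A. bounded_operator H A \<and>
         (\<exists>J \<sigma> u v. singular_system H A J \<sigma> u v \<and> (\<lambda>k. \<sigma> k powr p) summable_on J)}"


section \<open>Bimodules over a group algebra\<close>

text \<open>
  The discrete group is a type \<open>'g\<close> of class \<open>group_add\<close>; it is written additively but is not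
  assumed to be commutative, so the product \<open>s t\<close> is \<open>s + t\<close>, the inverse is \<open>- s\<close> and the identity
  is \<open>0\<close>. The group algebra is \<open>'g \<Rightarrow>\<^sub>0 complex\<close>, whose multiplication is convolution;
  \<open>\<lambda>\<^sub>g\<close> is \<open>Poly_Mapping.single g 1\<close>.
\<close>

record ('a, 'g) bimod = "'a inner_space" +
  lact :: "'g \<Rightarrow> 'a \<Rightarrow> 'a"
  ract :: "'a \<Rightarrow> 'g \<Rightarrow> 'a"

locale bimodule = hilbert_space H
  for H :: "('a::complex_vector, 'g::group_add, 'm) bimod_scheme" +
  assumes lact_isometric: "isometric_between H H (lact H s)"
    and ract_isometric: "isometric_between H H (\<lambda>\<xi>. ract H \<xi> t)"
    and lact_zero: "\<xi> \<in> vecs H \<Longrightarrow> lact H 0 \<xi> = \<xi>"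
    and ract_zero: "\<xi> \<in> vecs H \<Longrightarrow> ract H \<xi> 0 = \<xi>"
    and lact_add: "\<xi> \<in> vecs H \<Longrightarrow> lact H (s + t) \<xi> = lact H s (lact H t \<xi>)"
    and ract_add: "\<xi> \<in> vecs H \<Longrightarrow> ract H \<xi> (s + t) = ract H (ract H \<xi> s) t"
    and lact_ract: "\<xi> \<in> vecs H \<Longrightarrow> lact H s (ract H \<xi> t) = ract H (lact H s \<xi>) t"

definition lalg ::
  "('a::complex_vector, 'g, 'm) bimod_scheme \<Rightarrow> ('g \<Rightarrow>\<^sub>0 complex) \<Rightarrow> 'a \<Rightarrow> 'a" where
  "lalg H x \<xi> = (\<Sum>s\<in>Poly_Mapping.keys x. scaleC (Poly_Mapping.lookup x s) (lact H s \<xi>))"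

definition ralg ::
  "('a::complex_vector, 'g, 'm) bimod_scheme \<Rightarrow> 'a \<Rightarrow> ('g \<Rightarrow>\<^sub>0 complex) \<Rightarrow> 'a" where
  "ralg H \<xi> y = (\<Sum>t\<in>Poly_Mapping.keys y. scaleC (Poly_Mapping.lookup y t) (ract H \<xi> t))"

definition bimod_iso ::
  "('a::complex_vector, 'g, 'm) bimod_scheme \<Rightarrow> ('b::complex_vector, 'g, 'n) bimod_scheme \<Rightarrow>
    bool" where
  "bimod_iso H K \<longleftrightarrow>
     (\<exists>U. isometric_between H K U \<and> bij_betw U (vecs H) (vecs K) \<and>
          (\<forall>s. \<forall>\<xi>\<in>vecs H. U (lact H s \<xi>) = lact K s (U \<xi>)) \<and>
          (\<forall>t. \<forall>\<xi>\<in>vecs H. U (ract H \<xi> t) = ract K (U \<xi>) t))"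

text \<open>If \<open>S\<close> carries a subbimodule of \<open>H\<close>, the subbimodule itself is \<open>H\<lparr>vecs := S\<rparr>\<close>.\<close>

definition subbimodule :: "'a set \<Rightarrow> ('a::complex_vector, 'g, 'm) bimod_scheme \<Rightarrow> bool" where
  "subbimodule S H \<longleftrightarrow>
     closed_subspace H S \<and>
     (\<forall>s. \<forall>\<xi>\<in>S. lact H s \<xi> \<in> S) \<and> (\<forall>t. \<forall>\<xi>\<in>S. ract H \<xi> t \<in> S)"

definition direct_sum ::
  "'i set \<Rightarrow> ('a::complex_vector, 'g, 'm) bimod_scheme \<Rightarrow> ('i \<Rightarrow> 'a, 'g) bimod" where
  "direct_sum I K =
     \<lparr> vecs = {f. (\<forall>i\<in>I. f i \<in> vecs K) \<and> (\<forall>i. i \<notin> I \<longrightarrow> f i = 0) \<and>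
                 (\<lambda>i. (hnorm K (f i))\<^sup>2) summable_on I},
       cinner = (\<lambda>f g. \<Sum>\<^sub>\<infinity>i\<in>I. cinner K (f i) (g i)),
       lact = (\<lambda>s f i. if i \<in> I then lact K s (f i) else 0),
       ract = (\<lambda>f t i. if i \<in> I then ract K (f i) t else 0) \<rparr>"

text \<open>
  Existential quantification over a type of indices is not available, so index sets are taken
  inside the type \<open>'a\<close> of \<open>H\<close>. This loses nothing: each vector of \<open>\<Oplus>\<^sub>i K\<close> has countable support, so
  a nonzero \<open>H\<close> contained in a direct sum is already contained in the sum of at most \<open>\<bar>H\<bar>\<close> of the
  summands.
\<close>

definition quasi_contained ::
  "('a::complex_vector, 'g, 'm) bimod_scheme \<Rightarrow> ('b::complex_vector, 'g, 'n) bimod_scheme \<Rightarrow>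
    bool" where
  "quasi_contained H K \<longleftrightarrow>
     (\<exists>(I :: 'a set) S. subbimodule S (direct_sum I K) \<and>
        bimod_iso H ((direct_sum I K)\<lparr>vecs := S\<rparr>))"


section \<open>Coefficients\<close>

definition ell2 :: "('g::group_add \<Rightarrow> complex, 'g) bimod" where
  "ell2 =
     \<lparr> vecs = {f. (\<lambda>g. (cmod (f g))\<^sup>2) summable_on UNIV},
       cinner = (\<lambda>f h. \<Sum>\<^sub>\<infinity>g. f g * cnj (h g)),
       lact = (\<lambda>s f g. f (- s + g)),
       ract = (\<lambda>f t g. f (g - t)) \<rparr>"

definition delta :: "'g \<Rightarrow> 'g \<Rightarrow> complex" where
  "delta s = (\<lambda>g. if g = s then 1 else 0)"

lemma ell2_lact_delta: "lact ell2 s (delta g) = delta (s + g)"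
  by (auto simp: ell2_def delta_def fun_eq_iff)

lemma ell2_ract_delta: "ract ell2 (delta g) t = delta (g + t)"
  by (auto simp: ell2_def delta_def fun_eq_iff diff_eq_eq)

definition alg_to_ell2 :: "('g::group_add \<Rightarrow>\<^sub>0 complex) \<Rightarrow> 'g \<Rightarrow> complex" where
  "alg_to_ell2 x = lalg ell2 x (delta 0)"

lemma alg_to_ell2_eq_lookup: "alg_to_ell2 x = Poly_Mapping.lookup x"
proof
  fix g
  have sum_apply: "(\<Sum>s\<in>S. f s) g = (\<Sum>s\<in>S. f s g)" for S and f :: "'a \<Rightarrow> 'a \<Rightarrow> complex"
    by (induction S rule: infinite_finite_induct) auto
  show "alg_to_ell2 x g = Poly_Mapping.lookup x g"
    unfolding alg_to_ell2_def lalg_def ell2_lact_delta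
    by (simp add: sum_apply scaleC_fun_def scaleC_complex_def delta_def
        if_distrib[of "(*) _"] in_keys_iff cong: if_cong)
qed

definition alg_trace :: "('g::group_add \<Rightarrow>\<^sub>0 complex) \<Rightarrow> complex" where
  "alg_trace x = cinner ell2 (lalg ell2 x (delta 0)) (delta 0)"

definition is_coefficient ::
  "('a::complex_vector, 'g::group_add, 'm) bimod_scheme \<Rightarrow> 'a \<Rightarrow>
    (('g \<Rightarrow>\<^sub>0 complex) \<Rightarrow> ('g \<Rightarrow>\<^sub>0 complex)) \<Rightarrow> bool" where
  "is_coefficient H \<xi> T \<longleftrightarrow>
     (\<forall>x y. alg_trace (T x * y) = cinner H (ralg H (lalg H x \<xi>) y) \<xi>)"

definition coefficient_in_schatten ::
  "real \<Rightarrow> ('a::complex_vector, 'g::group_add, 'm) bimod_scheme \<Rightarrow> 'a \<Rightarrow> bool" where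
  "coefficient_in_schatten p H \<xi> \<longleftrightarrow>
     (\<exists>T. is_coefficient H \<xi> T \<and>
       (\<exists>A \<in> schatten_class p (ell2 :: ('g \<Rightarrow> complex, 'g) bimod).
          \<forall>x. A (alg_to_ell2 x) = alg_to_ell2 (T x)))"


section \<open>Tensor products\<close>

text \<open>
  The Hilbert space tensor product \<open>H\<^sub>1 \<otimes> \<dots> \<otimes> H\<^sub>n\<close> is realised as in Kadison--Ringrose,
  Section 2.6, by Hilbert--Schmidt functionals: a tensor \<open>u\<close> is the bounded function
  \<open>\<phi>(\<eta>\<^sub>1, \<dots>, \<eta>\<^sub>n) = \<langle>u, \<eta>\<^sub>1 \<otimes> \<dots> \<otimes> \<eta>\<^sub>n\<rangle>\<close>, conjugate-linear in each variable, whose values on tuples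
  of vectors from orthonormal bases are square summable. Square summability and the inner
  product do not depend on the orthonormal bases, so some are chosen. Functionals are zero off
  the tuples of vectors of the right spaces.
\<close>

definition is_onb :: "('a::complex_vector, 'm) inner_space_scheme \<Rightarrow> 'a set \<Rightarrow> bool" where
  "is_onb H B \<longleftrightarrow>
     orthonormal_on H B (\<lambda>b. b) \<and> (\<forall>x\<in>vecs H. (\<forall>b\<in>B. cinner H x b = 0) \<longrightarrow> x = 0)"

definition onb :: "('a::complex_vector, 'm) inner_space_scheme \<Rightarrow> 'a set" where
  "onb H = (SOME B. is_onb H B)"

definition tuples :: "('a, 'm) inner_space_scheme list \<Rightarrow> 'a list set" where
  "tuples Hs = listset (map vecs Hs)"

definition onb_tuples :: "('a::complex_vector, 'm) inner_space_scheme list \<Rightarrow> 'a list set" where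
  "onb_tuples Hs = listset (map onb Hs)"

definition bounded_multi_antilinear ::
  "('a::complex_vector, 'm) inner_space_scheme list \<Rightarrow> ('a list \<Rightarrow> complex) \<Rightarrow> bool" where
  "bounded_multi_antilinear Hs \<phi> \<longleftrightarrow>
     (\<forall>\<eta>\<in>tuples Hs. \<forall>i<length Hs. \<forall>a\<in>vecs (Hs ! i). \<forall>b\<in>vecs (Hs ! i).
        \<phi> (\<eta>[i := a + b]) = \<phi> (\<eta>[i := a]) + \<phi> (\<eta>[i := b])) \<and>
     (\<forall>\<eta>\<in>tuples Hs. \<forall>i<length Hs. \<forall>a\<in>vecs (Hs ! i). \<forall>c.
        \<phi> (\<eta>[i := scaleC c a]) = cnj c * \<phi> (\<eta>[i := a])) \<and>
     (\<exists>C. \<forall>\<eta>\<in>tuples Hs. cmod (\<phi> \<eta>) \<le> C * (\<Prod>i<length Hs. hnorm (Hs ! i) (\<eta> ! i)))"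

definition tensor_space ::
  "('a::complex_vector, 'm) inner_space_scheme list \<Rightarrow> ('a list \<Rightarrow> complex) inner_space" where
  "tensor_space Hs =
     \<lparr> vecs = {\<phi>. bounded_multi_antilinear Hs \<phi> \<and> (\<forall>\<eta>. \<eta> \<notin> tuples Hs \<longrightarrow> \<phi> \<eta> = 0) \<and>
                 (\<lambda>e. (cmod (\<phi> e))\<^sup>2) summable_on onb_tuples Hs},
       cinner = (\<lambda>\<phi> \<psi>. \<Sum>\<^sub>\<infinity>e\<in>onb_tuples Hs. \<phi> e * cnj (\<psi> e)) \<rparr>"

definition pure_tensor ::
  "('a, 'm) inner_space_scheme list \<Rightarrow> 'a list \<Rightarrow> 'a list \<Rightarrow> complex" where
  "pure_tensor Hs \<xi> =
     (\<lambda>\<eta>. if \<eta> \<in> tuples Hs then \<Prod>i<length Hs. cinner (Hs ! i) (\<xi> ! i) (\<eta> ! i) else 0)"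

text \<open>
  For unitaries \<open>U\<^sub>i\<close> with inverses \<open>V\<^sub>i\<close>, the operator \<open>U\<^sub>1 \<otimes> \<dots> \<otimes> U\<^sub>n\<close> is composition of functionals
  with \<open>V\<^sub>1 \<times> \<dots> \<times> V\<^sub>n\<close>, because \<open>\<langle>(U\<^sub>1 \<otimes> \<dots> \<otimes> U\<^sub>n) u, \<eta>\<^sub>1 \<otimes> \<dots> \<otimes> \<eta>\<^sub>n\<rangle> = \<langle>u, V\<^sub>1 \<eta>\<^sub>1 \<otimes> \<dots> \<otimes> V\<^sub>n \<eta>\<^sub>n\<rangle>\<close>. The
  argument \<open>Vs\<close> is the list of the inverses. The lemmas below confirm the resulting actions
  on pure tensors.
\<close>

definition tensor_unitary ::
  "('a, 'm) inner_space_scheme list \<Rightarrow> ('a \<Rightarrow> 'a) list \<Rightarrow> ('a list \<Rightarrow> complex) \<Rightarrow>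
    'a list \<Rightarrow> complex" where
  "tensor_unitary Hs Vs \<phi> = (\<lambda>\<eta>. if \<eta> \<in> tuples Hs then \<phi> (map2 (\<lambda>V x. V x) Vs \<eta>) else 0)"

definition diagonal_tensor ::
  "('a::complex_vector, 'g::group_add, 'm) bimod_scheme list \<Rightarrow> ('a list \<Rightarrow> complex, 'g) bimod" where
  "diagonal_tensor Hs =
     \<lparr> vecs = vecs (tensor_space Hs),
       cinner = cinner (tensor_space Hs),
       lact = (\<lambda>s. tensor_unitary Hs (map (\<lambda>H. lact H (- s)) Hs)),
       ract = (\<lambda>\<phi> t. tensor_unitary Hs (map (\<lambda>H \<eta>. ract H \<eta> (- t)) Hs) \<phi>) \<rparr>"

definition tensor_power ::
  "nat \<Rightarrow> ('a::complex_vector, 'g::group_add, 'm) bimod_scheme \<Rightarrow> ('a list \<Rightarrow> complex, 'g) bimod"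
  where "tensor_power n H = diagonal_tensor (replicate n H)"

definition coarse :: "(('g::group_add \<Rightarrow> complex) list \<Rightarrow> complex, 'g) bimod" where
  "coarse =
     \<lparr> vecs = vecs (tensor_space [ell2, ell2]),
       cinner = cinner (tensor_space [ell2, ell2]),
       lact = (\<lambda>s. tensor_unitary [ell2, ell2] [lact ell2 (- s), \<lambda>f. f]),
       ract = (\<lambda>\<phi> t. tensor_unitary [ell2, ell2] [\<lambda>f. f, \<lambda>f. ract ell2 f (- t)] \<phi>) \<rparr>"

lemma mem_tuples_iff:
  "\<eta> \<in> tuples Hs \<longleftrightarrow> length \<eta> = length Hs \<and> (\<forall>i<length Hs. \<eta> ! i \<in> vecs (Hs ! i))"
proof (induction Hs arbitrary: \<eta>)
  case Nil
  show ?case by (auto simp: tuples_def)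
next
  case (Cons H Hs)
  show ?case
    using Cons.IH
    by (cases \<eta>) (auto simp: tuples_def set_Cons_def less_Suc_eq_0_disj)
qed

lemma tensor_unitary_pure_tensor:
  assumes "length Us = length Hs" "length Vs = length Hs" "\<xi> \<in> tuples Hs"
    and V: "\<And>i \<eta>. \<lbrakk>i < length Hs; \<eta> \<in> vecs (Hs ! i)\<rbrakk> \<Longrightarrow> (Vs ! i) \<eta> \<in> vecs (Hs ! i)"
    and adj: "\<And>i x y. \<lbrakk>i < length Hs; x \<in> vecs (Hs ! i); y \<in> vecs (Hs ! i)\<rbrakk> \<Longrightarrow>
      cinner (Hs ! i) ((Us ! i) x) y = cinner (Hs ! i) x ((Vs ! i) y)"
  shows "tensor_unitary Hs Vs (pure_tensor Hs \<xi>) = pure_tensor Hs (map2 (\<lambda>U x. U x) Us \<xi>)"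
  using assms
  by (auto simp: tensor_unitary_def pure_tensor_def mem_tuples_iff fun_eq_iff intro!: prod.cong)

context bimodule
begin

lemma lact_adjoint:
  assumes "x \<in> vecs H" "y \<in> vecs H"
  shows "cinner H (lact H s x) y = cinner H x (lact H (- s) y)"
proof -
  have "cinner H (lact H s x) y = cinner H (lact H (- s) (lact H s x)) (lact H (- s) y)"
    using lact_isometric[of s] lact_isometric[of "- s"] assms
    by (auto simp: isometric_between_def linear_between_def)
  also have "lact H (- s) (lact H s x) = x"
    using lact_add[of x "- s" s] lact_zero assms by simp
  finally show ?thesis .
qed

lemma ract_adjoint:
  assumes "x \<in> vecs H" "y \<in> vecs H"
  shows "cinner H (ract H x t) y = cinner H x (ract H y (- t))"
proof -
  have "cinner H (ract H x t) y = cinner H (ract H (ract H x t) (- t)) (ract H y (- t))"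
    using ract_isometric[of t] ract_isometric[of "- t"] assms
    by (auto simp: isometric_between_def linear_between_def)
  also have "ract H (ract H x t) (- t) = x"
    using ract_add[of x t "- t"] ract_zero assms by simp
  finally show ?thesis .
qed

lemma lact_vecs: "x \<in> vecs H \<Longrightarrow> lact H s x \<in> vecs H"
  and ract_vecs: "x \<in> vecs H \<Longrightarrow> ract H x t \<in> vecs H"
  using lact_isometric[of s] ract_isometric[of t]
  by (auto simp: isometric_between_def linear_between_def)

lemma tensor_power_lact_pure:
  assumes "\<xi> \<in> tuples (replicate n H)"
  shows "lact (tensor_power n H) s (pure_tensor (replicate n H) \<xi>) =
    pure_tensor (replicate n H) (map (lact H s) \<xi>)"
proof -
  have "map2 (\<lambda>U x. U x) (map (lact H) (replicate n s)) \<xi> = map (lact H s) \<xi>"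
    using assms by (auto simp: mem_tuples_iff intro!: nth_equalityI)
  then show ?thesis
    using assms tensor_unitary_pure_tensor[of "map (lact H) (replicate n s)" "replicate n H"
        "map (\<lambda>H. lact H (- s)) (replicate n H)" \<xi>]
    by (simp add: tensor_power_def diagonal_tensor_def lact_adjoint lact_vecs)
qed

lemma tensor_power_ract_pure:
  assumes "\<xi> \<in> tuples (replicate n H)"
  shows "ract (tensor_power n H) (pure_tensor (replicate n H) \<xi>) t =
    pure_tensor (replicate n H) (map (\<lambda>x. ract H x t) \<xi>)"
proof -
  have "map2 (\<lambda>U x. U x) (replicate n (\<lambda>x. ract H x t)) \<xi> = map (\<lambda>x. ract H x t) \<xi>"
    using assms by (auto simp: mem_tuples_iff intro!: nth_equalityI)
  then show ?thesis
    using assms tensor_unitary_pure_tensor[of "replicate n (\<lambda>x. ract H x t)" "replicate n H"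
        "map (\<lambda>H \<eta>. ract H \<eta> (- t)) (replicate n H)" \<xi>]
    by (simp add: tensor_power_def diagonal_tensor_def ract_adjoint ract_vecs)
qed

end

lemma ell2_lact_adjoint: "cinner ell2 (lact ell2 s f) h = cinner ell2 f (lact ell2 (- s) h)"
  using infsum_reindex_bij_betw[of "\<lambda>g. s + g" UNIV UNIV "\<lambda>g. f (- s + g) * cnj (h g)"]
    bij_betw_byWitness[of UNIV "\<lambda>g. - s + g" "\<lambda>g. s + g" UNIV]
  by (simp add: ell2_def add.assoc[symmetric])

lemma ell2_ract_adjoint: "cinner ell2 (ract ell2 f t) h = cinner ell2 f (ract ell2 h (- t))"
  using infsum_reindex_bij_betw[of "\<lambda>g. g + t" UNIV UNIV "\<lambda>g. f (g - t) * cnj (h g)"]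
    bij_betw_byWitness[of UNIV "\<lambda>g. g - t" "\<lambda>g. g + t" UNIV]
  by (simp add: ell2_def)

lemma ell2_lact_vecs: "f \<in> vecs ell2 \<Longrightarrow> lact ell2 s f \<in> vecs ell2"
  using summable_on_reindex_bij_betw[of "\<lambda>g. - s + g" UNIV UNIV "\<lambda>g. (cmod (f g))\<^sup>2"]
    bij_betw_byWitness[of UNIV "\<lambda>g. s + g" "\<lambda>g. - s + g" UNIV]
  by (simp add: ell2_def add.assoc[symmetric])

lemma ell2_ract_vecs: "f \<in> vecs ell2 \<Longrightarrow> ract ell2 f t \<in> vecs ell2"
  using summable_on_reindex_bij_betw[of "\<lambda>g. g - t" UNIV UNIV "\<lambda>g. (cmod (f g))\<^sup>2"]
    bij_betw_byWitness[of UNIV "\<lambda>g. g + t" "\<lambda>g. g - t" UNIV]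
  by (simp add: ell2_def)

lemma coarse_lact_pure:
  assumes "f \<in> vecs ell2" "h \<in> vecs ell2"
  shows "lact coarse s (pure_tensor [ell2, ell2] [f, h]) = pure_tensor [ell2, ell2] [lact ell2 s f, h]"
proof -
  have "tensor_unitary [ell2, ell2] [lact ell2 (- s), \<lambda>f. f] (pure_tensor [ell2, ell2] [f, h]) =
    pure_tensor [ell2, ell2] (map2 (\<lambda>U x. U x) [lact ell2 s, \<lambda>f. f] [f, h])"
    using assms
    by (intro tensor_unitary_pure_tensor)
      (auto simp: mem_tuples_iff less_Suc_eq_0_disj ell2_lact_adjoint ell2_lact_vecs)
  then show ?thesis by (simp add: coarse_def)
qed

lemma coarse_ract_pure:
  assumes "f \<in> vecs ell2" "h \<in> vecs ell2"
  shows "ract coarse (pure_tensor [ell2, ell2] [f, h]) t = pure_tensor [ell2, ell2] [f, ract ell2 h t]"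
proof -
  have "tensor_unitary [ell2, ell2] [\<lambda>f. f, \<lambda>f. ract ell2 f (- t)] (pure_tensor [ell2, ell2] [f, h]) =
    pure_tensor [ell2, ell2] (map2 (\<lambda>U x. U x) [\<lambda>f. f, \<lambda>f. ract ell2 f t] [f, h])"
    using assms
    by (intro tensor_unitary_pure_tensor)
      (auto simp: mem_tuples_iff less_Suc_eq_0_disj ell2_ract_adjoint ell2_ract_vecs)
  then show ?thesis by (simp add: coarse_def)
qed

end

(*
  Write \<Lambda> = \<Gamma> \<times> \<Gamma>, acting on K = H^{\<otimes> n} by \<pi>(s,t) \<xi> = s \<xi> t^{-1}. The coarse bimodule is \<ell>_2(\<Lambda>).
  Each coefficient of \<xi> \<in> D is the matrix (\<langle>s \<xi> t, \<xi>\<rangle>) of an operator in S_p \<subseteq> S_{2n}, so by Jensen's inequality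
  its entries lie in \<ell>_{2n}(\<Lambda>); the coefficients of \<xi>_1 \<otimes> ... \<otimes> \<xi>_n are products of n of them, hence lie in
  \<ell>_2(\<Lambda>), and these vectors are total in K.

  If \<langle>\<xi>, \<pi>(g) \<xi>\<rangle> is square summable, then V x = (\<langle>x, \<pi>(g) \<xi>\<rangle>)_g is a densely defined closed operator, and
  w = (1 + V^* V)^{-1} \<xi> is a Bessel vector: \<Sum>_g |\<langle>x, \<pi>(g) w\<rangle>|^2 \<le> |x|^2 for all x. So Bessel vectors separate
  the points of K. By Zorn's lemma there is a maximal set B with
    \<Sum>_{w \<in> B} \<Sum>_g |\<langle>x, \<pi>(g) w\<rangle>|^2 \<le> |x|^2 for all x.
  Equality holds: with R = 1 - (frame operator of B), 0 \<le> R \<le> 1, and a Bessel vector w one has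
  \<Sum>_g |\<langle>x, \<pi>(g) R w\<rangle>|^2 \<le> |R x|^2 \<le> \<langle>R x, x\<rangle>, so B could be enlarged by R w unless R = 0. Therefore
  x \<mapsto> (\<langle>x, \<pi>(g) w\<rangle>)_{w, g} embeds K isometrically and equivariantly into a direct sum of copies of \<ell>_2(\<Lambda>).
*)

theory Submission
  imports Defs
begin

text \<open>The exponent: in general the entries of an operator in S_q lie in l_q only from q = 2
  on, because a single column is merely in l_2. So p is first raised to the even exponent 2n, which
  uses both n >= p/2 and n >= 1. The embedding: the polar part of the unbounded V would intertwine
  with l_2 of the group directly, but it calls for the spectral theory of V. The operator (1 + V*
  V)^{-1} calls only for Riesz representation in the domain of V with the graph norm, and it
  commutes with pi because that norm is invariant. The price is a contraction in place of a partial
  isometry. The exhaustion: orthogonal cyclic subspaces would require good vectors inside each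
  successive complement. A Bessel bound tolerates overlap, so any good vector of K can be used once
  R has cut it down. The maximal B is a set of vectors of K, hence itself an index set of the kind
  prescribed by quasi-containment; but a set cannot repeat a vector, and this is where a rescaling
  enters.\<close>

section \<open>Semi-inner products\<close>

text \<open>Definiteness and completeness are left out because the form of the remainder R of a
  Bessel family is only semidefinite, and it still has to satisfy the Cauchy-Schwarz inequality.
  Direct sums are treated at this level as well.\<close>

locale semi_inner_space =
  fixes H :: "('a::complex_vector, 'm) inner_space_scheme"
  assumes subspace: "complex_vector.subspace (vecs H)"
    and add_left: "\<lbrakk>x \<in> vecs H; y \<in> vecs H; z \<in> vecs H\<rbrakk> \<Longrightarrow>
      cinner H (x + y) z = cinner H x z + cinner H y z"
    and scaleC_left: "\<lbrakk>x \<in> vecs H; y \<in> vecs H\<rbrakk> \<Longrightarrow>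
      cinner H (scaleC c x) y = c * cinner H x y"
    and commute: "\<lbrakk>x \<in> vecs H; y \<in> vecs H\<rbrakk> \<Longrightarrow> cinner H x y = cnj (cinner H y x)"
    and nonneg: "x \<in> vecs H \<Longrightarrow> 0 \<le> Re (cinner H x x)"
begin

lemma zero_mem [simp]: "0 \<in> vecs H"
  using subspace by (rule complex_vector.subspace_0)

lemma add_mem [simp]: "x \<in> vecs H \<Longrightarrow> y \<in> vecs H \<Longrightarrow> x + y \<in> vecs H"
  using subspace by (rule complex_vector.subspace_add)

lemma diff_mem [simp]: "x \<in> vecs H \<Longrightarrow> y \<in> vecs H \<Longrightarrow> x - y \<in> vecs H"
  using subspace by (rule complex_vector.subspace_diff)

lemma scaleC_mem [simp]: "x \<in> vecs H \<Longrightarrow> scaleC c x \<in> vecs H"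
  using subspace by (rule complex_vector.subspace_scale)

lemma sum_mem: "(\<And>i. i \<in> I \<Longrightarrow> f i \<in> vecs H) \<Longrightarrow> (\<Sum>i\<in>I. f i) \<in> vecs H"
  using subspace by (rule complex_vector.subspace_sum)

lemma zero_left [simp]: "y \<in> vecs H \<Longrightarrow> cinner H 0 y = 0"
  using scaleC_left[of 0 y 0] by simp

lemma zero_right [simp]: "y \<in> vecs H \<Longrightarrow> cinner H y 0 = 0"
  using commute[of y 0] by simp

lemma add_right:
  "\<lbrakk>x \<in> vecs H; y \<in> vecs H; z \<in> vecs H\<rbrakk> \<Longrightarrow> cinner H x (y + z) = cinner H x y + cinner H x z"
  using commute[of x "y + z"] commute[of x y] commute[of x z] by (simp add: add_left)

lemma scaleC_right:
  "\<lbrakk>x \<in> vecs H; y \<in> vecs H\<rbrakk> \<Longrightarrow> cinner H x (scaleC c y) = cnj c * cinner H x y"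
  using commute[of x "scaleC c y"] commute[of x y] by (simp add: scaleC_left)

lemma diff_left:
  "\<lbrakk>x \<in> vecs H; y \<in> vecs H; z \<in> vecs H\<rbrakk> \<Longrightarrow> cinner H (x - y) z = cinner H x z - cinner H y z"
  using add_left[of "x - y" y z] by simp

lemma diff_right:
  "\<lbrakk>x \<in> vecs H; y \<in> vecs H; z \<in> vecs H\<rbrakk> \<Longrightarrow> cinner H x (y - z) = cinner H x y - cinner H x z"
  using add_right[of x "y - z" z] by simp

lemma sum_left:
  assumes "\<And>i. i \<in> I \<Longrightarrow> f i \<in> vecs H" "y \<in> vecs H"
  shows "cinner H (\<Sum>i\<in>I. f i) y = (\<Sum>i\<in>I. cinner H (f i) y)"
  using assms
  by (induction I rule: infinite_finite_induct) (auto simp: add_left sum_mem)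

lemma cinner_self: "x \<in> vecs H \<Longrightarrow> cinner H x x = complex_of_real ((hnorm H x)\<^sup>2)"
  using commute[of x x] nonneg[of x] by (simp add: hnorm_def complex_eq_iff)

lemma hnorm_sq: "x \<in> vecs H \<Longrightarrow> (hnorm H x)\<^sup>2 = Re (cinner H x x)"
  using nonneg[of x] by (simp add: hnorm_def)

lemma hnorm_nonneg [simp]: "x \<in> vecs H \<Longrightarrow> 0 \<le> hnorm H x"
  using nonneg[of x] by (simp add: hnorm_def)

lemma hnorm_zero [simp]: "hnorm H 0 = 0"
  by (simp add: hnorm_def)

lemma hnorm_scaleC: "x \<in> vecs H \<Longrightarrow> hnorm H (scaleC c x) = cmod c * hnorm H x"
proof -
  assume x: "x \<in> vecs H"
  have "cinner H (scaleC c x) (scaleC c x) = of_real ((cmod c * hnorm H x)\<^sup>2)"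
    using x unfolding power_mult_distrib of_real_mult cinner_self[OF x, symmetric] of_real_power[of "cmod c"]
      complex_norm_square
    by (simp add: scaleC_left scaleC_right)
  then have "hnorm H (scaleC c x) = sqrt ((cmod c * hnorm H x)\<^sup>2)"
    unfolding hnorm_def[of _ "scaleC c x"] by (simp only: Re_complex_of_real)
  then show ?thesis using x by simp
qed

lemma hnorm_minus_commute: "x \<in> vecs H \<Longrightarrow> y \<in> vecs H \<Longrightarrow> hnorm H (x - y) = hnorm H (y - x)"
  by (simp add: hnorm_def diff_left diff_right algebra_simps)

lemma hnorm_add_sq:
  "\<lbrakk>x \<in> vecs H; y \<in> vecs H\<rbrakk> \<Longrightarrow>
    (hnorm H (x + y))\<^sup>2 = (hnorm H x)\<^sup>2 + (hnorm H y)\<^sup>2 + 2 * Re (cinner H x y)"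
  using commute[of x y] by (simp add: hnorm_sq add_left add_right)

lemma hnorm_diff_sq:
  "\<lbrakk>x \<in> vecs H; y \<in> vecs H\<rbrakk> \<Longrightarrow>
    (hnorm H (x - y))\<^sup>2 = (hnorm H x)\<^sup>2 + (hnorm H y)\<^sup>2 - 2 * Re (cinner H x y)"
  using commute[of x y] by (simp add: hnorm_sq diff_left diff_right)

text \<open>With c = <x, y>, the squared norm of x - t c y is a quadratic polynomial in the real
  number t that never becomes negative. The form may be degenerate, so vanishing norm of
  \<open>y\<close> does not mean \<open>y = 0\<close> and is a case of its own.\<close>

lemma cauchy_schwarz:
  assumes x: "x \<in> vecs H" and y: "y \<in> vecs H"
  shows "cmod (cinner H x y) \<le> hnorm H x * hnorm H y"
proof -
  define c where "c = cinner H x y"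
  have q: "0 \<le> (hnorm H x)\<^sup>2 + t\<^sup>2 * (cmod c)\<^sup>2 * (hnorm H y)\<^sup>2 - 2 * t * (cmod c)\<^sup>2" for t
  proof -
    have "0 \<le> (hnorm H (x - scaleC (of_real t * c) y))\<^sup>2" by simp
    also have "\<dots> = (hnorm H x)\<^sup>2 + t\<^sup>2 * (cmod c)\<^sup>2 * (hnorm H y)\<^sup>2 - 2 * t * (cmod c)\<^sup>2"
    proof -
      have "Re (cnj (of_real t * c) * c) = t * (cmod c)\<^sup>2"
        unfolding cmod_power2 by (simp add: power2_eq_square algebra_simps)
      then show ?thesis
        using x y by (simp add: hnorm_diff_sq scaleC_right hnorm_scaleC c_def[symmetric]
            norm_mult power_mult_distrib)
    qed
    finally show ?thesis .
  qed
  have "(cmod c)\<^sup>2 \<le> (hnorm H x)\<^sup>2 * (hnorm H y)\<^sup>2"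
  proof (cases "hnorm H y = 0")
    case True
    show ?thesis
    proof (rule ccontr)
      assume "\<not> ?thesis"
      then have "(cmod c)\<^sup>2 > 0" using True by simp
      \<comment> \<open>The polynomial is affine here, and at this t its value is -1.\<close>
      then show False using q[of "((hnorm H x)\<^sup>2 + 1) / (2 * (cmod c)\<^sup>2)"] True
        by (simp add: field_simps)
    qed
  next
    case False
    then have y2: "(hnorm H y)\<^sup>2 > 0" by simp
    \<comment> \<open>The minimum of the polynomial is at t = 1 / |y|^2.\<close>
    have "(1 / (hnorm H y)\<^sup>2)\<^sup>2 * (cmod c)\<^sup>2 * (hnorm H y)\<^sup>2 = (cmod c)\<^sup>2 / (hnorm H y)\<^sup>2"
      using False by (simp add: power2_eq_square)
    then have "(cmod c)\<^sup>2 / (hnorm H y)\<^sup>2 \<le> (hnorm H x)\<^sup>2"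
      using q[of "1 / (hnorm H y)\<^sup>2"] by simp
    then show ?thesis using y2 by (simp add: pos_divide_le_eq)
  qed
  then have "(cmod c)\<^sup>2 \<le> (hnorm H x * hnorm H y)\<^sup>2" by (simp add: power_mult_distrib)
  then show ?thesis unfolding c_def by (rule power2_le_imp_le) (use x y in simp)
qed

lemma triangle:
  assumes "x \<in> vecs H" "y \<in> vecs H"
  shows "hnorm H (x + y) \<le> hnorm H x + hnorm H y"
proof (rule power2_le_imp_le)
  have "Re (cinner H x y) \<le> hnorm H x * hnorm H y"
    by (rule order_trans[OF complex_Re_le_cmod cauchy_schwarz[OF assms]])
  then show "(hnorm H (x + y))\<^sup>2 \<le> (hnorm H x + hnorm H y)\<^sup>2"
    using assms by (simp add: hnorm_add_sq power2_sum)
qed (use assms in simp)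

lemma triangle_diff:
  assumes "x \<in> vecs H" "y \<in> vecs H" "z \<in> vecs H"
  shows "hnorm H (x - z) \<le> hnorm H (x - y) + hnorm H (y - z)"
  using triangle[of "x - y" "y - z"] assms by simp

lemma hnorm_diff_ge:
  assumes "x \<in> vecs H" "y \<in> vecs H"
  shows "\<bar>hnorm H x - hnorm H y\<bar> \<le> hnorm H (x - y)"
  using triangle[of "x - y" y] triangle[of "y - x" x] assms
  by (simp add: hnorm_minus_commute[of x y])

lemma tendsto_cinner_left:
  assumes "\<And>k. X k \<in> vecs H" "x \<in> vecs H" "y \<in> vecs H" "(\<lambda>k. hnorm H (X k - x)) \<longlonglongrightarrow> 0"
  shows "(\<lambda>k. cinner H (X k) y) \<longlonglongrightarrow> cinner H x y"
proof (rule Lim_null_comparison[THEN LIM_zero_cancel])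
  show "\<forall>\<^sub>F k in sequentially. norm (cinner H (X k) y - cinner H x y) \<le> hnorm H (X k - x) * hnorm H y"
    using assms cauchy_schwarz[of "X _ - x" y] by (simp add: diff_left)
  show "(\<lambda>k. hnorm H (X k - x) * hnorm H y) \<longlonglongrightarrow> 0"
    using assms(4) tendsto_mult_left_zero by blast
qed

lemma tendsto_hnorm:
  assumes "\<And>k. X k \<in> vecs H" "x \<in> vecs H" "((\<lambda>k. hnorm H (X k - x)) \<longlongrightarrow> 0) F"
  shows "((\<lambda>k. hnorm H (X k)) \<longlongrightarrow> hnorm H x) F"
proof (rule Lim_null_comparison[THEN LIM_zero_cancel])
  show "\<forall>\<^sub>F k in F. norm (hnorm H (X k) - hnorm H x) \<le> hnorm H (X k - x)"
    using assms hnorm_diff_ge[of "X _" x] by simp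
qed (rule assms(3))

lemma convergent_Cauchy:
  assumes "\<And>k. X k \<in> vecs H" "x \<in> vecs H" "(\<lambda>k. hnorm H (X k - x)) \<longlonglongrightarrow> 0" "0 < e"
  shows "\<exists>N. \<forall>k\<ge>N. \<forall>l\<ge>N. hnorm H (X k - X l) < e"
proof -
  from assms(3) have "\<forall>\<^sub>F k in sequentially. hnorm H (X k - x) < e / 2"
    by (rule order_tendstoD) (use assms(4) in simp)
  then obtain N where N: "\<And>k. k \<ge> N \<Longrightarrow> hnorm H (X k - x) < e / 2"
    by (auto simp: eventually_sequentially)
  have "hnorm H (X k - X l) < e" if "k \<ge> N" "l \<ge> N" for k l
    using N[OF that(1)] N[OF that(2)] triangle_diff[of "X k" x "X l"] assms
    by (simp add: hnorm_minus_commute[of x "X l"])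
  then show ?thesis by blast
qed

text \<open>Pythagoras: with \<open>y\<close> the projection of \<open>x\<close> onto the span of
  the \<open>u j\<close>, the squared norm of \<open>y - x\<close> is the difference of the two
  sides, since <y, x> and <y, y> both equal the sum on the left.\<close>

lemma bessel:
  assumes u: "orthonormal_on H J u" and F: "finite F" "F \<subseteq> J" and x: "x \<in> vecs H"
  shows "(\<Sum>j\<in>F. (cmod (cinner H x (u j)))\<^sup>2) \<le> (hnorm H x)\<^sup>2"
proof -
  have uv: "u j \<in> vecs H" if "j \<in> F" for j using u F that by (auto simp: orthonormal_on_def)
  define y where "y = (\<Sum>j\<in>F. scaleC (cinner H x (u j)) (u j))"
  have y: "y \<in> vecs H" unfolding y_def by (intro sum_mem) (use uv in simp)
  have xy: "cinner H y z = (\<Sum>j\<in>F. cinner H x (u j) * cinner H (u j) z)" if "z \<in> vecs H" for z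
    unfolding y_def using that uv by (simp add: sum_left scaleC_left)
  have yu: "cinner H y (u j) = cinner H x (u j)" if "j \<in> F" for j
  proof -
    have "cinner H y (u j) = (\<Sum>i\<in>F. cinner H x (u i) * cinner H (u i) (u j))"
      using xy uv that by simp
    also have "\<dots> = (\<Sum>i\<in>F. if i = j then cinner H x (u i) else 0)"
      by (intro sum.cong refl) (use u F that in \<open>auto simp: orthonormal_on_def subset_iff\<close>)
    finally show ?thesis using F that by simp
  qed
  have uy: "cinner H (u j) y = cnj (cinner H x (u j))" if "j \<in> F" for j
    using commute[of "u j" y] yu[OF that] uv[OF that] y by simp
  have ux: "cinner H (u j) x = cnj (cinner H x (u j))" if "j \<in> F" for j
    using commute[of "u j" x] uv[OF that] x by simp
  have s: "Re (cinner H y z) = (\<Sum>j\<in>F. (cmod (cinner H x (u j)))\<^sup>2)"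
    if "z \<in> vecs H" "\<And>j. j \<in> F \<Longrightarrow> cinner H (u j) z = cnj (cinner H x (u j))" for z
    using that by (simp add: xy complex_norm_square[symmetric] flip: of_real_power of_real_sum)
  have "0 \<le> (hnorm H (y - x))\<^sup>2" by simp
  also have "\<dots> = (hnorm H x)\<^sup>2 - (\<Sum>j\<in>F. (cmod (cinner H x (u j)))\<^sup>2)"
    using s[OF x ux] s[OF y uy] x y by (simp add: hnorm_diff_sq hnorm_sq[OF y])
  finally show ?thesis by simp
qed

lemma hnorm_orthonormal_sum:
  assumes u: "orthonormal_on H J u" and F: "finite F" "F \<subseteq> J"
  shows "(hnorm H (\<Sum>j\<in>F. scaleC (c j) (u j)))\<^sup>2 = (\<Sum>j\<in>F. (cmod (c j))\<^sup>2)"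
  using F
proof (induction F rule: finite_induct)
  case (insert j F)
  have uv: "u i \<in> vecs H" if "i \<in> insert j F" for i
    using u insert.prems that by (auto simp: orthonormal_on_def)
  have s: "(\<Sum>j\<in>F. scaleC (c j) (u j)) \<in> vecs H" by (intro sum_mem) (use uv in simp)
  have "cinner H (\<Sum>i\<in>F. scaleC (c i) (u i)) (u j) = (\<Sum>i\<in>F. c i * cinner H (u i) (u j))"
    using uv by (simp add: sum_left scaleC_left)
  also have "\<dots> = 0"
    by (intro sum.neutral) (use u insert in \<open>auto simp: orthonormal_on_def subset_iff\<close>)
  finally have 0: "cinner H (\<Sum>i\<in>F. scaleC (c i) (u i)) (u j) = 0" .
  have "hnorm H (u j) = 1" using u insert.prems by (auto simp: orthonormal_on_def hnorm_def)
  then show ?case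
    using insert s uv 0
    by (simp add: hnorm_add_sq hnorm_scaleC add.commute[of "scaleC (c j) (u j)"] scaleC_right)
qed simp

end

sublocale hilbert_space \<subseteq> semi_inner_space H
  by unfold_locales
    (fact subspace_vecs cinner_add_left cinner_scaleC_left cinner_commute cinner_nonneg)+

context hilbert_space
begin

lemma hnorm_eq_0: "x \<in> vecs H \<Longrightarrow> hnorm H x = 0 \<longleftrightarrow> x = 0"
  using cinner_self[of x] cinner_definite[of x] by auto

lemma cinner_ext:
  assumes "x \<in> vecs H" "y \<in> vecs H" "\<And>z. z \<in> vecs H \<Longrightarrow> cinner H z x = cinner H z y"
  shows "x = y"
  using assms(3)[of "x - y"] cinner_definite[of "x - y"] assms(1,2) by (simp add: diff_right)


end

section \<open>Riesz representation, square-summable families and orthonormal bases\<close>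

context hilbert_space begin
text \<open>If w represents f, then |x|^2 - 2 Re f(x) = |x - w|^2 - |w|^2, so w has to be the
  minimiser of the function \<open>q\<close>. A minimising sequence is Cauchy by the parallelogram
  law, and the first-order condition at its limit is the representation.\<close>

lemma riesz:
  assumes add: "\<And>x y. x \<in> vecs H \<Longrightarrow> y \<in> vecs H \<Longrightarrow> f (x + y) = f x + f y"
    and scale: "\<And>c x. x \<in> vecs H \<Longrightarrow> f (scaleC c x) = c * f x"
    and bound: "\<And>x. x \<in> vecs H \<Longrightarrow> cmod (f x) \<le> C * hnorm H x"
  shows "\<exists>w\<in>vecs H. \<forall>x\<in>vecs H. f x = cinner H x w"
proof -
  define q where "q x = (hnorm H x)\<^sup>2 - 2 * Re (f x)" for x
  define m where "m = (INF x\<in>vecs H. q x)"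
  have "- C\<^sup>2 \<le> q x" if "x \<in> vecs H" for x
  proof -
    have "Re (f x) \<le> C * hnorm H x" by (rule order_trans[OF complex_Re_le_cmod bound[OF that]])
    moreover have "0 \<le> (hnorm H x - C)\<^sup>2" by simp
    ultimately show ?thesis unfolding q_def power2_diff by (simp add: mult.commute)
  qed
  then have bdd: "bdd_below (q ` vecs H)" by (rule bdd_belowI2)
  have m_le: "m \<le> q x" if "x \<in> vecs H" for x
    unfolding m_def using bdd that by (rule cINF_lower)
  have "\<exists>x\<in>vecs H. q x < m + 1 / real (Suc k)" for k
    using cINF_less_iff[of "vecs H" q "m + 1 / real (Suc k)"] bdd zero_mem
    by (auto simp: m_def simp del: zero_mem)
  then obtain X where X: "\<And>k. X k \<in> vecs H" and Xq: "\<And>k. q (X k) < m + 1 / real (Suc k)"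
    by metis
  \<comment> \<open>Parallelogram law: the real-linear part of \<open>q\<close> cancels against the
    midpoint. As \<open>q\<close> at the midpoint is at least \<open>m\<close>, points with almost
    minimal \<open>q\<close> are close together.\<close>
  have par: "(hnorm H (x - y))\<^sup>2 = 2 * q x + 2 * q y - 4 * q (scaleC (1/2) (x + y))"
    if "x \<in> vecs H" "y \<in> vecs H" for x y
  proof -
    have n1: "hnorm H (scaleC (1/2) (x + y)) = hnorm H (x + y) / 2"
      using hnorm_scaleC[of "x + y" "1/2"] that by (simp add: norm_divide)
    have n2: "f (scaleC (1/2) (x + y)) = (f x + f y) / 2"
      using scale[of "x + y" "1/2"] add[OF that] that by simp
    have "4 * q (scaleC (1/2) (x + y)) = (hnorm H (x + y))\<^sup>2 - 4 * Re (f x) - 4 * Re (f y)"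
      unfolding q_def n1 n2 by (simp add: power_divide add_divide_distrib)
    moreover have "d = 2 * (n - 2 * u) + 2 * (m - 2 * v) - a"
      if "a = r - 4 * u - 4 * v" "r = n + m + 2 * c" "d = n + m - 2 * c"
      for a c d m n r u v :: real
      using that by (simp add: algebra_simps)
    ultimately show ?thesis
      unfolding q_def using hnorm_add_sq[OF that] hnorm_diff_sq[OF that] by blast
  qed
  have dist: "(hnorm H (X k - X l))\<^sup>2 \<le> 2 * (1 / real (Suc k)) + 2 * (1 / real (Suc l))" for k l
    using par[OF X X, of k l] Xq[of k] Xq[of l] m_le[OF scaleC_mem[OF add_mem[OF X X]], of "1/2" k l]
    by linarith
  have "\<exists>N. \<forall>k\<ge>N. \<forall>l\<ge>N. hnorm H (X k - X l) < e" if "e > 0" for e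
  proof -
    obtain N where N: "inverse (real (Suc N)) < e\<^sup>2 / 4"
      using reals_Archimedean[of "e\<^sup>2 / 4"] \<open>e > 0\<close> by auto
    have "hnorm H (X k - X l) < e" if "k \<ge> N" "l \<ge> N" for k l
    proof (rule power2_less_imp_less)
      have "1 / real (Suc k) \<le> inverse (real (Suc N))" "1 / real (Suc l) \<le> inverse (real (Suc N))"
        using that by (simp_all add: field_simps)
      then show "(hnorm H (X k - X l))\<^sup>2 < e\<^sup>2" using dist[of k l] N by linarith
    qed (use \<open>e > 0\<close> in simp)
    then show ?thesis by blast
  qed
  then obtain w where w: "w \<in> vecs H" and lim: "(\<lambda>k. hnorm H (X k - w)) \<longlonglongrightarrow> 0"
    using complete[of X] X by blast
  have f_diff: "f (x - y) = f x - f y" if "x \<in> vecs H" "y \<in> vecs H" for x y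
    using add[of "x - y" y] that by simp
  have "(\<lambda>k. f (X k)) \<longlonglongrightarrow> f w"
  proof (rule Lim_null_comparison[THEN LIM_zero_cancel])
    show "\<forall>\<^sub>F k in sequentially. norm (f (X k) - f w) \<le> C * hnorm H (X k - w)"
      using bound[of "X _ - w"] X w by (simp add: f_diff)
    show "(\<lambda>k. C * hnorm H (X k - w)) \<longlonglongrightarrow> 0"
      using lim tendsto_mult_right_zero by blast
  qed
  then have "(\<lambda>k. q (X k)) \<longlonglongrightarrow> q w"
    unfolding q_def using tendsto_hnorm[OF X w lim] by (intro tendsto_intros) auto
  moreover have "(\<lambda>k. m + 1 / real (Suc k)) \<longlonglongrightarrow> m + 0"
    by (intro tendsto_intros) (use LIMSEQ_inverse_real_of_nat in \<open>simp add: divide_inverse\<close>)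
  ultimately have "q w \<le> m + 0"
    by (rule LIMSEQ_le) (use Xq less_imp_le in blast)
  then have min: "q w \<le> q x" if "x \<in> vecs H" for x using m_le[OF that] by simp
  have Re_eq: "Re (f z) = Re (cinner H z w)" if z: "z \<in> vecs H" for z
  proof -
    define b where "b = Re (f z) - Re (cinner H z w)"
    \<comment> \<open>Moving \<open>w\<close> by s z changes \<open>q\<close> by s^2 |z|^2 - 2 s b.
      This s almost minimises the change; the summand 1 keeps the denominator positive when the norm
      of \<open>z\<close> is 0, and the change is still at most - s b.\<close>
    define s where "s = b / ((hnorm H z)\<^sup>2 + 1)"
    have pos: "(hnorm H z)\<^sup>2 + 1 > 0" using zero_le_power2[of "hnorm H z"] by linarith
    have "Re (cinner H w z) = Re (cinner H z w)" using commute[of w z] w z by simp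
    then have n1: "(hnorm H (w + scaleC (of_real s) z))\<^sup>2
        = (hnorm H w)\<^sup>2 + s\<^sup>2 * (hnorm H z)\<^sup>2 + 2 * s * Re (cinner H z w)"
      using w z by (simp add: hnorm_add_sq hnorm_scaleC power_mult_distrib scaleC_right)
    have n2: "Re (f (w + scaleC (of_real s) z)) = Re (f w) + s * Re (f z)"
      using w z by (simp add: add scale)
    have "q (w + scaleC (of_real s) z) - q w = s\<^sup>2 * (hnorm H z)\<^sup>2 - 2 * s * b"
      unfolding q_def n1 n2 b_def by (simp add: right_diff_distrib)
    then have "2 * s * b \<le> s\<^sup>2 * (hnorm H z)\<^sup>2"
      using min[of "w + scaleC (of_real s) z"] w z by simp
    also have "\<dots> \<le> s\<^sup>2 * ((hnorm H z)\<^sup>2 + 1)" by (intro mult_left_mono) auto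
    also have "\<dots> = s * b" using pos by (simp add: s_def power2_eq_square)
    finally have "s * b \<le> 0" by (simp add: algebra_simps)
    moreover have "s * b = b\<^sup>2 / ((hnorm H z)\<^sup>2 + 1)" by (simp add: s_def power2_eq_square)
    ultimately have "b\<^sup>2 \<le> 0" using pos by (simp add: divide_le_0_iff)
    then show ?thesis by (simp add: b_def)
  qed
  \<comment> \<open>The real part at \<open>scaleC \<i> z\<close> is minus the imaginary part at
    \<open>z\<close>.\<close>
  have "f z = cinner H z w" if z: "z \<in> vecs H" for z
    using Re_eq[OF z] Re_eq[of "scaleC \<i> z"] z w by (simp add: scale scaleC_left complex_eq_iff)
  then show ?thesis using w by blast
qed

end

section \<open>Square-summable functions on an arbitrary index set\<close>

lemma nonneg_bounded_summable:
  fixes f :: "'i \<Rightarrow> real"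
  assumes "\<And>i. i \<in> I \<Longrightarrow> 0 \<le> f i" "\<And>F. finite F \<Longrightarrow> F \<subseteq> I \<Longrightarrow> sum f F \<le> b"
  shows "f summable_on I" "infsum f I \<le> b"
proof -
  show "f summable_on I"
    by (rule nonneg_bdd_above_summable_on) (use assms in \<open>auto intro!: bdd_aboveI2[where M = b]\<close>)
  then show "infsum f I \<le> b"
    by (rule infsum_le_finite_sums) (use assms in auto)
qed

abbreviation sq_summable :: "('i \<Rightarrow> complex) \<Rightarrow> 'i set \<Rightarrow> bool" where
  "sq_summable f I \<equiv> (\<lambda>i. (cmod (f i))\<^sup>2) summable_on I"

abbreviation sq_sum :: "('i \<Rightarrow> complex) \<Rightarrow> 'i set \<Rightarrow> real" where
  "sq_sum f I \<equiv> \<Sum>\<^sub>\<infinity>i\<in>I. (cmod (f i))\<^sup>2"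

definition l2_inner :: "'i set \<Rightarrow> ('i \<Rightarrow> complex) \<Rightarrow> ('i \<Rightarrow> complex) \<Rightarrow> complex" where
  "l2_inner I f g = (\<Sum>\<^sub>\<infinity>i\<in>I. f i * cnj (g i))"

lemma sq_summable_mult:
  assumes "sq_summable f I" "sq_summable g I"
  shows "(\<lambda>i. norm (f i * cnj (g i))) summable_on I"
proof (rule summable_on_comparison_test)
  show "(\<lambda>i. (cmod (f i))\<^sup>2 + (cmod (g i))\<^sup>2) summable_on I"
    using assms by (rule summable_on_add)
  have "a * b \<le> a\<^sup>2 + b\<^sup>2" if "0 \<le> a" "0 \<le> b" for a b :: real
    using sum_squares_bound[of a b] mult_nonneg_nonneg[OF that] by linarith
  then show "norm (f i * cnj (g i)) \<le> (cmod (f i))\<^sup>2 + (cmod (g i))\<^sup>2" for i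
    by (simp add: norm_mult)
qed simp

lemma sq_summable_add:
  assumes "sq_summable f I" "sq_summable g I"
  shows "sq_summable (\<lambda>i. f i + g i) I"
proof (rule summable_on_comparison_test)
  show "(\<lambda>i. 2 * ((cmod (f i))\<^sup>2 + (cmod (g i))\<^sup>2)) summable_on I"
    using assms by (intro summable_on_cmult_right summable_on_add)
  show "(cmod (f i + g i))\<^sup>2 \<le> 2 * ((cmod (f i))\<^sup>2 + (cmod (g i))\<^sup>2)" for i
  proof -
    have "(cmod (f i + g i))\<^sup>2 \<le> (cmod (f i) + cmod (g i))\<^sup>2"
      by (intro power_mono norm_triangle_ineq) simp
    also have "\<dots> \<le> 2 * ((cmod (f i))\<^sup>2 + (cmod (g i))\<^sup>2)"
      using sum_squares_bound[of "cmod (f i)" "cmod (g i)"] by (simp add: power2_sum)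
    finally show ?thesis .
  qed
qed simp

lemma sq_summable_scale: "sq_summable f I \<Longrightarrow> sq_summable (\<lambda>i. c * f i) I"
  by (simp add: norm_mult power_mult_distrib summable_on_cmult_right)

lemma sq_summable_diff:
  assumes "sq_summable f I" "sq_summable g I"
  shows "sq_summable (\<lambda>i. f i - g i) I"
  using sq_summable_add[OF assms(1) sq_summable_scale[OF assms(2), of "- 1"]] by simp

lemma l2_inner_self:
  assumes "sq_summable f I"
  shows "l2_inner I f f = of_real (sq_sum f I)"
  unfolding l2_inner_def
  by (rule infsumI)
    (use has_sum_infsum[OF assms] in
      \<open>simp add: complex_norm_square[symmetric] has_sum_of_real_iff del: of_real_power\<close>)

lemma l2_inner_add_left:
  assumes "sq_summable f I" "sq_summable g I" "sq_summable h I"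
  shows "l2_inner I (\<lambda>i. f i + g i) h = l2_inner I f h + l2_inner I g h"
  using abs_summable_summable[OF sq_summable_mult[OF assms(1,3)]]
    abs_summable_summable[OF sq_summable_mult[OF assms(2,3)]]
  by (simp add: l2_inner_def distrib_right infsum_add)

lemma l2_inner_scale_left: "l2_inner I (\<lambda>i. c * f i) h = c * l2_inner I f h"
  by (simp add: l2_inner_def mult.assoc infsum_cmult_right')

lemma l2_inner_commute: "l2_inner I f g = cnj (l2_inner I g f)"
  by (simp add: l2_inner_def mult.commute flip: infsum_cnj)

definition l2_space :: "'i set \<Rightarrow> ('i \<Rightarrow> complex) inner_space" where
  "l2_space I = \<lparr> vecs = {f. sq_summable f I}, cinner = l2_inner I \<rparr>"

lemma l2_semi_inner_space: "semi_inner_space (l2_space I)"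
proof
  show "complex_vector.subspace (vecs (l2_space I))"
    unfolding complex_vector.subspace_def
    by (auto simp: l2_space_def scaleC_fun_def scaleC_complex_def sq_summable_add sq_summable_scale)
  show "cinner (l2_space I) x y = cnj (cinner (l2_space I) y x)" for x y
    unfolding l2_space_def using l2_inner_commute by simp
qed (auto simp: l2_space_def scaleC_fun_def scaleC_complex_def plus_fun_def l2_inner_add_left
    l2_inner_scale_left l2_inner_self infsum_nonneg)

lemma hnorm_l2_space: "sq_summable f I \<Longrightarrow> hnorm (l2_space I) f = sqrt (sq_sum f I)"
  by (simp add: hnorm_def l2_space_def l2_inner_self)

lemma l2_cauchy_schwarz:
  assumes "sq_summable f I" "sq_summable g I"
  shows "cmod (l2_inner I f g) \<le> sqrt (sq_sum f I) * sqrt (sq_sum g I)"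
  using semi_inner_space.cauchy_schwarz[OF l2_semi_inner_space, of f I g] assms
  by (simp add: hnorm_l2_space) (simp add: l2_space_def)

text \<open>A finite partial sum for X k - x is the limit over l of the same partial sum for X k - X
  l, so the Cauchy bound e survives uniformly in the finite set. The pointwise limit is assumed
  because each application obtains it in its own way: from continuity of inner products or of
  evaluations.\<close>

lemma l2_complete:
  assumes X: "\<And>k. sq_summable (X k) I"
    and Cauchy: "\<And>e. e > 0 \<Longrightarrow> \<exists>N. \<forall>k\<ge>N. \<forall>l\<ge>N. sq_sum (\<lambda>i. X k i - X l i) I < e"
    and lim: "\<And>i. i \<in> I \<Longrightarrow> (\<lambda>k. X k i) \<longlonglongrightarrow> x i"
  shows "sq_summable x I" "(\<lambda>k. sq_sum (\<lambda>i. X k i - x i) I) \<longlonglongrightarrow> 0"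
proof -
  have *: "\<exists>N. \<forall>k\<ge>N. sq_summable (\<lambda>i. X k i - x i) I \<and> sq_sum (\<lambda>i. X k i - x i) I \<le> e"
    if e: "e > 0" for e
  proof -
    obtain N where N: "\<And>k l. k \<ge> N \<Longrightarrow> l \<ge> N \<Longrightarrow> sq_sum (\<lambda>i. X k i - X l i) I < e"
      using Cauchy[OF e] by blast
    have "sq_summable (\<lambda>i. X k i - x i) I \<and> sq_sum (\<lambda>i. X k i - x i) I \<le> e" if k: "k \<ge> N" for k
    proof -
      have b: "(\<Sum>i\<in>F. (cmod (X k i - x i))\<^sup>2) \<le> e" if F: "finite F" "F \<subseteq> I" for F
      proof (rule tendsto_upperbound)
        show "(\<lambda>l. \<Sum>i\<in>F. (cmod (X k i - X l i))\<^sup>2) \<longlonglongrightarrow> (\<Sum>i\<in>F. (cmod (X k i - x i))\<^sup>2)"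
          by (intro tendsto_intros lim) (use F in auto)
        have "(\<Sum>i\<in>F. (cmod (X k i - X l i))\<^sup>2) \<le> e" if "l \<ge> N" for l
          using finite_sum_le_infsum[OF sq_summable_diff[OF X X, of k l] F] N[OF k that] by simp
        then show "\<forall>\<^sub>F l in sequentially. (\<Sum>i\<in>F. (cmod (X k i - X l i))\<^sup>2) \<le> e"
          by (auto simp: eventually_sequentially)
      qed simp
      show ?thesis
        using nonneg_bounded_summable[of I "\<lambda>i. (cmod (X k i - x i))\<^sup>2" e] b by auto
    qed
    then show ?thesis by blast
  qed
  obtain N where "sq_summable (\<lambda>i. X N i - x i) I" using *[of 1] by auto
  from sq_summable_diff[OF X[of N] this] show "sq_summable x I" by simp
  show "(\<lambda>k. sq_sum (\<lambda>i. X k i - x i) I) \<longlonglongrightarrow> 0"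
  proof (rule LIMSEQ_I)
    fix e :: real assume "e > 0"
    with *[of "e / 2"] obtain N where N: "\<And>k. k \<ge> N \<Longrightarrow> sq_sum (\<lambda>i. X k i - x i) I \<le> e / 2" by auto
    have "norm (sq_sum (\<lambda>i. X k i - x i) I - 0) < e" if "k \<ge> N" for k
      using N[OF that] \<open>e > 0\<close> infsum_nonneg[of I "\<lambda>i. (cmod (X k i - x i))\<^sup>2"] by simp
    then show "\<exists>N. \<forall>k\<ge>N. norm (sq_sum (\<lambda>i. X k i - x i) I - 0) < e" by blast
  qed
qed

text \<open>The bound is put on finite partial sums because a finite subset of a union of a chain
  lies in a member of the chain, which is what Zorn's lemma will need. The constant is 1 so that the
  remainder 1 - (frame operator) is positive.\<close>

definition bessel_family ::
  "('a, 'm) inner_space_scheme \<Rightarrow> 'i set \<Rightarrow> ('i \<Rightarrow> 'a) \<Rightarrow> bool" where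
  "bessel_family H I v \<longleftrightarrow> (\<forall>i\<in>I. v i \<in> vecs H) \<and>
     (\<forall>x\<in>vecs H. \<forall>F. finite F \<longrightarrow> F \<subseteq> I \<longrightarrow> (\<Sum>i\<in>F. (cmod (cinner H x (v i)))\<^sup>2) \<le> (hnorm H x)\<^sup>2)"

lemma bessel_family_vecs: "bessel_family H I v \<Longrightarrow> i \<in> I \<Longrightarrow> v i \<in> vecs H"
  by (simp add: bessel_family_def)

lemma bessel_family_summable:
  assumes "bessel_family H I v" "x \<in> vecs H"
  shows "sq_summable (\<lambda>i. cinner H x (v i)) I" "sq_sum (\<lambda>i. cinner H x (v i)) I \<le> (hnorm H x)\<^sup>2"
  using nonneg_bounded_summable[of I "\<lambda>i. (cmod (cinner H x (v i)))\<^sup>2" "(hnorm H x)\<^sup>2"] assms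
  by (auto simp: bessel_family_def)

lemma (in semi_inner_space) orthonormal_bessel_family:
  "orthonormal_on H J u \<Longrightarrow> bessel_family H J u"
  using bessel[of J u] by (auto simp: bessel_family_def) (auto simp: orthonormal_on_def)

lemma (in semi_inner_space) bessel_form_left:
  assumes v: "\<And>i. i \<in> I \<Longrightarrow> v i \<in> vecs H"
    and sq: "\<And>x. x \<in> vecs H \<Longrightarrow> sq_summable (\<lambda>i. cinner H x (v i)) I" "sq_summable g I"
    and x: "x \<in> vecs H" "y \<in> vecs H"
  shows "l2_inner I (\<lambda>i. cinner H (x + y) (v i)) g =
      l2_inner I (\<lambda>i. cinner H x (v i)) g + l2_inner I (\<lambda>i. cinner H y (v i)) g" (is ?add)
    and "l2_inner I (\<lambda>i. cinner H (scaleC c x) (v i)) g = c * l2_inner I (\<lambda>i. cinner H x (v i)) g"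
      (is ?scale)
proof -
  have "l2_inner I (\<lambda>i. cinner H (x + y) (v i)) g =
      l2_inner I (\<lambda>i. cinner H x (v i) + cinner H y (v i)) g"
    unfolding l2_inner_def by (intro infsum_cong) (use v x in \<open>simp add: add_left\<close>)
  then show ?add by (simp only: l2_inner_add_left[OF sq(1)[OF x(1)] sq(1)[OF x(2)] sq(2)])
  have "l2_inner I (\<lambda>i. cinner H (scaleC c x) (v i)) g = l2_inner I (\<lambda>i. c * cinner H x (v i)) g"
    unfolding l2_inner_def by (intro infsum_cong) (use v x in \<open>simp add: scaleC_left\<close>)
  then show ?scale by (simp add: l2_inner_scale_left)
qed

context hilbert_space
begin

text \<open>The vector w stands for the sum of all \<open>g i\<close> times \<open>v i\<close>. It
  comes from Riesz representation as the adjoint of the coefficient map, so the convergence of that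
  series need not be discussed.\<close>

lemma bessel_synthesis:
  assumes v: "bessel_family H I v" and g: "sq_summable g I"
  shows "\<exists>w\<in>vecs H. \<forall>x\<in>vecs H. cinner H x w = l2_inner I (\<lambda>i. cinner H x (v i)) g"
proof -
  have "\<exists>w\<in>vecs H. \<forall>x\<in>vecs H. l2_inner I (\<lambda>i. cinner H x (v i)) g = cinner H x w"
  proof (rule riesz[where C = "sqrt (sq_sum g I)"])
    show "l2_inner I (\<lambda>i. cinner H (x + y) (v i)) g =
      l2_inner I (\<lambda>i. cinner H x (v i)) g + l2_inner I (\<lambda>i. cinner H y (v i)) g"
      if "x \<in> vecs H" "y \<in> vecs H" for x y
      by (rule bessel_form_left(1)) (use that v g bessel_family_vecs bessel_family_summable in auto)
    show "l2_inner I (\<lambda>i. cinner H (scaleC c x) (v i)) g = c * l2_inner I (\<lambda>i. cinner H x (v i)) g"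
      if "x \<in> vecs H" for c x
      by (rule bessel_form_left(2)[of I v g x 0])
        (use that v g bessel_family_vecs bessel_family_summable in auto)
    show "cmod (l2_inner I (\<lambda>i. cinner H x (v i)) g) \<le> sqrt (sq_sum g I) * hnorm H x"
      if x: "x \<in> vecs H" for x
    proof -
      have "cmod (l2_inner I (\<lambda>i. cinner H x (v i)) g)
          \<le> sqrt (sq_sum (\<lambda>i. cinner H x (v i)) I) * sqrt (sq_sum g I)"
        by (rule l2_cauchy_schwarz[OF bessel_family_summable(1)[OF v x] g])
      also have "\<dots> \<le> hnorm H x * sqrt (sq_sum g I)"
        by (intro mult_right_mono real_le_lsqrt bessel_family_summable(2)[OF v x])
          (use x in \<open>auto intro!: infsum_nonneg\<close>)
      finally show ?thesis by (simp add: mult.commute)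
    qed
  qed
  then show ?thesis by metis
qed

text \<open>The synthesis \<open>w'\<close> of the coefficients of \<open>w\<close> has the same
  coefficients as \<open>w\<close>, and an orthonormal basis separates vectors, so
  \<open>w' = w\<close>. The expansion is then the defining property of \<open>w'\<close>.\<close>

lemma onb_parseval:
  assumes B: "is_onb H B" and x: "x \<in> vecs H" and w: "w \<in> vecs H"
  shows "((\<lambda>b. cinner H x b * cnj (cinner H w b)) has_sum cinner H x w) B"
proof -
  have o: "orthonormal_on H B (\<lambda>b. b)" using B by (simp add: is_onb_def)
  note bf = orthonormal_bessel_family[OF o]
  note sq = bessel_family_summable(1)[OF bf]
  have Bv: "b \<in> vecs H" if "b \<in> B" for b using o that by (auto simp: orthonormal_on_def)
  obtain w' where w': "w' \<in> vecs H"
    and eq: "\<And>y. y \<in> vecs H \<Longrightarrow> cinner H y w' = l2_inner B (cinner H y) (cinner H w)"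
    using bessel_synthesis[OF bf sq[OF w]] by auto
  have "cinner H (w - w') b = 0" if b: "b \<in> B" for b
  proof -
    have "cinner H b w' = (\<Sum>\<^sub>\<infinity>c\<in>B. if c = b then cnj (cinner H w b) else 0)"
      unfolding eq[OF Bv[OF b]] l2_inner_def
      by (intro infsum_cong) (use o b in \<open>auto simp: orthonormal_on_def\<close>)
    also have "\<dots> = (\<Sum>\<^sub>\<infinity>c\<in>{b}. cnj (cinner H w b))"
      by (rule infsum_cong_neutral) (use b in auto)
    finally have "cinner H w b = cinner H w' b"
      using commute[of w' b] w' Bv[OF b] by simp
    then show ?thesis using w w' Bv[OF b] by (simp add: diff_left)
  qed
  then have "w - w' = 0" using B diff_mem[OF w w'] unfolding is_onb_def by blast
  then have "cinner H x w = l2_inner B (cinner H x) (cinner H w)" using eq[OF x] by simp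
  then show ?thesis
    using abs_summable_summable[OF sq_summable_mult[OF sq[OF x] sq[OF w]]]
    by (simp add: l2_inner_def has_sum_infsum)
qed

text \<open>Zorn's lemma for orthonormal sets: a nonzero vector orthogonal to a maximal one could be
  normalised and added.\<close>

lemma onb_exists: "\<exists>B. is_onb H B"
proof -
  define Os where "Os = {B. orthonormal_on H B (\<lambda>b. b)}"
  have "\<exists>M\<in>Os. \<forall>X\<in>Os. M \<subseteq> X \<longrightarrow> X = M"
  proof (rule subset_Zorn_nonempty)
    have "{} \<in> Os" by (simp add: Os_def orthonormal_on_def)
    then show "Os \<noteq> {}" by blast
    fix C assume "C \<noteq> {}" and C: "subset.chain Os C"
    \<comment> \<open>Orthonormality is a condition on pairs, and any two elements of the union lie
      in one member of the chain.\<close>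
    have "\<exists>B\<in>Os. a \<in> B \<and> b \<in> B" if ab: "a \<in> \<Union>C" "b \<in> \<Union>C" for a b
    proof -
      obtain A A' where A: "A \<in> C" "A' \<in> C" "a \<in> A" "b \<in> A'" using ab by blast
      then have "A \<subseteq> A' \<or> A' \<subseteq> A" using C unfolding subset_chain_def by blast
      then have "\<exists>B\<in>C. a \<in> B \<and> b \<in> B" using A by blast
      then show ?thesis using C unfolding subset_chain_def by blast
    qed
    note chain = this
    have pair: "cinner H a b = (if a = b then 1 else 0) \<and> a \<in> vecs H"
      if ab: "a \<in> \<Union>C" "b \<in> \<Union>C" for a b
    proof -
      obtain B where "B \<in> Os" "a \<in> B" "b \<in> B" using chain[OF ab] by blast
      then show ?thesis by (simp add: Os_def orthonormal_on_def)
    qed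
    show "\<Union>C \<in> Os" unfolding Os_def orthonormal_on_def using pair by blast
  qed
  then obtain B where B: "orthonormal_on H B (\<lambda>b. b)"
    and max: "\<And>X. orthonormal_on H X (\<lambda>b. b) \<Longrightarrow> B \<subseteq> X \<Longrightarrow> X = B" by (auto simp: Os_def)
  have "x = 0" if x: "x \<in> vecs H" and xB: "\<forall>b\<in>B. cinner H x b = 0" for x
  proof (rule ccontr)
    assume "x \<noteq> 0"
    then have n: "hnorm H x \<noteq> 0" using hnorm_eq_0[OF x] by simp
    define e where "e = scaleC (1 / of_real (hnorm H x)) x"
    have e: "e \<in> vecs H" using x by (simp add: e_def)
    have ee: "cinner H e e = 1"
      unfolding e_def using n x cinner_self[OF x]
      by (simp add: scaleC_left scaleC_right power2_eq_square)
    have eb: "cinner H e b = 0" "cinner H b e = 0" if "b \<in> B" for b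
    proof -
      have b: "b \<in> vecs H" using B that by (auto simp: orthonormal_on_def)
      show "cinner H e b = 0" using xB that x b by (simp add: e_def scaleC_left)
      then show "cinner H b e = 0" using commute[OF b e] by simp
    qed
    have "orthonormal_on H (insert e B) (\<lambda>b. b)"
      using B e ee eb by (auto simp: orthonormal_on_def)
    then have "e \<in> B" using max by blast
    then show False using eb ee by auto
  qed
  then show ?thesis using B by (auto simp: is_onb_def)
qed

lemma is_onb_onb: "is_onb H (onb H)"
  unfolding onb_def using onb_exists by (rule someI_ex)

end

section \<open>Parseval families of a unitary representation\<close>

lemma l2_inner_reindex:
  assumes "bij_betw \<phi> I J"
  shows "l2_inner I (\<lambda>i. f (\<phi> i)) (\<lambda>i. g (\<phi> i)) = l2_inner J f g"
  unfolding l2_inner_def by (rule infsum_reindex_bij_betw[OF assms])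

lemma sq_summable_reindex:
  assumes "bij_betw \<phi> I J"
  shows "sq_summable (\<lambda>i. f (\<phi> i)) I \<longleftrightarrow> sq_summable f J"
  by (rule summable_on_reindex_bij_betw[OF assms])

text \<open>
  The domain of the closed operator \<open>x \<mapsto> (\<langle>x, v i\<rangle>)\<^sub>i\<close> into \<open>\<ell>\<^sub>2(I)\<close>, with its graph inner product.
\<close>

definition graph_space ::
  "('a::complex_vector, 'm) inner_space_scheme \<Rightarrow> 'i set \<Rightarrow> ('i \<Rightarrow> 'a) \<Rightarrow> 'a inner_space" where
  "graph_space H I v =
     \<lparr> vecs = {x \<in> vecs H. sq_summable (\<lambda>i. cinner H x (v i)) I},
       cinner = (\<lambda>x y. cinner H x y + l2_inner I (\<lambda>i. cinner H x (v i)) (\<lambda>i. cinner H y (v i))) \<rparr>"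

context hilbert_space
begin

text \<open>Completeness of the graph norm says that the coefficient operator is closed. A
  graph-Cauchy sequence converges in \<open>H\<close>, hence its coefficients converge one by one,
  and \<open>l2_complete\<close> upgrades this to convergence of the coefficient functions in
  l_2.\<close>

lemma hilbert_space_graph_space:
  assumes v: "\<And>i. i \<in> I \<Longrightarrow> v i \<in> vecs H"
  shows "hilbert_space (graph_space H I v)"
proof -
  define W where "W = graph_space H I v"
  define c where "c x = (\<lambda>i. cinner H x (v i))" for x
  have vW: "x \<in> vecs W \<longleftrightarrow> x \<in> vecs H \<and> sq_summable (c x) I" for x
    by (simp add: W_def graph_space_def c_def)
  have iW: "cinner W x y = cinner H x y + l2_inner I (c x) (c y)" for x y
    by (simp add: W_def graph_space_def c_def)
  have c_add: "c (x + y) i = c x i + c y i" and c_diff: "c (x - y) i = c x i - c y i"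
    if "x \<in> vecs H" "y \<in> vecs H" "i \<in> I" for x y i
    using that v by (auto simp: c_def add_left diff_left)
  have c_scale: "c (scaleC a x) i = a * c x i" if "x \<in> vecs H" "i \<in> I" for x i a
    using that v by (simp add: c_def scaleC_left)
  have sq_cong: "sq_summable f I \<longleftrightarrow> sq_summable g I" if "\<And>i. i \<in> I \<Longrightarrow> f i = g i" for f g
    using that by (intro summable_on_cong) simp
  have sub: "complex_vector.subspace (vecs W)"
    unfolding complex_vector.subspace_def
  proof (intro conjI allI ballI)
    show "0 \<in> vecs W" using sq_cong[of "c 0" "\<lambda>_. 0"] v by (simp add: vW) (simp add: c_def)
    show "x + y \<in> vecs W" if "x \<in> vecs W" "y \<in> vecs W" for x y
      using that sq_summable_add[of "c x" I "c y"] sq_cong[of "c (x + y)" "\<lambda>i. c x i + c y i"]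
      by (simp add: vW c_add)
    show "scaleC a x \<in> vecs W" if "x \<in> vecs W" for x a
      using that sq_summable_scale[of "c x" I a] sq_cong[of "c (scaleC a x)" "\<lambda>i. a * c x i"]
      by (simp add: vW c_scale)
  qed
  have norm: "Re (cinner W x x) = (hnorm H x)\<^sup>2 + sq_sum (c x) I" if "x \<in> vecs W" for x
    using that by (simp add: iW vW cinner_self l2_inner_self)
  have semi: "semi_inner_space W"
  proof
    show "complex_vector.subspace (vecs W)" by (rule sub)
    show "cinner W (x + y) z = cinner W x z + cinner W y z"
      if "x \<in> vecs W" "y \<in> vecs W" "z \<in> vecs W" for x y z
    proof -
      have "l2_inner I (c (x + y)) (c z) = l2_inner I (\<lambda>i. c x i + c y i) (c z)"
        unfolding l2_inner_def by (intro infsum_cong) (use that in \<open>simp add: c_add vW\<close>)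
      then show ?thesis using that by (simp add: iW vW add_left l2_inner_add_left)
    qed
    show "cinner W (scaleC a x) y = a * cinner W x y" if "x \<in> vecs W" "y \<in> vecs W" for x y a
    proof -
      have "l2_inner I (c (scaleC a x)) (c y) = l2_inner I (\<lambda>i. a * c x i) (c y)"
        unfolding l2_inner_def by (intro infsum_cong) (use that in \<open>simp add: c_scale vW\<close>)
      then show ?thesis
        using that by (simp add: iW vW scaleC_left l2_inner_scale_left distrib_left)
    qed
    show "cinner W x y = cnj (cinner W y x)" if "x \<in> vecs W" "y \<in> vecs W" for x y
      using that commute[of x y] l2_inner_commute[of I "c x" "c y"] by (simp add: iW vW)
    show "0 \<le> Re (cinner W x x)" if "x \<in> vecs W" for x
      using norm[OF that] by (simp add: infsum_nonneg)
  qed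
  interpret W: semi_inner_space W by (rule semi)
  have normW: "(hnorm W x)\<^sup>2 = (hnorm H x)\<^sup>2 + sq_sum (c x) I" if "x \<in> vecs W" for x
    using norm[OF that] W.hnorm_sq[OF that] by simp
  have norm_le: "hnorm H x \<le> hnorm W x" "sq_sum (c x) I \<le> (hnorm W x)\<^sup>2" if "x \<in> vecs W" for x
    using normW[OF that] W.hnorm_nonneg[OF that] infsum_nonneg[of I "\<lambda>i. (cmod (c x i))\<^sup>2"]
    by (auto intro!: power2_le_imp_le[of "hnorm H x"])
  have "hilbert_space W"
  proof
    show "x = 0" if "x \<in> vecs W" "cinner W x x = 0" for x
      using norm[OF that(1)] that infsum_nonneg[of I "\<lambda>i. (cmod (c x i))\<^sup>2"] hnorm_eq_0[of x]
      by (simp add: vW add_nonneg_eq_0_iff)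
    fix X :: "nat \<Rightarrow> 'a"
    assume X: "\<And>k. X k \<in> vecs W"
      and Cauchy: "\<And>e. e > 0 \<Longrightarrow> \<exists>N. \<forall>k\<ge>N. \<forall>l\<ge>N. hnorm W (X k - X l) < e"
    have XH: "X k \<in> vecs H" for k using X vW by blast
    have "\<exists>N. \<forall>k\<ge>N. \<forall>l\<ge>N. hnorm H (X k - X l) < e" if e: "e > 0" for e
    proof -
      obtain N where N: "\<forall>k\<ge>N. \<forall>l\<ge>N. hnorm W (X k - X l) < e" using Cauchy[OF e] by blast
      have "hnorm H (X k - X l) < e" if "k \<ge> N" "l \<ge> N" for k l
        using norm_le(1)[OF W.diff_mem[OF X[of k] X[of l]]] N that by fastforce
      then show ?thesis by blast
    qed
    then obtain x where x: "x \<in> vecs H" and lim: "(\<lambda>k. hnorm H (X k - x)) \<longlonglongrightarrow> 0"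
      using complete[of X] XH by blast
    have C2: "\<exists>N. \<forall>k\<ge>N. \<forall>l\<ge>N. sq_sum (\<lambda>i. c (X k) i - c (X l) i) I < e" if e: "e > 0" for e
    proof -
      obtain N where N: "\<forall>k\<ge>N. \<forall>l\<ge>N. hnorm W (X k - X l) < sqrt e"
        using Cauchy[of "sqrt e"] e by auto
      have "sq_sum (\<lambda>i. c (X k) i - c (X l) i) I < e" if "k \<ge> N" "l \<ge> N" for k l
      proof -
        have "sq_sum (\<lambda>i. c (X k) i - c (X l) i) I = sq_sum (c (X k - X l)) I"
          by (intro infsum_cong) (simp add: c_diff XH)
        also have "\<dots> \<le> (hnorm W (X k - X l))\<^sup>2" using norm_le(2) X by simp
        also have "\<dots> < (sqrt e)\<^sup>2"
          using N that X by (intro power_strict_mono) auto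
        finally show ?thesis using e by simp
      qed
      then show ?thesis by blast
    qed
    have pt: "(\<lambda>k. c (X k) i) \<longlonglongrightarrow> c x i" if "i \<in> I" for i
      unfolding c_def by (rule tendsto_cinner_left[OF XH x v[OF that] lim])
    have sqX: "sq_summable (c (X k)) I" for k using X vW by blast
    note l2 = l2_complete[OF sqX C2 pt]
    have xW: "x \<in> vecs W" using x l2(1) by (simp add: vW)
    have "(\<lambda>k. sqrt ((hnorm H (X k - x))\<^sup>2 + sq_sum (\<lambda>i. c (X k) i - c x i) I)) \<longlonglongrightarrow> sqrt (0\<^sup>2 + 0)"
      by (intro tendsto_intros lim l2(2))
    moreover have "sqrt ((hnorm H (X k - x))\<^sup>2 + sq_sum (\<lambda>i. c (X k) i - c x i) I) = hnorm W (X k - x)"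
      for k
    proof -
      have "sq_sum (\<lambda>i. c (X k) i - c x i) I = sq_sum (c (X k - x)) I"
        by (intro infsum_cong) (simp add: c_diff XH x)
      moreover have "X k - x \<in> vecs W" using X xW by simp
      ultimately show ?thesis using normW[of "X k - x", symmetric] W.hnorm_nonneg[of "X k - x"] by simp
    qed
    ultimately show "\<exists>x\<in>vecs W. (\<lambda>k. hnorm W (X k - x)) \<longlonglongrightarrow> 0" using xW by auto
  qed (use W.subspace W.add_left W.scaleC_left W.commute W.nonneg in blast)+
  then show ?thesis by (simp add: W_def)
qed

end

text \<open>The group \<open>'k\<close> will be \<open>'g \<times> 'g\<close>: two commuting actions
  become one, and equivariance becomes a single translation of the index.\<close>

locale unitary_rep = hilbert_space H
  for H :: "('a::complex_vector, 'm) inner_space_scheme" +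
  fixes \<pi> :: "'k::group_add \<Rightarrow> 'a \<Rightarrow> 'a"
  assumes rep_isometric: "isometric_between H H (\<pi> g)"
    and rep_zero: "x \<in> vecs H \<Longrightarrow> \<pi> 0 x = x"
    and rep_add: "x \<in> vecs H \<Longrightarrow> \<pi> (g + h) x = \<pi> g (\<pi> h x)"
begin

lemma rep_mem [simp]: "x \<in> vecs H \<Longrightarrow> \<pi> g x \<in> vecs H"
  using rep_isometric[of g] by (simp add: isometric_between_def linear_between_def)

lemma cinner_rep [simp]: "x \<in> vecs H \<Longrightarrow> y \<in> vecs H \<Longrightarrow> cinner H (\<pi> g x) (\<pi> g y) = cinner H x y"
  using rep_isometric[of g] by (simp add: isometric_between_def)

lemma rep_scaleC: "x \<in> vecs H \<Longrightarrow> \<pi> g (scaleC c x) = scaleC c (\<pi> g x)"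
  using rep_isometric[of g] by (simp add: isometric_between_def linear_between_def)

lemma rep_minus_rep [simp]: "x \<in> vecs H \<Longrightarrow> \<pi> (- g) (\<pi> g x) = x" "x \<in> vecs H \<Longrightarrow> \<pi> g (\<pi> (- g) x) = x"
  using rep_add[of x "- g" g] rep_add[of x g "- g"] rep_zero[of x] by simp_all

lemma rep_adjoint:
  assumes "x \<in> vecs H" "y \<in> vecs H"
  shows "cinner H (\<pi> g x) y = cinner H x (\<pi> (- g) y)"
  using cinner_rep[of "\<pi> g x" y "- g"] assms by simp

lemma cinner_rep_rep:
  assumes "x \<in> vecs H" "y \<in> vecs H"
  shows "cinner H (\<pi> h x) (\<pi> g y) = cinner H x (\<pi> (- h + g) y)"
  using assms by (simp add: rep_adjoint rep_add)

lemma bij_shift: "bij_betw (\<lambda>g. - h + g) UNIV (UNIV :: 'k set)"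
  by (rule bij_betw_byWitness[where f' = "\<lambda>g. h + g"]) (auto simp: add.assoc[symmetric])

lemma bij_shift_snd: "bij_betw (\<lambda>(w, g). (w, - h + g)) (B \<times> UNIV) (B \<times> (UNIV :: 'k set))"
  by (rule bij_betw_byWitness[where f' = "\<lambda>(w, g). (w, h + g)"]) (auto simp: add.assoc[symmetric])

text \<open>
  With \<open>V x = (\<langle>x, \<pi> g \<xi>\<rangle>)\<^sub>g\<close>, the operator \<open>a\<close> below is \<open>(1 + V\<^sup>* V)\<^sup>-\<^sup>1\<close>, and \<open>w = a \<xi>\<close> satisfies
  \<open>\<langle>x, \<pi> g w\<rangle> = (V a x) g\<close>, where \<open>V a\<close> is a contraction.
\<close>

lemma sq_summable_imp_bessel_vector:
  assumes \<xi>: "\<xi> \<in> vecs H" and sq: "sq_summable (\<lambda>g. cinner H \<xi> (\<pi> g \<xi>)) UNIV"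
  shows "\<exists>w\<in>vecs H. bessel_family H UNIV (\<lambda>g. \<pi> g w) \<and>
    (\<forall>\<eta>\<in>vecs H. cinner H \<eta> \<xi> \<noteq> 0 \<longrightarrow> (\<exists>g. cinner H \<eta> (\<pi> g w) \<noteq> 0))"
proof -
  define W where "W = graph_space H UNIV (\<lambda>g. \<pi> g \<xi>)"
  define c where "c x = (\<lambda>g. cinner H x (\<pi> g \<xi>))" for x
  have vW: "x \<in> vecs W \<longleftrightarrow> x \<in> vecs H \<and> sq_summable (c x) UNIV" for x
    by (simp add: W_def graph_space_def c_def)
  have iW: "cinner W x y = cinner H x y + l2_inner UNIV (c x) (c y)" for x y
    by (simp add: W_def graph_space_def c_def)
  interpret W: hilbert_space W
    unfolding W_def by (rule hilbert_space_graph_space) (use \<xi> in simp)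
  have WH: "x \<in> vecs H" if "x \<in> vecs W" for x using that vW by blast
  have normW: "(hnorm W x)\<^sup>2 = (hnorm H x)\<^sup>2 + sq_sum (c x) UNIV" if "x \<in> vecs W" for x
    using that by (simp add: W.hnorm_sq iW vW hnorm_sq l2_inner_self)
  have norm_le: "hnorm H x \<le> hnorm W x" "sq_sum (c x) UNIV \<le> (hnorm W x)\<^sup>2" if "x \<in> vecs W" for x
    using normW[OF that] W.hnorm_nonneg[OF that] infsum_nonneg[of UNIV "\<lambda>i. (cmod (c x i))\<^sup>2"]
    by (auto intro!: power2_le_imp_le[of "hnorm H x"])
  \<comment> \<open>The functional <x, \<eta>> is continuous for the larger graph norm. Its
    representing vector in the graph space solves (1 + V* V) a \<eta> = \<eta> in the weak
    sense.\<close>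
  have "\<exists>w\<in>vecs W. \<forall>x\<in>vecs W. cinner H x \<eta> = cinner W x w" if \<eta>: "\<eta> \<in> vecs H" for \<eta>
  proof (rule W.riesz[where C = "hnorm H \<eta>"])
    show "cinner H (x + y) \<eta> = cinner H x \<eta> + cinner H y \<eta>" if "x \<in> vecs W" "y \<in> vecs W" for x y
      using that \<eta> WH by (simp add: add_left)
    show "cinner H (scaleC b x) \<eta> = b * cinner H x \<eta>" if "x \<in> vecs W" for b x
      using that \<eta> WH by (simp add: scaleC_left)
    show "cmod (cinner H x \<eta>) \<le> hnorm H \<eta> * hnorm W x" if "x \<in> vecs W" for x
    proof -
      have "cmod (cinner H x \<eta>) \<le> hnorm H x * hnorm H \<eta>"
        using WH[OF that] \<eta> by (rule cauchy_schwarz)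
      also have "\<dots> \<le> hnorm W x * hnorm H \<eta>"
        using norm_le(1)[OF that] \<eta> by (intro mult_right_mono) auto
      finally show ?thesis by (simp add: mult.commute)
    qed
  qed
  then obtain a where a: "\<And>\<eta>. \<eta> \<in> vecs H \<Longrightarrow> a \<eta> \<in> vecs W"
    and aW: "\<And>x \<eta>. \<eta> \<in> vecs H \<Longrightarrow> x \<in> vecs W \<Longrightarrow> cinner H x \<eta> = cinner W x (a \<eta>)"
    by metis
  \<comment> \<open>Both sides are the graph inner product of \<open>a x\<close> and
    \<open>a y\<close>.\<close>
  have a_sym: "cinner H (a x) y = cinner H x (a y)" if "x \<in> vecs H" "y \<in> vecs H" for x y
  proof -
    have "cinner H (a x) y = cinner W (a x) (a y)" using aW a that by simp
    also have "\<dots> = cnj (cinner W (a y) (a x))" using W.commute a that by blast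
    also have "cinner W (a y) (a x) = cinner H (a y) x" using aW a that by simp
    also have "cnj \<dots> = cinner H x (a y)" using commute[of x "a y"] WH[OF a] that by simp
    finally show ?thesis .
  qed
  have c_rep: "c (\<pi> h x) = (\<lambda>g. c x (- h + g))" if "x \<in> vecs H" for h x
    unfolding c_def using cinner_rep_rep that \<xi> by blast
  have rep_W: "\<pi> h x \<in> vecs W" if "x \<in> vecs W" for h x
    using that sq_summable_reindex[OF bij_shift[of h], of "c x"] by (simp add: vW c_rep)
  have iW_rep: "cinner W (\<pi> h x) (\<pi> h y) = cinner W x y" if "x \<in> vecs W" "y \<in> vecs W" for h x y
    using that l2_inner_reindex[OF bij_shift[of h], of "c x" "c y"] WH by (simp add: iW c_rep)
  \<comment> \<open>The graph inner product is invariant, because \<pi> only shifts the coefficient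
    functions.\<close>
  have a_rep: "a (\<pi> h x) = \<pi> h (a x)" if x: "x \<in> vecs H" for h x
  proof (rule W.cinner_ext)
    show "a (\<pi> h x) \<in> vecs W" "\<pi> h (a x) \<in> vecs W" using a rep_W x by auto
    fix z assume z: "z \<in> vecs W"
    have "cinner W z (a (\<pi> h x)) = cinner H z (\<pi> h x)" using aW z x by simp
    also have "\<dots> = cinner H (\<pi> (- h) z) x" using rep_adjoint[of z x "- h"] WH[OF z] x by simp
    also have "\<dots> = cinner W (\<pi> (- h) z) (a x)" using aW rep_W z x by simp
    also have "\<dots> = cinner W (\<pi> h (\<pi> (- h) z)) (\<pi> h (a x))"
      using iW_rep[OF rep_W[OF z] a[OF x], of h "- h"] by simp
    also have "\<pi> h (\<pi> (- h) z) = z" using WH[OF z] by simp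
    finally show "cinner W z (a (\<pi> h x)) = cinner W z (\<pi> h (a x))" .
  qed
  define w where "w = a \<xi>"
  have w: "w \<in> vecs H" using a[OF \<xi>] WH by (simp add: w_def)
  have coef: "cinner H x (\<pi> g w) = c (a x) g" if x: "x \<in> vecs H" for x g
  proof -
    have "cinner H x (\<pi> g w) = cinner H x (a (\<pi> g \<xi>))" using a_rep[OF \<xi>] by (simp add: w_def)
    also have "\<dots> = cinner H (a x) (\<pi> g \<xi>)" using a_sym[OF x, of "\<pi> g \<xi>"] \<xi> by simp
    finally show ?thesis by (simp add: c_def)
  qed
  \<comment> \<open>The squared graph norm of \<open>a x\<close> is <a x, x>; Cauchy-Schwarz and one
    cancellation give the bound. As the graph norm dominates the l_2 norm of the coefficients,
    \<open>V a\<close> is a contraction.\<close>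
  have a_norm: "hnorm W (a x) \<le> hnorm H x" if x: "x \<in> vecs H" for x
  proof (cases "hnorm W (a x) = 0")
    case False
    have "(hnorm W (a x))\<^sup>2 = Re (cinner H (a x) x)" using aW[OF x a[OF x]] W.hnorm_sq[OF a[OF x]] by simp
    also have "\<dots> \<le> hnorm H (a x) * hnorm H x"
      by (rule order_trans[OF complex_Re_le_cmod cauchy_schwarz]) (use x a WH in auto)
    also have "\<dots> \<le> hnorm W (a x) * hnorm H x"
      by (intro mult_right_mono norm_le) (use x a in auto)
    finally have "hnorm W (a x) * hnorm W (a x) \<le> hnorm W (a x) * hnorm H x"
      by (simp add: power2_eq_square)
    moreover have "hnorm W (a x) > 0" using W.hnorm_nonneg[OF a[OF x]] False by simp
    ultimately show ?thesis by simp
  qed (use x in simp)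
  have "bessel_family H UNIV (\<lambda>g. \<pi> g w)"
    unfolding bessel_family_def
  proof (intro conjI ballI allI impI)
    fix x F assume x: "x \<in> vecs H" and F: "finite (F :: 'k set)"
    have "(\<Sum>g\<in>F. (cmod (cinner H x (\<pi> g w)))\<^sup>2) = (\<Sum>g\<in>F. (cmod (c (a x) g))\<^sup>2)"
      by (simp add: coef[OF x])
    also have "\<dots> \<le> sq_sum (c (a x)) UNIV"
      using a[OF x] F by (intro finite_sum_le_infsum) (auto simp: vW)
    also have "\<dots> \<le> (hnorm W (a x))\<^sup>2" by (rule norm_le(2)[OF a[OF x]])
    also have "\<dots> \<le> (hnorm H x)\<^sup>2"
      using a_norm[OF x] W.hnorm_nonneg[OF a[OF x]] by (intro power_mono)
    finally show "(\<Sum>g\<in>F. (cmod (cinner H x (\<pi> g w)))\<^sup>2) \<le> (hnorm H x)\<^sup>2" .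
  qed (use w in simp)
  moreover have "\<exists>g. cinner H \<eta> (\<pi> g w) \<noteq> 0" if \<eta>: "\<eta> \<in> vecs H" and n0: "cinner H \<eta> \<xi> \<noteq> 0" for \<eta>
  proof (rule ccontr)
    assume "\<not> ?thesis"
    then have ca: "c (a \<eta>) = (\<lambda>_. 0)" using coef[OF \<eta>] by auto
    \<comment> \<open>Here \<open>sq\<close> enters: only a vector in the domain of V can be paired
      with \<open>a \<eta>\<close> in the graph space. Since the coefficients of
      \<open>a \<eta>\<close> vanish, that pairing is <\<xi>, a \<eta>>, the conjugate of the
      coefficient of \<open>a \<eta>\<close> at the identity.\<close>
    have \<xi>W: "\<xi> \<in> vecs W" using \<xi> sq by (simp add: vW c_def)
    have "cinner H \<xi> \<eta> = cinner W \<xi> (a \<eta>)" by (rule aW[OF \<eta> \<xi>W])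
    also have "\<dots> = cinner H \<xi> (a \<eta>)" by (simp add: iW ca l2_inner_def)
    also have "\<dots> = cnj (cinner H (a \<eta>) \<xi>)" using commute \<xi> WH[OF a[OF \<eta>]] by blast
    also have "cinner H (a \<eta>) \<xi> = c (a \<eta>) 0" using \<xi> by (simp add: c_def rep_zero)
    finally have "cinner H \<xi> \<eta> = 0" by (simp add: ca)
    then show False using n0 commute[OF \<eta> \<xi>] by simp
  qed
  ultimately show ?thesis using w by blast
qed

text \<open>Equality in the Bessel bound makes the coefficient map isometric although the orbits of
  different \<open>w\<close> may overlap. The hypothesis is pointwise because it will be applied at
  the one vector \<open>R \<eta>\<close>.\<close>

lemma parseval_family_exists:
  assumes sep: "\<And>\<eta>. \<eta> \<in> vecs H \<Longrightarrow> \<eta> \<noteq> 0 \<Longrightarrow>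
    \<exists>w\<in>vecs H. bessel_family H UNIV (\<lambda>g. \<pi> g w) \<and> (\<exists>g. cinner H \<eta> (\<pi> g w) \<noteq> 0)"
  shows "\<exists>B\<subseteq>vecs H. bessel_family H (B \<times> UNIV) (\<lambda>(w, g). \<pi> g w) \<and>
    (\<forall>x\<in>vecs H. sq_sum (\<lambda>(w, g). cinner H x (\<pi> g w)) (B \<times> UNIV) = (hnorm H x)\<^sup>2)"
proof -
  define v where "v = (\<lambda>(w, g). \<pi> g w)"
  define Bs where "Bs = {B. B \<subseteq> vecs H \<and> bessel_family H (B \<times> UNIV) v}"
  have "\<exists>M\<in>Bs. \<forall>X\<in>Bs. M \<subseteq> X \<longrightarrow> X = M"
  proof (rule subset_Zorn_nonempty)
    have "{} \<in> Bs" by (simp add: Bs_def bessel_family_def)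
    then show "Bs \<noteq> {}" by blast
    fix C assume ne: "C \<noteq> {}" and C: "subset.chain Bs C"
    have CB: "C \<subseteq> Bs" using C unfolding subset_chain_def by blast
    have "(\<Sum>i\<in>F. (cmod (cinner H x (v i)))\<^sup>2) \<le> (hnorm H x)\<^sup>2"
      if x: "x \<in> vecs H" and F: "finite F" "F \<subseteq> \<Union>C \<times> UNIV" for x F
    proof -
      \<comment> \<open>A finite set of indices has finitely many first components, which all lie in
        one member of the chain.\<close>
      obtain B where "B \<in> C" "fst ` F \<subseteq> B"
      proof (rule finite_subset_Union_chain)
        show "finite (fst ` F)" using F by simp
        show "fst ` F \<subseteq> \<Union>C" using image_mono[OF F(2), of fst] by simp
        show "subset.chain Bs C" by (rule C)
      qed (use ne in auto)
      then have B: "B \<in> C" "F \<subseteq> B \<times> UNIV" by force+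
      then have "bessel_family H (B \<times> UNIV) v" using CB by (auto simp: Bs_def)
      then show ?thesis using x F B by (simp add: bessel_family_def)
    qed
    moreover have CH: "\<Union>C \<subseteq> vecs H" using CB by (auto simp: Bs_def)
    have "v i \<in> vecs H" if "i \<in> \<Union>C \<times> UNIV" for i
      using that CH rep_mem by (auto simp: v_def simp del: Union_iff)
    ultimately have "bessel_family H (\<Union>C \<times> UNIV) v" unfolding bessel_family_def by blast
    then show "\<Union>C \<in> Bs" using CB by (auto simp: Bs_def)
  qed
  then obtain B where BBs: "B \<in> Bs" and maxBs: "\<And>X. X \<in> Bs \<Longrightarrow> B \<subseteq> X \<Longrightarrow> X = B" by blast
  have B: "B \<subseteq> vecs H" and bf: "bessel_family H (B \<times> UNIV) v" using BBs by (simp_all add: Bs_def)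
  have max: "X = B" if "X \<subseteq> vecs H" "bessel_family H (X \<times> UNIV) v" "B \<subseteq> X" for X
    using maxBs[of X] that by (simp add: Bs_def)
  define I where "I = B \<times> (UNIV :: 'k set)"
  define c where "c x = (\<lambda>i. cinner H x (v i))" for x
  note bfI = bf[folded I_def]
  have sq: "sq_summable (c x) I" "sq_sum (c x) I \<le> (hnorm H x)\<^sup>2" if "x \<in> vecs H" for x
    unfolding c_def using bessel_family_summable[OF bfI that] by auto
  have vv: "v i \<in> vecs H" if "i \<in> I" for i using bessel_family_vecs[OF bfI that] .
  have "sq_sum (c \<eta>) I = (hnorm H \<eta>)\<^sup>2" if \<eta>: "\<eta> \<in> vecs H" for \<eta>
  proof (rule ccontr)
    assume "\<not> ?thesis"
    then have less: "sq_sum (c \<eta>) I < (hnorm H \<eta>)\<^sup>2" using sq(2)[OF \<eta>] by simp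
    \<comment> \<open>This is the form <R x, y>, introduced before R exists; it is positive by the
      Bessel bound. Its squared norm at \<open>x\<close> is the amount by which that bound fails to
      be an equality.\<close>
    define S where "S = \<lparr>vecs = vecs H, cinner = \<lambda>x y. cinner H x y - l2_inner I (c x) (c y)\<rparr>"
    have vS: "vecs S = vecs H" and iS: "cinner S x y = cinner H x y - l2_inner I (c x) (c y)" for x y
      by (simp_all add: S_def)
    have selfS: "cinner S x x = of_real ((hnorm H x)\<^sup>2 - sq_sum (c x) I)" if "x \<in> vecs H" for x
      using that sq by (simp add: iS cinner_self l2_inner_self)
    interpret S: semi_inner_space S
    proof
      show "complex_vector.subspace (vecs S)" using subspace by (simp add: vS)
      fix x y z b assume x: "x \<in> vecs S" and y: "y \<in> vecs S"
      show "cinner S (x + y) z = cinner S x z + cinner S y z" if z: "z \<in> vecs S"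
      proof -
        have "l2_inner I (c (x + y)) (c z) = l2_inner I (c x) (c z) + l2_inner I (c y) (c z)"
          unfolding c_def
          by (rule bessel_form_left(1)) (use x y z vv sq in \<open>auto simp: vS c_def\<close>)
        then show ?thesis using x y z by (simp add: iS vS add_left)
      qed
      have "l2_inner I (c (scaleC b x)) (c y) = b * l2_inner I (c x) (c y)"
        unfolding c_def
        by (rule bessel_form_left(2)[of I v _ x 0]) (use x y vv sq in \<open>auto simp: vS c_def\<close>)
      then show "cinner S (scaleC b x) y = b * cinner S x y"
        using x y by (simp add: iS vS scaleC_left right_diff_distrib)
      show "cinner S x y = cnj (cinner S y x)"
        using x y commute[of x y] l2_inner_commute[of I "c x" "c y"] by (simp add: iS vS)
      show "0 \<le> Re (cinner S x x)" using selfS[of x] sq(2)[of x] x by (simp add: vS)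
    qed
    have normS: "(hnorm S x)\<^sup>2 = (hnorm H x)\<^sup>2 - sq_sum (c x) I" if "x \<in> vecs H" for x
      using that selfS[of x] S.hnorm_sq[of x] by (simp add: vS)
    have normS_le: "hnorm S x \<le> hnorm H x" if "x \<in> vecs H" for x
      by (rule power2_le_imp_le) (use that normS infsum_nonneg[of I "\<lambda>i. (cmod (c x i))\<^sup>2"] in auto)
    have "\<exists>z\<in>vecs H. \<forall>x\<in>vecs H. cinner H x z = cinner S x y" if y: "y \<in> vecs H" for y
    proof -
      \<comment> \<open>Here \<open>z\<close> is the frame operator applied to \<open>y\<close>, so
        that \<open>R y = y - z\<close>.\<close>
      obtain z where z: "z \<in> vecs H" "\<And>x. x \<in> vecs H \<Longrightarrow> cinner H x z = l2_inner I (c x) (c y)"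
        using bessel_synthesis[OF bfI sq(1)[OF y]] unfolding c_def by blast
      have "cinner H x (y - z) = cinner S x y" if "x \<in> vecs H" for x
        using that y z by (simp add: diff_right iS)
      then show ?thesis using y z(1) by (intro bexI[of _ "y - z"]) auto
    qed
    then obtain R where R: "\<And>y. y \<in> vecs H \<Longrightarrow> R y \<in> vecs H"
      and RS: "\<And>x y. x \<in> vecs H \<Longrightarrow> y \<in> vecs H \<Longrightarrow> cinner H x (R y) = cinner S x y"
      by metis
    have RS': "cinner H (R x) y = cinner S x y" if "x \<in> vecs H" "y \<in> vecs H" for x y
      using commute[of "R x" y] S.commute[of x y] R RS that by (simp add: vS)
    \<comment> \<open>For each fixed \<open>w\<close>, translation by \<open>h\<close> permutes the
      indices \<open>(w, g)\<close>, so the frame operator, and with it R, commutes with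
      \<pi>.\<close>
    have S_rep: "cinner S (\<pi> h x) (\<pi> h y) = cinner S x y" if "x \<in> vecs H" "y \<in> vecs H" for x y h
    proof -
      have "l2_inner I (c (\<pi> h z)) (c (\<pi> h z')) = l2_inner I (c z) (c z')"
        if "z \<in> vecs H" "z' \<in> vecs H" for z z'
      proof -
        have "l2_inner I (c (\<pi> h z)) (c (\<pi> h z')) =
            l2_inner I (\<lambda>i. c z ((\<lambda>(w, g). (w, - h + g)) i)) (\<lambda>i. c z' ((\<lambda>(w, g). (w, - h + g)) i))"
          unfolding l2_inner_def
          by (intro infsum_cong) (use that B in \<open>auto simp: I_def c_def v_def cinner_rep_rep subset_iff\<close>)
        then show ?thesis using l2_inner_reindex[OF bij_shift_snd[of h B], of "c z" "c z'"] by (simp add: I_def)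
      qed
      then show ?thesis using that by (simp add: iS)
    qed
    \<comment> \<open>This is R^2 <= R, a consequence of R <= 1: |R x|^2 is the form
      \<open>S\<close> at \<open>x\<close> and \<open>R x\<close>, and the \<open>S\<close>-norm is
      at most the norm of \<open>H\<close>.\<close>
    have R_norm: "hnorm H (R x) \<le> hnorm S x" if x: "x \<in> vecs H" for x
    proof (cases "hnorm H (R x) = 0")
      case False
      have "(hnorm H (R x))\<^sup>2 = Re (cinner S x (R x))" using RS'[OF x R[OF x]] hnorm_sq[OF R[OF x]] by simp
      also have "\<dots> \<le> hnorm S x * hnorm S (R x)"
        by (rule order_trans[OF complex_Re_le_cmod S.cauchy_schwarz]) (use x R in \<open>auto simp: vS\<close>)
      also have "\<dots> \<le> hnorm S x * hnorm H (R x)"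
        by (intro mult_left_mono normS_le) (use x R vS in auto)
      finally have "hnorm H (R x) * hnorm H (R x) \<le> hnorm S x * hnorm H (R x)"
        by (simp add: power2_eq_square)
      moreover have "hnorm H (R x) > 0" using hnorm_nonneg[OF R[OF x]] False by simp
      ultimately show ?thesis by simp
    qed (use x vS in simp)
    have "cinner H \<eta> (R \<eta>) \<noteq> 0"
      unfolding RS[OF \<eta> \<eta>] selfS[OF \<eta>] of_real_eq_0_iff using less by linarith
    then have "R \<eta> \<noteq> 0" using \<eta> by auto
    then obtain w0 g0 where w0: "w0 \<in> vecs H" and bw0: "bessel_family H UNIV (\<lambda>g. \<pi> g w0)"
      and g0: "cinner H (R \<eta>) (\<pi> g0 w0) \<noteq> 0" using sep[OF R[OF \<eta>]] by blast
    define w where "w = R w0"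
    have w: "w \<in> vecs H" using R w0 by (simp add: w_def)
    \<comment> \<open>Equivariance and symmetry of R move it from \<open>w0\<close> to
      \<open>x\<close>, so the Bessel bound for \<open>w0\<close> can be used at
      \<open>R x\<close>.\<close>
    have coef: "cinner H x (\<pi> g w) = cinner H (R x) (\<pi> g w0)" if x: "x \<in> vecs H" for x g
    proof -
      have "cinner H x (\<pi> g w) = cinner H (\<pi> (- g) x) w" using rep_adjoint[of x w "- g"] x w by simp
      also have "\<dots> = cinner S (\<pi> (- g) x) (\<pi> (- g) (\<pi> g w0))" using RS x w0 by (simp add: w_def)
      also have "\<dots> = cinner S x (\<pi> g w0)" using S_rep[of x "\<pi> g w0" "- g"] x w0 by simp
      finally show ?thesis using RS' x w0 by simp
    qed
    have "w \<noteq> 0"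
    proof
      assume "w = 0"
      then have "\<pi> g0 w = 0" using rep_scaleC[of 0 g0 0] by simp
      then show False using coef[OF \<eta>, of g0] g0 \<eta> by simp
    qed
    then have wn: "hnorm H w > 0" using hnorm_eq_0[OF w] hnorm_nonneg[OF w] by linarith
    have w_sum: "(\<Sum>g\<in>F. (cmod (cinner H x (\<pi> g w)))\<^sup>2) \<le> (hnorm S x)\<^sup>2"
      if x: "x \<in> vecs H" and F: "finite F" for x F
    proof -
      have "(\<Sum>g\<in>F. (cmod (cinner H x (\<pi> g w)))\<^sup>2) = (\<Sum>g\<in>F. (cmod (cinner H (R x) (\<pi> g w0)))\<^sup>2)"
        by (simp add: coef[OF x])
      also have "\<dots> \<le> (hnorm H (R x))\<^sup>2" using bw0 R[OF x] F by (simp add: bessel_family_def)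
      also have "\<dots> \<le> (hnorm S x)\<^sup>2" using R_norm[OF x] R[OF x] by (intro power_mono) auto
      finally show ?thesis .
    qed
    text \<open>If \<open>w\<close> already belongs to \<open>B\<close>, a multiple of it does not, so it can still be added.\<close>
    have "\<exists>t::real. 1 / 2 \<le> t \<and> t \<le> 1 \<and> scaleC (of_real t) w \<notin> B"
    proof (rule ccontr)
      assume "\<not> ?thesis"
      then have tB: "scaleC (of_real t) w \<in> B" if "1 / 2 \<le> t" "t \<le> 1" for t :: real using that by blast
      \<comment> \<open>For t >= 1/2 the vector t w alone contributes at least |w|^4 / 4 to the
        Bessel sum at \<open>w\<close>, at the identity of the group. More than 4 / |w|^2 such
        vectors in \<open>B\<close> would push that sum beyond |w|^2.\<close>
      obtain N :: nat where N: "real N > 4 / (hnorm H w)\<^sup>2" using reals_Archimedean2 by blast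
      have "infinite {1/2..1::real}" by simp
      then obtain T where T: "T \<subseteq> {1/2..1::real}" "finite T" "card T = N"
        using infinite_arbitrarily_large by blast
      define f where "f t = (scaleC (complex_of_real t) w, 0 :: 'k)" for t
      have inj: "inj_on f T"
        using \<open>w \<noteq> 0\<close> by (auto simp: inj_on_def f_def complex_vector.scale_cancel_right)
      have fT: "f ` T \<subseteq> B \<times> UNIV" using tB T by (auto simp: f_def)
      have ge: "(hnorm H w)\<^sup>2 * (hnorm H w)\<^sup>2 / 4 \<le> (cmod (cinner H w (v (f t))))\<^sup>2" if "t \<in> T" for t
      proof -
        have t: "1 / 2 \<le> t" using T that by auto
        have "cmod (cinner H w (v (f t))) = t * (hnorm H w)\<^sup>2"
          using w t by (simp add: f_def v_def rep_zero scaleC_right cinner_self norm_mult norm_power)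
        then have "(cmod (cinner H w (v (f t))))\<^sup>2 = t\<^sup>2 * ((hnorm H w)\<^sup>2)\<^sup>2"
          by (simp add: power_mult_distrib)
        moreover have "(1 / 2)\<^sup>2 \<le> t\<^sup>2" using t by (intro power_mono) auto
        then have "(1 / 2)\<^sup>2 * ((hnorm H w)\<^sup>2)\<^sup>2 \<le> t\<^sup>2 * ((hnorm H w)\<^sup>2)\<^sup>2"
          by (rule mult_right_mono) simp
        ultimately show ?thesis by (simp add: power2_eq_square)
      qed
      have "real N * ((hnorm H w)\<^sup>2 * (hnorm H w)\<^sup>2 / 4) \<le> (\<Sum>t\<in>T. (cmod (cinner H w (v (f t))))\<^sup>2)"
        using sum_mono[OF ge, of T] T by simp
      also have "\<dots> = (\<Sum>i\<in>f ` T. (cmod (cinner H w (v i)))\<^sup>2)" by (simp add: sum.reindex[OF inj])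
      also have "\<dots> \<le> (hnorm H w)\<^sup>2" using bf w T fT by (simp add: bessel_family_def)
      finally have "real N * (hnorm H w)\<^sup>2 * (hnorm H w)\<^sup>2 \<le> 4 * (hnorm H w)\<^sup>2" by (simp add: mult.assoc)
      then have "real N * (hnorm H w)\<^sup>2 \<le> 4" using wn by (simp add: mult_le_cancel_right)
      then show False using N wn by (simp add: pos_divide_less_eq)
    qed
    then obtain t :: real where t: "1 / 2 \<le> t" "t \<le> 1" and tB: "scaleC (of_real t) w \<notin> B" by blast
    define u where "u = scaleC (complex_of_real t) w"
    have u: "u \<in> vecs H" using w by (simp add: u_def)
    have u_le: "(cmod (cinner H x (\<pi> g u)))\<^sup>2 \<le> (cmod (cinner H x (\<pi> g w)))\<^sup>2" if "x \<in> vecs H" for x g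
    proof -
      have "cmod (cinner H x (\<pi> g u)) = t * cmod (cinner H x (\<pi> g w))"
        using that w t by (simp add: u_def rep_scaleC scaleC_right norm_mult)
      also have "\<dots> \<le> cmod (cinner H x (\<pi> g w))" using t by (simp add: mult_left_le_one_le)
      finally show ?thesis by (simp add: power_mono)
    qed
    have "bessel_family H (insert u B \<times> UNIV) v"
      unfolding bessel_family_def
    proof (intro conjI ballI allI impI)
      show "v i \<in> vecs H" if "i \<in> insert u B \<times> UNIV" for i using that u B by (auto simp: v_def)
      fix x F assume x: "x \<in> vecs H" and F: "finite F" "F \<subseteq> insert u B \<times> (UNIV :: 'k set)"
      let ?q = "\<lambda>i. (cmod (cinner H x (v i)))\<^sup>2"
      define G where "G = {g. (u, g) \<in> F}"
      have finG: "finite G"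
        by (rule finite_subset[OF _ finite_imageI[OF F(1), of snd]])
          (auto simp: G_def intro: rev_image_eqI)
      have F_eq: "F = (F \<inter> I) \<union> Pair u ` G" "(F \<inter> I) \<inter> Pair u ` G = {}"
        using F tB by (auto simp: G_def I_def u_def)
      \<comment> \<open>The old indices use at most \<open>sq_sum (c x) I\<close>; the orbit of
        \<open>u\<close> fits into the room left over, which is exactly the squared
        \<open>S\<close>-norm of \<open>x\<close>.\<close>
      have "sum ?q F = sum ?q (F \<inter> I) + sum ?q (Pair u ` G)"
        using F_eq(2) F(1) finG by (subst F_eq(1)) (intro sum.union_disjoint, auto)
      also have "sum ?q (F \<inter> I) \<le> sq_sum (c x) I"
        using sq(1)[OF x] F by (auto simp: c_def intro!: finite_sum_le_infsum)
      also have "sum ?q (Pair u ` G) = (\<Sum>g\<in>G. (cmod (cinner H x (\<pi> g u)))\<^sup>2)"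
        by (subst sum.reindex) (auto simp: inj_on_def v_def)
      also have "\<dots> \<le> (\<Sum>g\<in>G. (cmod (cinner H x (\<pi> g w)))\<^sup>2)" by (intro sum_mono u_le x)
      also have "\<dots> \<le> (hnorm S x)\<^sup>2" by (rule w_sum[OF x finG])
      finally show "sum ?q F \<le> (hnorm H x)\<^sup>2" using normS[OF x] by simp
    qed
    then have "insert u B = B" using max[of "insert u B"] B u by blast
    then show False using tB u_def by blast
  qed
  then show ?thesis using B bf unfolding c_def I_def v_def
    by (intro exI[of _ B]) (simp add: case_prod_unfold)
qed

end

section \<open>Tensor products\<close>

text \<open>Bimodules are records with actions added to an inner product space. This carries the
  Hilbert space property over from the bare space to \<open>ell2\<close>, to \<open>coarse\<close>
  and to tensor powers.\<close>

lemma hilbert_space_cong: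
  assumes "hilbert_space H" "vecs K = vecs H" "cinner K = cinner H"
  shows "hilbert_space K"
proof -
  have "hnorm K = hnorm H" using assms by (simp add: hnorm_def fun_eq_iff)
  then have "hilbert_space K \<longleftrightarrow> hilbert_space H"
    unfolding hilbert_space_def assms(2,3) by (intro arg_cong2[of _ _ _ _ "(\<and>)"] refl) simp
  then show ?thesis using assms(1) by (rule iffD2)
qed

text \<open>Polarisation: the norm of x + y gives the real part of the inner product, and replacing
  x by \<open>scaleC \<i> x\<close> gives the imaginary part.\<close>

lemma (in semi_inner_space) isometric_betweenI:
  assumes K: "semi_inner_space K" and lin: "linear_between H K U"
    and norm: "\<And>x. x \<in> vecs H \<Longrightarrow> hnorm K (U x) = hnorm H x"
  shows "isometric_between H K U"
proof -
  interpret K: semi_inner_space K by (rule K)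
  have U: "U x \<in> vecs K" if "x \<in> vecs H" for x using lin that by (simp add: linear_between_def)
  have Re: "Re (cinner K (U x) (U y)) = Re (cinner H x y)" if "x \<in> vecs H" "y \<in> vecs H" for x y
  proof -
    have "U (x + y) = U x + U y" using lin that by (simp add: linear_between_def)
    then show ?thesis
      using K.hnorm_add_sq[OF U[OF that(1)] U[OF that(2)]] hnorm_add_sq[OF that]
        norm[OF that(1)] norm[OF that(2)] norm[OF add_mem[OF that]] by simp
  qed
  have "cinner K (U x) (U y) = cinner H x y" if "x \<in> vecs H" "y \<in> vecs H" for x y
  proof -
    have "U (scaleC \<i> x) = scaleC \<i> (U x)" using lin that by (simp add: linear_between_def)
    then have "Im (cinner K (U x) (U y)) = Im (cinner H x y)"
      using Re[of "scaleC \<i> x" y] that U by (simp add: scaleC_left K.scaleC_left)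
    then show ?thesis using Re[OF that] by (simp add: complex_eq_iff)
  qed
  then show ?thesis using lin by (simp add: isometric_between_def)
qed

lemma (in hilbert_space) antilinear_riesz:
  assumes "\<And>x y. x \<in> vecs H \<Longrightarrow> y \<in> vecs H \<Longrightarrow> f (x + y) = f x + f y"
    and "\<And>c x. x \<in> vecs H \<Longrightarrow> f (scaleC c x) = cnj c * f x"
    and "\<And>x. x \<in> vecs H \<Longrightarrow> cmod (f x) \<le> C * hnorm H x"
  shows "\<exists>w\<in>vecs H. \<forall>x\<in>vecs H. f x = cinner H w x"
proof -
  obtain w where w: "w \<in> vecs H" and eq: "\<And>x. x \<in> vecs H \<Longrightarrow> cnj (f x) = cinner H x w"
    using riesz[of "\<lambda>x. cnj (f x)" C] assms by auto
  have "f x = cinner H w x" if "x \<in> vecs H" for x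
    using arg_cong[OF eq[OF that], of cnj] commute[OF w that] by simp
  then show ?thesis using w by blast
qed

section \<open>Bounded multi-antilinear functionals, one variable at a time\<close>

lemma tuples_Nil [simp]: "tuples [] = {[]}"
  by (simp add: tuples_def)

lemma Cons_mem_tuples [simp]: "a # \<eta> \<in> tuples (H # Hs) \<longleftrightarrow> a \<in> vecs H \<and> \<eta> \<in> tuples Hs"
  by (auto simp: tuples_def set_Cons_def)

lemma tuples_ConsE:
  assumes "\<xi> \<in> tuples (H # Hs)"
  obtains a \<eta> where "\<xi> = a # \<eta>" "a \<in> vecs H" "\<eta> \<in> tuples Hs"
  using assms by (auto simp: tuples_def set_Cons_def)

lemma tuples_update:
  "\<eta> \<in> tuples Hs \<Longrightarrow> a \<in> vecs (Hs ! i) \<Longrightarrow> \<eta>[i := a] \<in> tuples Hs"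
  by (simp add: mem_tuples_iff) (metis nth_list_update_eq nth_list_update_neq)

lemma bounded_multi_antilinearI:
  assumes "\<And>\<eta> i a b. \<lbrakk>\<eta> \<in> tuples Hs; i < length Hs; a \<in> vecs (Hs ! i); b \<in> vecs (Hs ! i)\<rbrakk> \<Longrightarrow>
      \<phi> (\<eta>[i := a + b]) = \<phi> (\<eta>[i := a]) + \<phi> (\<eta>[i := b])"
    and "\<And>\<eta> i a c. \<lbrakk>\<eta> \<in> tuples Hs; i < length Hs; a \<in> vecs (Hs ! i)\<rbrakk> \<Longrightarrow>
      \<phi> (\<eta>[i := scaleC c a]) = cnj c * \<phi> (\<eta>[i := a])"
    and "\<And>\<eta>. \<eta> \<in> tuples Hs \<Longrightarrow> cmod (\<phi> \<eta>) \<le> C * (\<Prod>i<length Hs. hnorm (Hs ! i) (\<eta> ! i))"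
  shows "bounded_multi_antilinear Hs \<phi>"
  unfolding bounded_multi_antilinear_def using assms by blast

lemma bounded_multi_antilinearD:
  assumes "bounded_multi_antilinear Hs \<phi>"
  shows "\<lbrakk>\<eta> \<in> tuples Hs; i < length Hs; a \<in> vecs (Hs ! i); b \<in> vecs (Hs ! i)\<rbrakk> \<Longrightarrow>
      \<phi> (\<eta>[i := a + b]) = \<phi> (\<eta>[i := a]) + \<phi> (\<eta>[i := b])"
    and "\<lbrakk>\<eta> \<in> tuples Hs; i < length Hs; a \<in> vecs (Hs ! i)\<rbrakk> \<Longrightarrow>
      \<phi> (\<eta>[i := scaleC c a]) = cnj c * \<phi> (\<eta>[i := a])"
    and "\<exists>C. \<forall>\<eta>\<in>tuples Hs. cmod (\<phi> \<eta>) \<le> C * (\<Prod>i<length Hs. hnorm (Hs ! i) (\<eta> ! i))"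
  using assms unfolding bounded_multi_antilinear_def by blast+

lemma bounded_multi_antilinear_tail:
  assumes "bounded_multi_antilinear (H # Hs) \<phi>" "a \<in> vecs H"
  shows "bounded_multi_antilinear Hs (\<lambda>\<eta>. \<phi> (a # \<eta>))"
proof -
  obtain C where C: "\<And>\<eta>. \<eta> \<in> tuples (H # Hs) \<Longrightarrow>
      cmod (\<phi> \<eta>) \<le> C * (\<Prod>i<Suc (length Hs). hnorm ((H # Hs) ! i) (\<eta> ! i))"
    using bounded_multi_antilinearD(3)[OF assms(1)] by auto
  show ?thesis
  proof (rule bounded_multi_antilinearI)
    show "\<phi> (a # \<eta>[i := b + c]) = \<phi> (a # \<eta>[i := b]) + \<phi> (a # \<eta>[i := c])"
      if "\<eta> \<in> tuples Hs" "i < length Hs" "b \<in> vecs (Hs ! i)" "c \<in> vecs (Hs ! i)" for \<eta> i b c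
      using bounded_multi_antilinearD(1)[OF assms(1), of "a # \<eta>" "Suc i" b c] that assms(2) by simp
    show "\<phi> (a # \<eta>[i := scaleC c b]) = cnj c * \<phi> (a # \<eta>[i := b])"
      if "\<eta> \<in> tuples Hs" "i < length Hs" "b \<in> vecs (Hs ! i)" for \<eta> i b c
      using bounded_multi_antilinearD(2)[OF assms(1), of "a # \<eta>" "Suc i" b c] that assms(2) by simp
    show "cmod (\<phi> (a # \<eta>)) \<le> (C * hnorm H a) * (\<Prod>i<length Hs. hnorm (Hs ! i) (\<eta> ! i))"
      if "\<eta> \<in> tuples Hs" for \<eta>
      using C[of "a # \<eta>"] that assms(2)
      by (simp add: prod.lessThan_Suc_shift mult.assoc del: prod.lessThan_Suc)
  qed
qed

text \<open>With the other variables frozen, a functional is an inner product in the first one.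
  Together with \<open>bounded_multi_antilinear_tail\<close> this drives the inductions over the
  list of spaces.\<close>

lemma bounded_multi_antilinear_head:
  assumes H: "hilbert_space H" and \<phi>: "bounded_multi_antilinear (H # Hs) \<phi>" and \<eta>: "\<eta> \<in> tuples Hs"
  shows "\<exists>w\<in>vecs H. \<forall>a\<in>vecs H. \<phi> (a # \<eta>) = cinner H w a"
proof -
  obtain C where C: "\<And>\<eta>. \<eta> \<in> tuples (H # Hs) \<Longrightarrow>
      cmod (\<phi> \<eta>) \<le> C * (\<Prod>i<Suc (length Hs). hnorm ((H # Hs) ! i) (\<eta> ! i))"
    using bounded_multi_antilinearD(3)[OF \<phi>] by auto
  show ?thesis
  proof (rule hilbert_space.antilinear_riesz[OF H])
    show "\<phi> ((a + b) # \<eta>) = \<phi> (a # \<eta>) + \<phi> (b # \<eta>)" if "a \<in> vecs H" "b \<in> vecs H" for a b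
      using bounded_multi_antilinearD(1)[OF \<phi>, of "a # \<eta>" 0 a b] that \<eta> by simp
    show "\<phi> (scaleC c a # \<eta>) = cnj c * \<phi> (a # \<eta>)" if "a \<in> vecs H" for c a
      using bounded_multi_antilinearD(2)[OF \<phi>, of "a # \<eta>" 0 a c] that \<eta> by simp
    show "cmod (\<phi> (a # \<eta>)) \<le> (C * (\<Prod>i<length Hs. hnorm (Hs ! i) (\<eta> ! i))) * hnorm H a"
      if "a \<in> vecs H" for a
      using C[of "a # \<eta>"] that \<eta>
      by (simp add: prod.lessThan_Suc_shift mult_ac del: prod.lessThan_Suc)
  qed
qed

text \<open>Trivial orthogonal complement: unlike density, this can be exploited in one variable of
  a functional at a time, without forming spans or approximations of tensors.\<close>

definition separating :: "('a::complex_vector, 'm) inner_space_scheme \<Rightarrow> 'a set \<Rightarrow> bool" where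
  "separating H E \<longleftrightarrow> E \<subseteq> vecs H \<and> (\<forall>w\<in>vecs H. (\<forall>b\<in>E. cinner H w b = 0) \<longrightarrow> w = 0)"

text \<open>This is totality of the pure tensors with entries in separating sets. By induction the
  functional vanishes once its first entry is in \<open>E\<close>; hence the vector representing its
  first variable is orthogonal to \<open>E\<close> and is 0.\<close>

lemma bounded_multi_antilinear_eq_0:
  assumes "\<And>H. H \<in> set Hs \<Longrightarrow> hilbert_space H" "list_all2 separating Hs Es"
    and "bounded_multi_antilinear Hs \<phi>" "\<And>e. e \<in> listset Es \<Longrightarrow> \<phi> e = 0" "\<eta> \<in> tuples Hs"
  shows "\<phi> \<eta> = 0"
  using assms
proof (induction Hs arbitrary: Es \<phi> \<eta>)
  case (Cons H Hs)
  interpret hilbert_space H using Cons.prems(1) by simp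
  obtain E Es' where Es: "Es = E # Es'" and E: "separating H E" and Es': "list_all2 separating Hs Es'"
    using Cons.prems(2) by (auto simp: list_all2_Cons1)
  obtain a \<xi> where \<eta>: "\<eta> = a # \<xi>" "a \<in> vecs H" "\<xi> \<in> tuples Hs"
    using Cons.prems(5) by (rule tuples_ConsE)
  obtain w where w: "w \<in> vecs H" and eq: "\<And>a. a \<in> vecs H \<Longrightarrow> \<phi> (a # \<xi>) = cinner H w a"
    using bounded_multi_antilinear_head[OF hilbert_space_axioms Cons.prems(3) \<eta>(3)] by blast
  have "cinner H w b = 0" if b: "b \<in> E" for b
  proof -
    have bH: "b \<in> vecs H" using E b by (auto simp: separating_def)
    have "\<phi> (b # \<xi>) = 0"
    proof (rule Cons.IH[OF _ Es' bounded_multi_antilinear_tail[OF Cons.prems(3) bH]])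
      show "\<phi> (b # e) = 0" if "e \<in> listset Es'" for e
        using Cons.prems(4)[of "b # e"] that b by (simp add: Es set_Cons_def)
    qed (use Cons.prems(1) \<eta>(3) in auto)
    then show ?thesis using eq[OF bH] by simp
  qed
  then have "w = 0" using E w by (auto simp: separating_def)
  then show ?case using eq[OF \<eta>(2)] \<eta> by simp
qed simp

section \<open>The inner product of the tensor space and pure tensors\<close>

lemma vecs_tensor_space:
  "\<phi> \<in> vecs (tensor_space Hs) \<longleftrightarrow>
    bounded_multi_antilinear Hs \<phi> \<and> (\<forall>\<eta>. \<eta> \<notin> tuples Hs \<longrightarrow> \<phi> \<eta> = 0) \<and> sq_summable \<phi> (onb_tuples Hs)"
  by (simp add: tensor_space_def)

lemma cinner_tensor_space: "cinner (tensor_space Hs) = l2_inner (onb_tuples Hs)"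
  by (simp add: tensor_space_def l2_inner_def fun_eq_iff)

lemma bounded_multi_antilinear_add:
  assumes "bounded_multi_antilinear Hs \<phi>" "bounded_multi_antilinear Hs \<psi>"
  shows "bounded_multi_antilinear Hs (\<phi> + \<psi>)"
proof -
  obtain C where C: "\<And>\<eta>. \<eta> \<in> tuples Hs \<Longrightarrow> cmod (\<phi> \<eta>) \<le> C * (\<Prod>i<length Hs. hnorm (Hs ! i) (\<eta> ! i))"
    using bounded_multi_antilinearD(3)[OF assms(1)] by blast
  obtain C' where C': "\<And>\<eta>. \<eta> \<in> tuples Hs \<Longrightarrow> cmod (\<psi> \<eta>) \<le> C' * (\<Prod>i<length Hs. hnorm (Hs ! i) (\<eta> ! i))"
    using bounded_multi_antilinearD(3)[OF assms(2)] by blast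
  show ?thesis
  proof (rule bounded_multi_antilinearI[where C = "C + C'"])
    show "cmod ((\<phi> + \<psi>) \<eta>) \<le> (C + C') * (\<Prod>i<length Hs. hnorm (Hs ! i) (\<eta> ! i))" if "\<eta> \<in> tuples Hs" for \<eta>
      using norm_triangle_le[OF add_mono[OF C[OF that] C'[OF that]]] by (simp add: distrib_right)
  qed (simp_all add: bounded_multi_antilinearD(1,2)[OF assms(1)] bounded_multi_antilinearD(1,2)[OF assms(2)]
      distrib_left)
qed

lemma bounded_multi_antilinear_scale:
  assumes "bounded_multi_antilinear Hs \<phi>"
  shows "bounded_multi_antilinear Hs (scaleC c \<phi>)"
proof -
  obtain C where C: "\<And>\<eta>. \<eta> \<in> tuples Hs \<Longrightarrow> cmod (\<phi> \<eta>) \<le> C * (\<Prod>i<length Hs. hnorm (Hs ! i) (\<eta> ! i))"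
    using bounded_multi_antilinearD(3)[OF assms(1)] by blast
  show ?thesis
  proof (rule bounded_multi_antilinearI[where C = "cmod c * C"])
    show "cmod (scaleC c \<phi> \<eta>) \<le> (cmod c * C) * (\<Prod>i<length Hs. hnorm (Hs ! i) (\<eta> ! i))"
      if "\<eta> \<in> tuples Hs" for \<eta>
      using mult_left_mono[OF C[OF that], of "cmod c"]
      by (simp add: scaleC_fun_def scaleC_complex_def norm_mult mult.assoc)
  qed (simp_all add: bounded_multi_antilinearD(1,2)[OF assms(1)] scaleC_fun_def scaleC_complex_def
      distrib_left)
qed

lemma scaleC_apply: "scaleC c \<phi> \<eta> = c * (\<phi> \<eta> :: complex)"
  by (simp add: scaleC_fun_def scaleC_complex_def)

lemma semi_inner_space_tensor_space: "semi_inner_space (tensor_space Hs)"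
proof
  have "0 \<in> vecs (tensor_space Hs)"
    unfolding vecs_tensor_space by (auto intro!: bounded_multi_antilinearI[where C = 0])
  then show "complex_vector.subspace (vecs (tensor_space Hs))"
    unfolding complex_vector.subspace_def
    by (auto simp: vecs_tensor_space bounded_multi_antilinear_add bounded_multi_antilinear_scale
        scaleC_apply intro: sq_summable_add sq_summable_scale)
  show "cinner (tensor_space Hs) x y = cnj (cinner (tensor_space Hs) y x)" for x y
    unfolding cinner_tensor_space using l2_inner_commute .
qed (auto simp: vecs_tensor_space cinner_tensor_space plus_fun_def l2_inner_add_left
    l2_inner_self infsum_nonneg scaleC_fun_def scaleC_complex_def l2_inner_scale_left)

lemma hnorm_tensor_space:
  "\<phi> \<in> vecs (tensor_space Hs) \<Longrightarrow> hnorm (tensor_space Hs) \<phi> = sqrt (sq_sum \<phi> (onb_tuples Hs))"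
  by (simp add: hnorm_def vecs_tensor_space cinner_tensor_space l2_inner_self)

lemma pure_tensor_Nil: "pure_tensor [] [] = (\<lambda>\<eta>. if \<eta> = [] then 1 else 0)"
  by (auto simp: pure_tensor_def)

lemma pure_tensor_Cons:
  "a \<in> vecs H \<Longrightarrow> pure_tensor (H # Hs) (x # \<xi>) (a # \<eta>) = cinner H x a * pure_tensor Hs \<xi> \<eta>"
  by (simp add: pure_tensor_def prod.lessThan_Suc_shift del: prod.lessThan_Suc)

text \<open>A finite subset of the product lies in a finite rectangle, over which the sum
  factors.\<close>

lemma sq_summable_product:
  assumes "sq_summable f A" "sq_summable g B"
  shows "sq_summable (\<lambda>(a, b). f a * g b) (A \<times> B)"
proof (rule nonneg_bounded_summable(1))
  fix F assume F: "finite F" "F \<subseteq> A \<times> B"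
  have "(\<Sum>i\<in>F. (cmod (case i of (a, b) \<Rightarrow> f a * g b))\<^sup>2)
      \<le> (\<Sum>i\<in>fst ` F \<times> snd ` F. (cmod (case i of (a, b) \<Rightarrow> f a * g b))\<^sup>2)"
    using F by (intro sum_mono2) (auto simp: image_iff, force+)
  also have "\<dots> = (\<Sum>a\<in>fst ` F. (cmod (f a))\<^sup>2) * (\<Sum>b\<in>snd ` F. (cmod (g b))\<^sup>2)"
    by (simp add: sum_product sum.cartesian_product case_prod_unfold norm_mult power_mult_distrib)
  also have "\<dots> \<le> sq_sum f A * sq_sum g B"
    using F assms by (intro mult_mono finite_sum_le_infsum sum_nonneg infsum_nonneg) auto
  finally show "(\<Sum>i\<in>F. (cmod (case i of (a, b) \<Rightarrow> f a * g b))\<^sup>2) \<le> sq_sum f A * sq_sum g B" .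
qed simp

lemma bij_onb_tuples: "bij_betw (\<lambda>(b, e). b # e) (onb H \<times> onb_tuples Hs) (onb_tuples (H # Hs))"
  by (auto simp: bij_betw_def inj_on_def onb_tuples_def set_Cons_def image_iff)

lemma orthonormal_onb: "hilbert_space H \<Longrightarrow> orthonormal_on H (onb H) (\<lambda>b. b)"
  using hilbert_space.is_onb_onb by (auto simp: is_onb_def)

lemma onb_vecs: "hilbert_space H \<Longrightarrow> b \<in> onb H \<Longrightarrow> b \<in> vecs H"
  using orthonormal_onb by (auto simp: orthonormal_on_def)

lemma onb_tuples_subset:
  "(\<And>H. H \<in> set Hs \<Longrightarrow> hilbert_space H) \<Longrightarrow> e \<in> onb_tuples Hs \<Longrightarrow> e \<in> tuples Hs"
  by (induction Hs arbitrary: e) (auto simp: onb_tuples_def set_Cons_def onb_vecs)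

lemma sq_summable_pure_tensor:
  assumes "\<And>H. H \<in> set Hs \<Longrightarrow> hilbert_space H" "\<xi> \<in> tuples Hs"
  shows "sq_summable (pure_tensor Hs \<xi>) (onb_tuples Hs)"
  using assms
proof (induction Hs arbitrary: \<xi>)
  case Nil
  then show ?case by (simp add: onb_tuples_def)
next
  case (Cons H Hs)
  interpret hilbert_space H using Cons.prems(1) by simp
  obtain x \<zeta> where \<xi>: "\<xi> = x # \<zeta>" "x \<in> vecs H" "\<zeta> \<in> tuples Hs"
    using Cons.prems(2) by (rule tuples_ConsE)
  have 1: "sq_summable (cinner H x) (onb H)"
    using bessel_family_summable(1)[OF orthonormal_bessel_family[OF orthonormal_onb[OF hilbert_space_axioms]]
        \<xi>(2)] by simp
  have 2: "sq_summable (pure_tensor Hs \<zeta>) (onb_tuples Hs)"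
    using Cons.IH Cons.prems(1) \<xi>(3) by simp
  have "sq_summable (\<lambda>i. pure_tensor (H # Hs) \<xi> ((\<lambda>(b, e). b # e) i)) (onb H \<times> onb_tuples Hs) \<longleftrightarrow>
      sq_summable (\<lambda>(a, b). cinner H x a * pure_tensor Hs \<zeta> b) (onb H \<times> onb_tuples Hs)"
    by (intro summable_on_cong)
      (auto simp: \<xi> pure_tensor_Cons onb_vecs[OF hilbert_space_axioms])
  then show ?case
    using sq_summable_product[OF 1 2]
      summable_on_reindex_bij_betw[OF bij_onb_tuples, of "\<lambda>e. (cmod (pure_tensor (H # Hs) \<xi> e))\<^sup>2" H Hs]
    by blast
qed

lemma pure_tensor_update:
  assumes "\<eta> \<in> tuples Hs" "i < length Hs" "a \<in> vecs (Hs ! i)"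
  shows "pure_tensor Hs \<xi> (\<eta>[i := a]) =
    cinner (Hs ! i) (\<xi> ! i) a * (\<Prod>j\<in>{..<length Hs} - {i}. cinner (Hs ! j) (\<xi> ! j) (\<eta> ! j))"
proof -
  have l: "length \<eta> = length Hs" using assms(1) by (simp add: mem_tuples_iff)
  have "(\<Prod>j<length Hs. cinner (Hs ! j) (\<xi> ! j) (\<eta>[i := a] ! j)) =
      cinner (Hs ! i) (\<xi> ! i) (\<eta>[i := a] ! i) *
      (\<Prod>j\<in>{..<length Hs} - {i}. cinner (Hs ! j) (\<xi> ! j) (\<eta>[i := a] ! j))"
    using assms by (intro prod.remove) auto
  also have "\<dots> = cinner (Hs ! i) (\<xi> ! i) a *
      (\<Prod>j\<in>{..<length Hs} - {i}. cinner (Hs ! j) (\<xi> ! j) (\<eta> ! j))"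
    using assms l by (intro arg_cong2[of _ _ _ _ "(*)"] prod.cong) auto
  finally show ?thesis using tuples_update[OF assms(1,3)] by (simp add: pure_tensor_def)
qed

lemma pure_tensor_mem:
  assumes hs: "\<And>H. H \<in> set Hs \<Longrightarrow> hilbert_space H" and \<xi>: "\<xi> \<in> tuples Hs"
  shows "pure_tensor Hs \<xi> \<in> vecs (tensor_space Hs)"
proof -
  have semi: "semi_inner_space (Hs ! i)" if "i < length Hs" for i
  proof -
    interpret hilbert_space "Hs ! i" using hs that by simp
    show ?thesis by (rule semi_inner_space_axioms)
  qed
  have \<xi>v: "\<xi> ! i \<in> vecs (Hs ! i)" if "i < length Hs" for i using \<xi> that by (simp add: mem_tuples_iff)
  have "bounded_multi_antilinear Hs (pure_tensor Hs \<xi>)"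
  proof (rule bounded_multi_antilinearI)
    fix \<eta> i a b c assume \<eta>: "\<eta> \<in> tuples Hs" and i: "i < length Hs" and a: "a \<in> vecs (Hs ! i)"
    interpret semi_inner_space "Hs ! i" by (rule semi[OF i])
    show "pure_tensor Hs \<xi> (\<eta>[i := scaleC c a]) = cnj c * pure_tensor Hs \<xi> (\<eta>[i := a])"
      using \<eta> i a \<xi>v by (simp add: pure_tensor_update scaleC_right)
    show "pure_tensor Hs \<xi> (\<eta>[i := a + b]) = pure_tensor Hs \<xi> (\<eta>[i := a]) + pure_tensor Hs \<xi> (\<eta>[i := b])"
      if "b \<in> vecs (Hs ! i)"
      using \<eta> i a that \<xi>v by (simp add: pure_tensor_update add_right distrib_right)
  next
    fix \<eta> assume \<eta>: "\<eta> \<in> tuples Hs"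
    have "cmod (pure_tensor Hs \<xi> \<eta>) \<le> (\<Prod>i<length Hs. hnorm (Hs ! i) (\<xi> ! i) * hnorm (Hs ! i) (\<eta> ! i))"
      using \<eta> semi_inner_space.cauchy_schwarz[OF semi \<xi>v]
      by (auto simp: pure_tensor_def prod_norm[symmetric] mem_tuples_iff intro!: prod_mono)
    then show "cmod (pure_tensor Hs \<xi> \<eta>) \<le>
        (\<Prod>i<length Hs. hnorm (Hs ! i) (\<xi> ! i)) * (\<Prod>i<length Hs. hnorm (Hs ! i) (\<eta> ! i))"
      by (simp add: prod.distrib)
  qed
  then show ?thesis
    using sq_summable_pure_tensor[of Hs, OF hs \<xi>] by (simp add: vecs_tensor_space) (simp add: pure_tensor_def)
qed

text \<open>Induction on the list of spaces: the sum over the remaining bases is the induction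
  hypothesis for a slice of \<open>\<phi>\<close>, and the sum over the first basis is Parseval's
  identity. This reproducing property makes evaluation at a tuple an inner product, independent of
  the bases chosen.\<close>

lemma l2_inner_pure_tensor:
  assumes "\<And>H. H \<in> set Hs \<Longrightarrow> hilbert_space H" "\<phi> \<in> vecs (tensor_space Hs)" "\<xi> \<in> tuples Hs"
  shows "l2_inner (onb_tuples Hs) \<phi> (pure_tensor Hs \<xi>) = \<phi> \<xi>"
  using assms
proof (induction Hs arbitrary: \<phi> \<xi>)
  case Nil
  then show ?case by (simp add: l2_inner_def onb_tuples_def pure_tensor_Nil)
next
  case (Cons H Hs)
  interpret hilbert_space H using Cons.prems(1) by simp
  obtain x \<zeta> where \<xi>: "\<xi> = x # \<zeta>" "x \<in> vecs H" "\<zeta> \<in> tuples Hs"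
    using Cons.prems(3) by (rule tuples_ConsE)
  have \<phi>: "bounded_multi_antilinear (H # Hs) \<phi>" "\<And>\<eta>. \<eta> \<notin> tuples (H # Hs) \<Longrightarrow> \<phi> \<eta> = 0"
    "sq_summable \<phi> (onb_tuples (H # Hs))"
    using Cons.prems(2) by (auto simp: vecs_tensor_space)
  define P where "P = pure_tensor (H # Hs) \<xi>"
  have slice: "(\<lambda>e. \<phi> (b # e)) \<in> vecs (tensor_space Hs)" if b: "b \<in> onb H" for b
  proof -
    have bH: "b \<in> vecs H" using onb_vecs[OF hilbert_space_axioms b] .
    have "sq_summable \<phi> ((#) b ` onb_tuples Hs)"
      by (rule summable_on_subset_banach[OF \<phi>(3)]) (use b in \<open>auto simp: onb_tuples_def set_Cons_def\<close>)
    then have "sq_summable (\<lambda>e. \<phi> (b # e)) (onb_tuples Hs)"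
      by (subst (asm) summable_on_reindex) (auto simp: inj_on_def o_def)
    then show ?thesis
      using bounded_multi_antilinear_tail[OF \<phi>(1) bH] \<phi>(2) by (auto simp: vecs_tensor_space)
  qed
  have "sq_summable P (onb_tuples (H # Hs))"
    unfolding P_def by (rule sq_summable_pure_tensor) (use Cons.prems in auto)
  then have "(\<lambda>e. \<phi> e * cnj (P e)) summable_on onb_tuples (H # Hs)"
    by (rule abs_summable_summable[OF sq_summable_mult[OF \<phi>(3)]])
  then have sm: "(\<lambda>(b, e). \<phi> (b # e) * cnj (P (b # e))) summable_on onb H \<times> onb_tuples Hs"
    using summable_on_reindex_bij_betw[OF bij_onb_tuples, of "\<lambda>e. \<phi> e * cnj (P e)" H Hs]
    by (simp add: case_prod_unfold)
  have "l2_inner (onb_tuples (H # Hs)) \<phi> P =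
      (\<Sum>\<^sub>\<infinity>(b, e)\<in>onb H \<times> onb_tuples Hs. \<phi> (b # e) * cnj (P (b # e)))"
    unfolding l2_inner_def
    using infsum_reindex_bij_betw[OF bij_onb_tuples, of "\<lambda>e. \<phi> e * cnj (P e)" H Hs]
    by (simp add: case_prod_unfold)
  \<comment> \<open>The double sum may be iterated because a product of two square-summable
    functions is absolutely summable.\<close>
  also have "\<dots> = (\<Sum>\<^sub>\<infinity>b\<in>onb H. \<Sum>\<^sub>\<infinity>e\<in>onb_tuples Hs. \<phi> (b # e) * cnj (P (b # e)))"
    using infsum_Sigma'_banach[OF sm] by simp
  also have "\<dots> = (\<Sum>\<^sub>\<infinity>b\<in>onb H. \<phi> (b # \<zeta>) * cnj (cinner H x b))"
  proof (rule infsum_cong)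
    fix b assume b: "b \<in> onb H"
    have "(\<Sum>\<^sub>\<infinity>e\<in>onb_tuples Hs. \<phi> (b # e) * cnj (P (b # e))) =
        (\<Sum>\<^sub>\<infinity>e\<in>onb_tuples Hs. cnj (cinner H x b) * (\<phi> (b # e) * cnj (pure_tensor Hs \<zeta> e)))"
      using onb_vecs[OF hilbert_space_axioms b]
      by (intro infsum_cong) (simp add: P_def \<xi> pure_tensor_Cons)
    also have "\<dots> = cnj (cinner H x b) * l2_inner (onb_tuples Hs) (\<lambda>e. \<phi> (b # e)) (pure_tensor Hs \<zeta>)"
      by (simp add: infsum_cmult_right' l2_inner_def)
    also have "l2_inner (onb_tuples Hs) (\<lambda>e. \<phi> (b # e)) (pure_tensor Hs \<zeta>) = \<phi> (b # \<zeta>)"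
      using Cons.IH[OF _ slice[OF b] \<xi>(3)] Cons.prems(1) by simp
    finally show "(\<Sum>\<^sub>\<infinity>e\<in>onb_tuples Hs. \<phi> (b # e) * cnj (P (b # e))) = \<phi> (b # \<zeta>) * cnj (cinner H x b)"
      by (simp add: mult.commute)
  qed
  also have "\<dots> = \<phi> (x # \<zeta>)"
  proof -
    obtain w where w: "w \<in> vecs H" and eq: "\<And>a. a \<in> vecs H \<Longrightarrow> \<phi> (a # \<zeta>) = cinner H w a"
      using bounded_multi_antilinear_head[OF hilbert_space_axioms \<phi>(1) \<xi>(3)] by blast
    have "(\<Sum>\<^sub>\<infinity>b\<in>onb H. \<phi> (b # \<zeta>) * cnj (cinner H x b)) =
        (\<Sum>\<^sub>\<infinity>b\<in>onb H. cinner H w b * cnj (cinner H x b))"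
      by (intro infsum_cong) (simp add: eq onb_vecs[OF hilbert_space_axioms])
    also have "\<dots> = cinner H w x" by (rule infsumI[OF onb_parseval[OF is_onb_onb w \<xi>(2)]])
    finally show ?thesis using eq[OF \<xi>(2)] by simp
  qed
  finally show ?case by (simp add: P_def \<xi>(1))
qed

context
  fixes Hs :: "('a::complex_vector, 'm) inner_space_scheme list"
  assumes hs: "\<And>H. H \<in> set Hs \<Longrightarrow> hilbert_space H"
begin

interpretation semi_inner_space "tensor_space Hs"
  by (rule semi_inner_space_tensor_space)

lemma cinner_pure_tensor_right:
  "\<phi> \<in> vecs (tensor_space Hs) \<Longrightarrow> \<xi> \<in> tuples Hs \<Longrightarrow>
    cinner (tensor_space Hs) \<phi> (pure_tensor Hs \<xi>) = \<phi> \<xi>"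
  unfolding cinner_tensor_space using l2_inner_pure_tensor hs by blast

lemma cinner_pure_tensor:
  assumes "\<xi> \<in> tuples Hs" "\<zeta> \<in> tuples Hs"
  shows "cinner (tensor_space Hs) (pure_tensor Hs \<xi>) (pure_tensor Hs \<zeta>) =
    (\<Prod>i<length Hs. cinner (Hs ! i) (\<xi> ! i) (\<zeta> ! i))"
  using cinner_pure_tensor_right[OF pure_tensor_mem[OF hs assms(1)] assms(2)] assms(2)
  by (simp add: pure_tensor_def)

lemma hnorm_pure_tensor:
  assumes "\<xi> \<in> tuples Hs"
  shows "hnorm (tensor_space Hs) (pure_tensor Hs \<xi>) = (\<Prod>i<length Hs. hnorm (Hs ! i) (\<xi> ! i))"
proof -
  have i: "cinner (Hs ! i) (\<xi> ! i) (\<xi> ! i) = of_real ((hnorm (Hs ! i) (\<xi> ! i))\<^sup>2)"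
    "0 \<le> hnorm (Hs ! i) (\<xi> ! i)" if "i < length Hs" for i
  proof -
    interpret h: hilbert_space "Hs ! i" using hs that by simp
    show "cinner (Hs ! i) (\<xi> ! i) (\<xi> ! i) = of_real ((hnorm (Hs ! i) (\<xi> ! i))\<^sup>2)"
      "0 \<le> hnorm (Hs ! i) (\<xi> ! i)"
      using assms that h.cinner_self h.hnorm_nonneg by (simp_all add: mem_tuples_iff)
  qed
  have eq: "cinner (tensor_space Hs) (pure_tensor Hs \<xi>) (pure_tensor Hs \<xi>) =
      of_real ((\<Prod>i<length Hs. hnorm (Hs ! i) (\<xi> ! i))\<^sup>2)"
    unfolding cinner_pure_tensor[OF assms assms] prod_power_distrib of_real_prod
    by (intro prod.cong refl) (simp add: i)
  show ?thesis
    unfolding hnorm_def[of "tensor_space Hs"] eq Re_complex_of_real real_sqrt_abs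
    by (intro abs_of_nonneg prod_nonneg) (simp add: i(2))
qed

lemma tensor_bound:
  assumes "\<phi> \<in> vecs (tensor_space Hs)" "\<xi> \<in> tuples Hs"
  shows "cmod (\<phi> \<xi>) \<le> hnorm (tensor_space Hs) \<phi> * (\<Prod>i<length Hs. hnorm (Hs ! i) (\<xi> ! i))"
  using cauchy_schwarz[OF assms(1) pure_tensor_mem[OF hs assms(2)]] assms
  by (simp add: cinner_pure_tensor_right hnorm_pure_tensor)

lemma tensor_ext:
  assumes "\<phi> \<in> vecs (tensor_space Hs)" "\<And>\<xi>. \<xi> \<in> tuples Hs \<Longrightarrow> \<phi> \<xi> = 0"
  shows "\<phi> = 0"
  using assms by (auto simp: vecs_tensor_space fun_eq_iff)

text \<open>By \<open>tensor_bound\<close>, evaluation at a tuple is continuous. This yields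
  definiteness, and a pointwise limit for each Cauchy sequence; the identities of
  multi-antilinearity pass to that limit, and \<open>l2_complete\<close> gives convergence in
  norm.\<close>

lemma hilbert_space_tensor_space: "hilbert_space (tensor_space Hs)"
proof
  let ?T = "tensor_space Hs"
  show "\<phi> = 0" if \<phi>: "\<phi> \<in> vecs ?T" and 0: "cinner ?T \<phi> \<phi> = 0" for \<phi>
  proof (rule tensor_ext[OF \<phi>])
    have "hnorm ?T \<phi> = 0" using 0 by (simp add: hnorm_def)
    then show "\<phi> \<xi> = 0" if "\<xi> \<in> tuples Hs" for \<xi> using tensor_bound[OF \<phi> that] by simp
  qed
  fix X :: "nat \<Rightarrow> 'a list \<Rightarrow> complex"
  assume X: "\<And>k. X k \<in> vecs ?T"
    and Cauchy: "\<And>e. e > 0 \<Longrightarrow> \<exists>N. \<forall>k\<ge>N. \<forall>l\<ge>N. hnorm ?T (X k - X l) < e"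
  have "\<exists>y. (\<lambda>k. X k \<xi>) \<longlonglongrightarrow> y" for \<xi>
  proof (cases "\<xi> \<in> tuples Hs")
    case True
    \<comment> \<open>The summand 1 makes \<open>C\<close> positive also for tuples that contain the
      zero vector, so that e may be divided by it.\<close>
    define C where "C = (\<Prod>i<length Hs. hnorm (Hs ! i) (\<xi> ! i)) + 1"
    have "0 \<le> hnorm ?T (pure_tensor Hs \<xi>)" using pure_tensor_mem[OF hs True] by simp
    then have C: "0 < C" using hnorm_pure_tensor[OF True] by (simp add: C_def)
    have "Cauchy (\<lambda>k. X k \<xi>)"
    proof (rule metric_CauchyI)
      fix e :: real assume "0 < e"
      then obtain N where N: "\<forall>k\<ge>N. \<forall>l\<ge>N. hnorm ?T (X k - X l) < e / C"
        using Cauchy[of "e / C"] C by auto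
      have "dist (X k \<xi>) (X l \<xi>) < e" if "k \<ge> N" "l \<ge> N" for k l
      proof -
        have d: "X k - X l \<in> vecs ?T" using X by simp
        have "cmod ((X k - X l) \<xi>) \<le> hnorm ?T (X k - X l) * (C - 1)"
          using tensor_bound[OF d True] by (simp add: C_def)
        also have "\<dots> \<le> hnorm ?T (X k - X l) * C" using d by (intro mult_left_mono) auto
        also have "\<dots> < e" using N that C by (simp add: pos_less_divide_eq)
        finally show ?thesis by (simp add: dist_norm)
      qed
      then show "\<exists>N. \<forall>k\<ge>N. \<forall>l\<ge>N. dist (X k \<xi>) (X l \<xi>) < e" by blast
    qed
    then show ?thesis by (simp add: Cauchy_convergent_iff convergent_def)
  next
    case False
    then have "X k \<xi> = 0" for k using X vecs_tensor_space by blast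
    then show ?thesis by auto
  qed
  then obtain \<phi> where lim: "\<And>\<xi>. (\<lambda>k. X k \<xi>) \<longlonglongrightarrow> \<phi> \<xi>" by metis
  have sqX: "sq_summable (X k) (onb_tuples Hs)" for k using X vecs_tensor_space by blast
  have norm: "hnorm ?T (X k - X l) = sqrt (sq_sum (\<lambda>e. X k e - X l e) (onb_tuples Hs))" for k l
    using hnorm_tensor_space[of "X k - X l" Hs] X by simp
  have C2: "\<exists>N. \<forall>k\<ge>N. \<forall>l\<ge>N. sq_sum (\<lambda>e. X k e - X l e) (onb_tuples Hs) < e" if e: "e > 0" for e
    using Cauchy[of "sqrt e"] e unfolding norm by simp
  note l2 = l2_complete[OF sqX C2 lim]
  \<comment> \<open>Boundedness of the limit functional needs one constant for all late k, which the
    norm of \<open>X N\<close> plus 1 provides.\<close>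
  obtain N where N: "\<And>k. k \<ge> N \<Longrightarrow> hnorm ?T (X k - X N) < 1" using Cauchy[of 1] by auto
  define C where "C = hnorm ?T (X N) + 1"
  have XC: "hnorm ?T (X k) \<le> C" if "k \<ge> N" for k
    using triangle[of "X k - X N" "X N"] X N[OF that] by (simp add: C_def)
  have Xb: "bounded_multi_antilinear Hs (X k)" for k using X vecs_tensor_space by blast
  have "bounded_multi_antilinear Hs \<phi>"
  proof (rule bounded_multi_antilinearI)
    show "\<phi> (\<eta>[i := a + b]) = \<phi> (\<eta>[i := a]) + \<phi> (\<eta>[i := b])"
      if "\<eta> \<in> tuples Hs" "i < length Hs" "a \<in> vecs (Hs ! i)" "b \<in> vecs (Hs ! i)" for \<eta> i a b
    proof (rule LIMSEQ_unique)
      show "(\<lambda>k. X k (\<eta>[i := a]) + X k (\<eta>[i := b])) \<longlonglongrightarrow> \<phi> (\<eta>[i := a + b])"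
        using lim[of "\<eta>[i := a + b]"] by (simp add: bounded_multi_antilinearD(1)[OF Xb that])
    qed (intro tendsto_add lim)
    show "\<phi> (\<eta>[i := scaleC c a]) = cnj c * \<phi> (\<eta>[i := a])"
      if "\<eta> \<in> tuples Hs" "i < length Hs" "a \<in> vecs (Hs ! i)" for \<eta> i a c
    proof (rule LIMSEQ_unique)
      show "(\<lambda>k. cnj c * X k (\<eta>[i := a])) \<longlonglongrightarrow> \<phi> (\<eta>[i := scaleC c a])"
        using lim[of "\<eta>[i := scaleC c a]"] by (simp add: bounded_multi_antilinearD(2)[OF Xb that])
    qed (intro tendsto_mult_left lim)
    show "cmod (\<phi> \<eta>) \<le> C * (\<Prod>i<length Hs. hnorm (Hs ! i) (\<eta> ! i))" if \<eta>: "\<eta> \<in> tuples Hs" for \<eta>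
    proof (rule tendsto_upperbound[OF tendsto_norm[OF lim]])
      have "0 \<le> (\<Prod>i<length Hs. hnorm (Hs ! i) (\<eta> ! i))"
        using hnorm_nonneg[OF pure_tensor_mem[OF hs \<eta>]] hnorm_pure_tensor[OF \<eta>] by simp
      then have "cmod (X k \<eta>) \<le> C * (\<Prod>i<length Hs. hnorm (Hs ! i) (\<eta> ! i))" if "k \<ge> N" for k
        using order_trans[OF tensor_bound[OF X \<eta>] mult_right_mono[OF XC[OF that]]] by blast
      then show "\<forall>\<^sub>F k in sequentially. cmod (X k \<eta>) \<le> C * (\<Prod>i<length Hs. hnorm (Hs ! i) (\<eta> ! i))"
        by (auto simp: eventually_sequentially)
    qed simp
  qed
  moreover have "\<phi> \<eta> = 0" if "\<eta> \<notin> tuples Hs" for \<eta>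
  proof -
    have "X k \<eta> = 0" for k using X that vecs_tensor_space by blast
    then have "(\<lambda>k. 0) \<longlonglongrightarrow> \<phi> \<eta>" using lim[of \<eta>] by simp
    then show ?thesis by (simp add: LIMSEQ_const_iff)
  qed
  ultimately have \<phi>: "\<phi> \<in> vecs ?T" using l2(1) by (simp add: vecs_tensor_space)
  have "(\<lambda>k. hnorm ?T (X k - \<phi>)) \<longlonglongrightarrow> 0"
    using tendsto_real_sqrt[OF l2(2)] hnorm_tensor_space[of "X _ - \<phi>" Hs] X \<phi> by simp
  then show "\<exists>\<phi>\<in>vecs ?T. (\<lambda>k. hnorm ?T (X k - \<phi>)) \<longlonglongrightarrow> 0" using \<phi> by blast
qed (fact subspace add_left scaleC_left commute nonneg)+

text \<open>The inner product of two pure tensors is a product of Kronecker symbols, which is 1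
  exactly if the tuples agree in every place. The family is indexed by the original tuples and not
  by their images, so that the sums it enters remain sums over the chosen bases.\<close>

lemma orthonormal_pure_tensor:
  assumes J: "J \<subseteq> tuples Hs"
    and o: "\<And>\<xi> \<zeta> i. \<xi> \<in> J \<Longrightarrow> \<zeta> \<in> J \<Longrightarrow> i < length Hs \<Longrightarrow>
      cinner (Hs ! i) (V i (\<xi> ! i)) (V i (\<zeta> ! i)) = (if \<xi> ! i = \<zeta> ! i then 1 else 0)"
    and V: "\<And>i x. i < length Hs \<Longrightarrow> x \<in> vecs (Hs ! i) \<Longrightarrow> V i x \<in> vecs (Hs ! i)"
    and VV: "\<And>\<xi>. \<xi> \<in> J \<Longrightarrow> length (VV \<xi>) = length Hs \<and> (\<forall>i<length Hs. VV \<xi> ! i = V i (\<xi> ! i))"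
  shows "orthonormal_on (tensor_space Hs) J (\<lambda>\<xi>. pure_tensor Hs (VV \<xi>))"
proof -
  have t: "VV \<xi> \<in> tuples Hs" if "\<xi> \<in> J" for \<xi>
    using VV[OF that] V J that by (auto simp: mem_tuples_iff)
  have "cinner (tensor_space Hs) (pure_tensor Hs (VV \<xi>)) (pure_tensor Hs (VV \<zeta>)) =
      (if \<xi> = \<zeta> then 1 else 0)" if "\<xi> \<in> J" "\<zeta> \<in> J" for \<xi> \<zeta>
  proof -
    have l: "length \<xi> = length Hs" "length \<zeta> = length Hs" using J that by (auto simp: mem_tuples_iff)
    have "cinner (tensor_space Hs) (pure_tensor Hs (VV \<xi>)) (pure_tensor Hs (VV \<zeta>)) =
        (\<Prod>i<length Hs. if \<xi> ! i = \<zeta> ! i then 1 else 0)"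
      unfolding cinner_pure_tensor[OF t[OF that(1)] t[OF that(2)]]
      by (intro prod.cong refl) (simp add: VV that o)
    also have "\<dots> = (if \<xi> = \<zeta> then 1 else 0)"
      using l by (auto simp: list_eq_iff_nth_eq)
    finally show ?thesis .
  qed
  then show ?thesis using pure_tensor_mem[OF hs t] by (auto simp: orthonormal_on_def)
qed

section \<open>Tensor products of isometries\<close>

context
  fixes Vs :: "('a \<Rightarrow> 'a) list"
  assumes len: "length Vs = length Hs"
    and Vs: "\<And>i. i < length Hs \<Longrightarrow> isometric_between (Hs ! i) (Hs ! i) (Vs ! i)"
begin

lemma map2_apply_mem: "\<eta> \<in> tuples Hs \<Longrightarrow> map2 (\<lambda>V x. V x) Vs \<eta> \<in> tuples Hs"
  using len Vs by (auto simp: mem_tuples_iff isometric_between_def linear_between_def)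

text \<open>At a basis tuple the new functional is the inner product of \<open>\<phi>\<close> with
  the pure tensor of the transformed tuple. These tensors are orthonormal, so Bessel's inequality
  gives square summability and the norm bound together. The maps need not be onto, whence a
  contraction; group actions upgrade it to an isometry later.\<close>

lemma tensor_unitary_mem_le:
  assumes \<phi>: "\<phi> \<in> vecs (tensor_space Hs)"
  shows "tensor_unitary Hs Vs \<phi> \<in> vecs (tensor_space Hs)"
    and "hnorm (tensor_space Hs) (tensor_unitary Hs Vs \<phi>) \<le> hnorm (tensor_space Hs) \<phi>"
proof -
  let ?V = "map2 (\<lambda>V x. V x) Vs"
  let ?U = "tensor_unitary Hs Vs \<phi>"
  have U: "?U \<eta> = \<phi> (?V \<eta>)" if "\<eta> \<in> tuples Hs" for \<eta> using that by (simp add: tensor_unitary_def)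
  have Vi: "(Vs ! i) a \<in> vecs (Hs ! i)" "(Vs ! i) (a + b) = (Vs ! i) a + (Vs ! i) b"
    "(Vs ! i) (scaleC c a) = scaleC c ((Vs ! i) a)"
    "cinner (Hs ! i) ((Vs ! i) a) ((Vs ! i) b) = cinner (Hs ! i) a b"
    if "i < length Hs" "a \<in> vecs (Hs ! i)" "b \<in> vecs (Hs ! i)" for i a b c
    using Vs[OF that(1)] that by (auto simp: isometric_between_def linear_between_def)
  have upd: "?V (\<eta>[i := a]) = (?V \<eta>)[i := (Vs ! i) a]" if "\<eta> \<in> tuples Hs" "i < length Hs" for \<eta> i a
    using that len by (intro nth_equalityI) (auto simp: nth_list_update mem_tuples_iff)
  have b\<phi>: "bounded_multi_antilinear Hs \<phi>" using \<phi> by (simp add: vecs_tensor_space)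
  obtain C where C: "\<And>\<eta>. \<eta> \<in> tuples Hs \<Longrightarrow> cmod (\<phi> \<eta>) \<le> C * (\<Prod>i<length Hs. hnorm (Hs ! i) (\<eta> ! i))"
    using bounded_multi_antilinearD(3)[OF b\<phi>] by blast
  have "bounded_multi_antilinear Hs ?U"
  proof (rule bounded_multi_antilinearI)
    fix \<eta> i a b c assume \<eta>: "\<eta> \<in> tuples Hs" and i: "i < length Hs" and a: "a \<in> vecs (Hs ! i)"
    interpret h: hilbert_space "Hs ! i" using hs i by simp
    show "?U (\<eta>[i := a + b]) = ?U (\<eta>[i := a]) + ?U (\<eta>[i := b])" if "b \<in> vecs (Hs ! i)"
      using bounded_multi_antilinearD(1)[OF b\<phi> map2_apply_mem[OF \<eta>] i Vi(1)[OF i a a] Vi(1)[OF i that that]]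
      by (simp add: U tuples_update \<eta> a that upd i Vi)
    show "?U (\<eta>[i := scaleC c a]) = cnj c * ?U (\<eta>[i := a])"
      using bounded_multi_antilinearD(2)[OF b\<phi> map2_apply_mem[OF \<eta>] i Vi(1)[OF i a a]]
      by (simp add: U tuples_update \<eta> a upd i Vi(3)[OF i a a])
  next
    fix \<eta> assume \<eta>: "\<eta> \<in> tuples Hs"
    have "(\<Prod>i<length Hs. hnorm (Hs ! i) (?V \<eta> ! i)) = (\<Prod>i<length Hs. hnorm (Hs ! i) (\<eta> ! i))"
      using \<eta> len Vi(4) by (intro prod.cong refl) (auto simp: hnorm_def mem_tuples_iff)
    then show "cmod (?U \<eta>) \<le> C * (\<Prod>i<length Hs. hnorm (Hs ! i) (\<eta> ! i))"
      using C[OF map2_apply_mem[OF \<eta>]] U[OF \<eta>] by simp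
  qed
  moreover
  have sub: "onb_tuples Hs \<subseteq> tuples Hs" using onb_tuples_subset hs by blast
  have nth_onb: "e ! i \<in> onb (Hs ! i)" if "e \<in> onb_tuples Hs" "i < length Hs" for e i
    using that unfolding onb_tuples_def
    by (induction Hs arbitrary: e i) (auto simp: set_Cons_def nth_Cons split: nat.splits)
  have "orthonormal_on (tensor_space Hs) (onb_tuples Hs) (\<lambda>e. pure_tensor Hs (?V e))"
  proof (rule orthonormal_pure_tensor[OF sub])
    show "cinner (Hs ! i) ((Vs ! i) (e ! i)) ((Vs ! i) (f ! i)) = (if e ! i = f ! i then 1 else 0)"
      if e: "e \<in> onb_tuples Hs" and f: "f \<in> onb_tuples Hs" and i: "i < length Hs" for e f i
    proof -
      have "orthonormal_on (Hs ! i) (onb (Hs ! i)) (\<lambda>b. b)" using orthonormal_onb[OF hs[OF nth_mem[OF i]]] .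
      then show ?thesis
        using nth_onb[OF e i] nth_onb[OF f i] Vi(4)[OF i] unfolding orthonormal_on_def by simp
    qed
    show "(Vs ! i) x \<in> vecs (Hs ! i)" if "i < length Hs" "x \<in> vecs (Hs ! i)" for i x
      using Vi(1)[OF that that(2)] .
    show "length (?V e) = length Hs \<and> (\<forall>i<length Hs. ?V e ! i = (Vs ! i) (e ! i))"
      if "e \<in> onb_tuples Hs" for e
      using that sub len by (auto simp: mem_tuples_iff subset_iff)
  qed
  note bessel = bessel_family_summable[OF orthonormal_bessel_family[OF this] \<phi>]
  have eq: "cinner (tensor_space Hs) \<phi> (pure_tensor Hs (?V e)) = ?U e" if "e \<in> onb_tuples Hs" for e
    using that sub by (simp add: U cinner_pure_tensor_right[OF \<phi> map2_apply_mem] subset_iff)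
  have "sq_summable ?U (onb_tuples Hs) \<longleftrightarrow>
      sq_summable (\<lambda>e. cinner (tensor_space Hs) \<phi> (pure_tensor Hs (?V e))) (onb_tuples Hs)"
    by (intro summable_on_cong) (simp add: eq)
  then have sq: "sq_summable ?U (onb_tuples Hs)" using bessel(1) by blast
  ultimately show mem: "?U \<in> vecs (tensor_space Hs)"
    by (simp add: vecs_tensor_space) (simp add: tensor_unitary_def)
  have "sq_sum ?U (onb_tuples Hs) =
      sq_sum (\<lambda>e. cinner (tensor_space Hs) \<phi> (pure_tensor Hs (?V e))) (onb_tuples Hs)"
    by (intro infsum_cong) (simp add: eq)
  then have "(hnorm (tensor_space Hs) ?U)\<^sup>2 \<le> (hnorm (tensor_space Hs) \<phi>)\<^sup>2"
    using bessel(2) by (simp add: hnorm_tensor_space[OF mem] infsum_nonneg)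
  then show "hnorm (tensor_space Hs) ?U \<le> hnorm (tensor_space Hs) \<phi>"
    by (rule power2_le_imp_le) (use \<phi> in simp)
qed

lemma linear_tensor_unitary:
  "linear_between (tensor_space Hs) (tensor_space Hs) (tensor_unitary Hs Vs)"
  by (auto simp: linear_between_def tensor_unitary_mem_le(1))
    (auto simp: tensor_unitary_def fun_eq_iff scaleC_apply)

end

end

section \<open>Direct sums and quasi-containment\<close>

lemma l2_inner_add_right:
  assumes "sq_summable f I" "sq_summable g I" "sq_summable h I"
  shows "l2_inner I h (\<lambda>i. f i + g i) = l2_inner I h f + l2_inner I h g"
  using l2_inner_add_left[OF assms] l2_inner_commute[of I h "\<lambda>i. f i + g i"]
    l2_inner_commute[of I h f] l2_inner_commute[of I h g] by simp

lemma l2_inner_scale_right: "l2_inner I h (\<lambda>i. c * f i) = cnj c * l2_inner I h f"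
  using l2_inner_scale_left[of I c f h] l2_inner_commute[of I h "\<lambda>i. c * f i"]
    l2_inner_commute[of I h f] by simp

lemma direct_sum_cinner_summable:
  fixes C :: "('a::complex_vector, 'g, 'n) bimod_scheme"
  assumes "semi_inner_space C" "f \<in> vecs (direct_sum I C)" "g \<in> vecs (direct_sum I C)"
  shows "(\<lambda>i. cinner C (f i) (g i)) summable_on I"
proof -
  interpret C: semi_inner_space C by (rule assms(1))
  have fg: "f i \<in> vecs C" "g i \<in> vecs C" if "i \<in> I" for i
    using that assms by (auto simp: direct_sum_def)
  have "(\<lambda>i. (hnorm C (f i))\<^sup>2) summable_on I" "(\<lambda>i. (hnorm C (g i))\<^sup>2) summable_on I"
    using assms by (auto simp: direct_sum_def)
  then have "(\<lambda>i. (hnorm C (f i))\<^sup>2 + (hnorm C (g i))\<^sup>2) summable_on I" by (rule summable_on_add)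
  then have "(\<lambda>i. norm (cinner C (f i) (g i))) summable_on I"
  proof (rule summable_on_comparison_test)
    fix i assume i: "i \<in> I"
    have "a * b \<le> a\<^sup>2 + b\<^sup>2" if "0 \<le> a" "0 \<le> b" for a b :: real
      using sum_squares_bound[of a b] mult_nonneg_nonneg[OF that] by linarith
    then show "norm (cinner C (f i) (g i)) \<le> (hnorm C (f i))\<^sup>2 + (hnorm C (g i))\<^sup>2"
      using order_trans[OF C.cauchy_schwarz[OF fg[OF i]]] fg[OF i] by simp
  qed simp
  then show ?thesis by (rule abs_summable_summable)
qed

lemma semi_inner_space_direct_sum:
  fixes C :: "('a::complex_vector, 'g, 'n) bimod_scheme"
  assumes "semi_inner_space C"
  shows "semi_inner_space (direct_sum I C)"
proof -
  interpret C: semi_inner_space C by (rule assms)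
  let ?D = "direct_sum I C"
  note sm = direct_sum_cinner_summable[OF assms]
  have mem: "f i \<in> vecs C" if "f \<in> vecs ?D" "i \<in> I" for f i
    using that by (simp add: direct_sum_def)
  have norm_add: "(\<lambda>i. (hnorm C (f i + g i))\<^sup>2) summable_on I" if f: "f \<in> vecs ?D" and g: "g \<in> vecs ?D" for f g
  proof (rule summable_on_comparison_test)
    show "(\<lambda>i. 2 * ((hnorm C (f i))\<^sup>2 + (hnorm C (g i))\<^sup>2)) summable_on I"
      using f g by (intro summable_on_cmult_right summable_on_add) (auto simp: direct_sum_def)
    fix i assume i: "i \<in> I"
    have "(hnorm C (f i + g i))\<^sup>2 \<le> (hnorm C (f i) + hnorm C (g i))\<^sup>2"
      using mem[OF f i] mem[OF g i] by (intro power_mono C.triangle) auto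
    also have "\<dots> \<le> 2 * ((hnorm C (f i))\<^sup>2 + (hnorm C (g i))\<^sup>2)"
      using sum_squares_bound[of "hnorm C (f i)" "hnorm C (g i)"] by (simp add: power2_sum)
    finally show "(hnorm C (f i + g i))\<^sup>2 \<le> 2 * ((hnorm C (f i))\<^sup>2 + (hnorm C (g i))\<^sup>2)" .
  qed simp
  have norm_scale: "(\<lambda>i. (hnorm C (scaleC c (f i)))\<^sup>2) summable_on I" if f: "f \<in> vecs ?D" for f c
  proof -
    have "(\<lambda>i. (cmod c)\<^sup>2 * (hnorm C (f i))\<^sup>2) summable_on I"
      using f by (intro summable_on_cmult_right) (simp add: direct_sum_def)
    then show ?thesis
      by (rule summable_on_cong[THEN iffD1, rotated])
        (use mem[OF f] in \<open>simp add: C.hnorm_scaleC power_mult_distrib\<close>)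
  qed
  show ?thesis
  proof
    show "complex_vector.subspace (vecs ?D)"
      unfolding complex_vector.subspace_def
    proof (intro conjI ballI allI)
      show "0 \<in> vecs ?D" by (simp add: direct_sum_def)
      show "f + g \<in> vecs ?D" if "f \<in> vecs ?D" "g \<in> vecs ?D" for f g
        using norm_add[OF that] that by (simp add: direct_sum_def)
      show "scaleC c f \<in> vecs ?D" if "f \<in> vecs ?D" for f c
        using norm_scale[OF that] that by (simp add: direct_sum_def scaleC_fun_def)
    qed
    fix f g h c assume f: "f \<in> vecs ?D" and g: "g \<in> vecs ?D"
    show "cinner ?D (f + g) h = cinner ?D f h + cinner ?D g h" if h: "h \<in> vecs ?D"
    proof -
      have "(\<Sum>\<^sub>\<infinity>i\<in>I. cinner C (f i + g i) (h i)) = (\<Sum>\<^sub>\<infinity>i\<in>I. cinner C (f i) (h i) + cinner C (g i) (h i))"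
        using mem f g h by (intro infsum_cong C.add_left) auto
      also have "\<dots> = (\<Sum>\<^sub>\<infinity>i\<in>I. cinner C (f i) (h i)) + (\<Sum>\<^sub>\<infinity>i\<in>I. cinner C (g i) (h i))"
        by (intro infsum_add sm f g h)
      finally show ?thesis by (simp add: direct_sum_def)
    qed
    have "(\<Sum>\<^sub>\<infinity>i\<in>I. cinner C (scaleC c (f i)) (g i)) = (\<Sum>\<^sub>\<infinity>i\<in>I. c * cinner C (f i) (g i))"
      using mem f g by (intro infsum_cong C.scaleC_left) auto
    then show "cinner ?D (scaleC c f) g = c * cinner ?D f g"
      by (simp add: direct_sum_def scaleC_fun_def infsum_cmult_right')
    have "(\<Sum>\<^sub>\<infinity>i\<in>I. cinner C (f i) (g i)) = (\<Sum>\<^sub>\<infinity>i\<in>I. cnj (cinner C (g i) (f i)))"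
      using mem f g by (intro infsum_cong C.commute) auto
    then show "cinner ?D f g = cnj (cinner ?D g f)"
      by (simp add: direct_sum_def)
    have "cinner ?D f f = (\<Sum>\<^sub>\<infinity>i\<in>I. of_real ((hnorm C (f i))\<^sup>2))"
      using mem[OF f] by (simp add: direct_sum_def C.cinner_self cong: infsum_cong)
    also have "\<dots> = of_real (\<Sum>\<^sub>\<infinity>i\<in>I. (hnorm C (f i))\<^sup>2)"
      by (rule infsumI) (use f in \<open>simp add: has_sum_of_real_iff direct_sum_def del: of_real_power\<close>)
    finally show "0 \<le> Re (cinner ?D f f)" by (simp add: infsum_nonneg)
  qed
qed

lemma hnorm_direct_sum:
  assumes "semi_inner_space C" "f \<in> vecs (direct_sum I C)"
  shows "(hnorm (direct_sum I C) f)\<^sup>2 = (\<Sum>\<^sub>\<infinity>i\<in>I. (hnorm C (f i))\<^sup>2)"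
proof -
  interpret C: semi_inner_space C by (rule assms)
  interpret D: semi_inner_space "direct_sum I C" by (rule semi_inner_space_direct_sum[OF assms(1)])
  have mem: "f i \<in> vecs C" if "i \<in> I" for i using that assms(2) by (simp add: direct_sum_def)
  have "cinner (direct_sum I C) f f = (\<Sum>\<^sub>\<infinity>i\<in>I. of_real ((hnorm C (f i))\<^sup>2))"
    using mem by (simp add: direct_sum_def C.cinner_self cong: infsum_cong)
  also have "\<dots> = of_real (\<Sum>\<^sub>\<infinity>i\<in>I. (hnorm C (f i))\<^sup>2)"
    by (rule infsumI) (use assms(2) in \<open>simp add: has_sum_of_real_iff direct_sum_def del: of_real_power\<close>)
  finally show ?thesis using D.hnorm_sq[OF assms(2)] by simp
qed

text \<open>This makes limits in the direct sum unique, as is needed to see that the image of the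
  embedding is closed.\<close>

lemma direct_sum_eq_0:
  assumes C: "hilbert_space C" and f: "f \<in> vecs (direct_sum I C)" and 0: "hnorm (direct_sum I C) f = 0"
  shows "f = 0"
proof
  interpret C: hilbert_space C by (rule C)
  fix i
  show "f i = 0 i"
  proof (cases "i \<in> I")
    case True
    have "(hnorm C (f i))\<^sup>2 = (\<Sum>j\<in>{i}. (hnorm C (f j))\<^sup>2)" by simp
    also have "\<dots> \<le> (\<Sum>\<^sub>\<infinity>i\<in>I. (hnorm C (f i))\<^sup>2)"
      using f True by (intro finite_sum_le_infsum) (auto simp: direct_sum_def)
    also have "\<dots> = 0" using hnorm_direct_sum[OF C.semi_inner_space_axioms f] 0 by simp
    finally show ?thesis using C.hnorm_eq_0[of "f i"] f True by (simp add: direct_sum_def)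
  qed (use f in \<open>simp add: direct_sum_def\<close>)
qed

lemma isometric_between_compose:
  "isometric_between H K U \<Longrightarrow> isometric_between K L V \<Longrightarrow> isometric_between H L (\<lambda>x. V (U x))"
  by (simp add: isometric_between_def linear_between_def)

section \<open>Bimodules as representations of the product group, and the embedding
  criterion\<close>

definition bimod_rep :: "('a::complex_vector, 'g::group_add, 'm) bimod_scheme \<Rightarrow> 'g \<times> 'g \<Rightarrow> 'a \<Rightarrow> 'a" where
  "bimod_rep H = (\<lambda>(s, t) x. lact H s (ract H x (- t)))"

lemma (in bimodule) unitary_rep_bimod_rep: "unitary_rep H (bimod_rep H)"
proof
  show "isometric_between H H (bimod_rep H g)" for g
    using isometric_between_compose[OF ract_isometric lact_isometric]
    by (auto simp: bimod_rep_def split: prod.split)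
  show "bimod_rep H 0 x = x" if "x \<in> vecs H" for x
    using that by (simp add: bimod_rep_def zero_prod_def lact_zero ract_zero)
  show "bimod_rep H (g + h) x = bimod_rep H g (bimod_rep H h x)" if "x \<in> vecs H" for x g h
    using that
    by (cases g; cases h)
      (simp add: bimod_rep_def minus_add lact_add ract_add lact_ract[symmetric] ract_vecs lact_vecs
        del: add_uminus_conv_diff)
qed

text \<open>An orthonormal orbit \<open>q\<close> of the product group spans a copy of its l_2 space
  inside \<open>C\<close>. A vector \<open>x\<close> is sent, in the summand with index
  \<open>w\<close>, to the sum over g of <x, g w> times \<open>q g\<close>; the Parseval identity
  makes this isometric, and translation of the index makes it equivariant.\<close>

lemma quasi_containedI:
  fixes K :: "('a::complex_vector, 'g::group_add, 'm) bimod_scheme"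
    and C :: "('b::complex_vector, 'g, 'n) bimod_scheme"
  assumes K: "bimodule K" and C: "bimodule C"
    and q: "orthonormal_on C UNIV q" and q_rep: "\<And>g h. bimod_rep C g (q h) = q (g + h)"
    and sep: "\<And>\<eta>. \<eta> \<in> vecs K \<Longrightarrow> \<eta> \<noteq> 0 \<Longrightarrow>
      \<exists>\<xi>\<in>vecs K. cinner K \<eta> \<xi> \<noteq> 0 \<and> sq_summable (\<lambda>g. cinner K \<xi> (bimod_rep K g \<xi>)) UNIV"
  shows "quasi_contained K C"
proof -
  interpret K: unitary_rep K "bimod_rep K" by (rule bimodule.unitary_rep_bimod_rep[OF K])
  interpret C: unitary_rep C "bimod_rep C" by (rule bimodule.unitary_rep_bimod_rep[OF C])
  interpret Kb: bimodule K by (rule K)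
  interpret Cb: bimodule C by (rule C)
  have "\<exists>w\<in>vecs K. bessel_family K UNIV (\<lambda>g. bimod_rep K g w) \<and> (\<exists>g. cinner K \<eta> (bimod_rep K g w) \<noteq> 0)"
    if \<eta>: "\<eta> \<in> vecs K" "\<eta> \<noteq> 0" for \<eta>
  proof -
    obtain \<xi> where \<xi>: "\<xi> \<in> vecs K" "cinner K \<eta> \<xi> \<noteq> 0"
      "sq_summable (\<lambda>g. cinner K \<xi> (bimod_rep K g \<xi>)) UNIV" using sep[OF \<eta>] by blast
    show ?thesis using K.sq_summable_imp_bessel_vector[OF \<xi>(1,3)] \<xi>(2) \<eta>(1) by blast
  qed
  from K.parseval_family_exists[OF this] obtain B where B: "B \<subseteq> vecs K"
    and bf: "bessel_family K (B \<times> UNIV) (\<lambda>(w, g). bimod_rep K g w)"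
    and parseval: "\<And>x. x \<in> vecs K \<Longrightarrow>
      sq_sum (\<lambda>(w, g). cinner K x (bimod_rep K g w)) (B \<times> UNIV) = (hnorm K x)\<^sup>2"
    by blast
  define F where "F w x = (\<lambda>g. cinner K x (bimod_rep K g w))" for w x
  have sqB: "(\<lambda>(w, g). (cmod (F w x g))\<^sup>2) summable_on B \<times> UNIV" if "x \<in> vecs K" for x
    using bessel_family_summable(1)[OF bf that] by (simp add: F_def case_prod_unfold)
  have sqF: "sq_summable (F w x) UNIV" if x: "x \<in> vecs K" and w: "w \<in> B" for w x
  proof -
    have "(\<lambda>(w, g). (cmod (F w x g))\<^sup>2) summable_on Pair w ` UNIV"
      by (rule summable_on_subset_banach[OF sqB[OF x]]) (use w in auto)
    then show ?thesis by (subst (asm) summable_on_reindex) (auto simp: inj_on_def o_def)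
  qed
  \<comment> \<open>Fubini splits the Parseval identity into one contribution for each summand of
    the direct sum.\<close>
  have sumB: "(\<lambda>w. sq_sum (F w x) UNIV) summable_on B"
    "(\<Sum>\<^sub>\<infinity>w\<in>B. sq_sum (F w x) UNIV) = (hnorm K x)\<^sup>2" if "x \<in> vecs K" for x
    using summable_on_Sigma_banach[OF sqB[OF that]] infsum_Sigma'_banach[OF sqB[OF that]] parseval[OF that]
    by (simp_all add: F_def case_prod_unfold)
  have F_add: "F w (x + y) = (\<lambda>g. F w x g + F w y g)" and F_scale: "F w (scaleC c x) = (\<lambda>g. c * F w x g)"
    and F_rep: "F w (bimod_rep K k x) = (\<lambda>g. F w x (- k + g))"
    if "w \<in> B" "x \<in> vecs K" "y \<in> vecs K" for w x y c k
    using that B by (auto simp: F_def K.add_left K.scaleC_left K.cinner_rep_rep subset_iff)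
  note bq = C.orthonormal_bessel_family[OF q]
  have qv: "q h \<in> vecs C" for h using bessel_family_vecs[OF bq] by simp
  \<comment> \<open>\<open>\<Phi> w x\<close> is the sum over h of \<open>F w x h\<close> times
    \<open>q h\<close>, given by its inner products; its coefficients against \<open>q\<close> are
    therefore \<open>F w x\<close>.\<close>
  define \<Phi> where "\<Phi> w x = (SOME z. z \<in> vecs C \<and>
    (\<forall>y\<in>vecs C. cinner C y z = l2_inner UNIV (\<lambda>h. cinner C y (q h)) (F w x)))" for w x
  have \<Phi>_some: "\<Phi> w x \<in> vecs C \<and>
      (\<forall>y\<in>vecs C. cinner C y (\<Phi> w x) = l2_inner UNIV (\<lambda>h. cinner C y (q h)) (F w x))"
    if "x \<in> vecs K" "w \<in> B" for w x
    unfolding \<Phi>_def by (rule someI_ex) (use C.bessel_synthesis[OF bq sqF[OF that]] in blast)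
  have \<Phi>: "\<Phi> w x \<in> vecs C" if "x \<in> vecs K" "w \<in> B" for w x
    using \<Phi>_some[OF that] by (rule conjunct1)
  have \<Phi>_eq: "cinner C y (\<Phi> w x) = l2_inner UNIV (\<lambda>h. cinner C y (q h)) (F w x)"
    if "x \<in> vecs K" "w \<in> B" "y \<in> vecs C" for w x y
    using \<Phi>_some[OF that(1,2)] that(3) by blast
  have qq: "cinner C (q g) (q h) = (if g = h then 1 else 0)" for g h
    using q unfolding orthonormal_on_def by blast
  have sq_q: "sq_summable (\<lambda>h. cinner C y (q h)) UNIV" if "y \<in> vecs C" for y
    using bessel_family_summable(1)[OF bq that] .
  have \<Phi>q: "cinner C (\<Phi> w x) (q h) = F w x h" if x: "x \<in> vecs K" and w: "w \<in> B" for w x h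
  proof -
    have "cinner C (q h) (\<Phi> w x) = (\<Sum>\<^sub>\<infinity>g. if g = h then cnj (F w x h) else 0)"
      unfolding \<Phi>_eq[OF x w qv] l2_inner_def
      by (intro infsum_cong) (auto simp: qq)
    also have "\<dots> = (\<Sum>\<^sub>\<infinity>g\<in>{h}. cnj (F w x h))" by (rule infsum_cong_neutral) auto
    finally show ?thesis using C.commute[OF \<Phi>[OF x w] qv] by simp
  qed
  have \<Phi>_norm: "(hnorm C (\<Phi> w x))\<^sup>2 = sq_sum (F w x) UNIV" if x: "x \<in> vecs K" and w: "w \<in> B" for w x
    using \<Phi>_eq[OF x w \<Phi>[OF x w]] C.hnorm_sq[OF \<Phi>[OF x w]]
    by (simp add: \<Phi>q[OF x w] l2_inner_self[OF sqF[OF x w]])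
  have \<Phi>_add: "\<Phi> w (x + y) = \<Phi> w x + \<Phi> w y" if x: "x \<in> vecs K" and y: "y \<in> vecs K" and w: "w \<in> B" for w x y
    by (rule C.cinner_ext)
      (use x y w in \<open>simp_all add: \<Phi> C.add_right \<Phi>_eq F_add sqF sq_q l2_inner_add_right\<close>)
  have \<Phi>_scale: "\<Phi> w (scaleC c x) = scaleC c (\<Phi> w x)" if x: "x \<in> vecs K" and w: "w \<in> B" for w x c
    by (rule C.cinner_ext)
      (use x w in \<open>simp_all add: \<Phi> C.scaleC_right \<Phi>_eq F_scale[OF w x x] l2_inner_scale_right\<close>)
  \<comment> \<open>Acting by \<open>k\<close> shifts the coefficient function on one side and moves
    along the orbit \<open>q\<close> on the other; reindexing the sum identifies the two.\<close>
  have \<Phi>_rep: "\<Phi> w (bimod_rep K k x) = bimod_rep C k (\<Phi> w x)" if x: "x \<in> vecs K" and w: "w \<in> B" for w x k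
  proof (rule C.cinner_ext)
    fix y assume y: "y \<in> vecs C"
    have "cinner C y (bimod_rep C k (\<Phi> w x)) = cinner C (bimod_rep C (- k) y) (\<Phi> w x)"
      using C.rep_adjoint[OF y \<Phi>[OF x w], of "- k"] by simp
    also have "\<dots> = l2_inner UNIV (\<lambda>h. cinner C (bimod_rep C (- k) y) (q h)) (F w x)"
      using \<Phi>_eq[OF x w] y by simp
    also have "(\<lambda>h. cinner C (bimod_rep C (- k) y) (q h)) = (\<lambda>h. cinner C y (q (k + h)))"
      using C.rep_adjoint[OF y qv, of "- k"] q_rep[of k] by simp
    also have "l2_inner UNIV (\<lambda>h. cinner C y (q (k + h))) (F w x) =
        l2_inner UNIV (\<lambda>h. cinner C y (q h)) (F w (bimod_rep K k x))"
      using l2_inner_reindex[OF K.bij_shift[of k], of "\<lambda>h. cinner C y (q (k + h))" "F w x"]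
      by (simp add: F_rep[OF w x x] add.assoc[symmetric])
    finally show "cinner C y (\<Phi> w (bimod_rep K k x)) = cinner C y (bimod_rep C k (\<Phi> w x))"
      using \<Phi>_eq[OF K.rep_mem[OF x] w y] by simp
  qed (use x w \<Phi> in auto)
  \<comment> \<open>Being a set of vectors of \<open>K\<close>, \<open>B\<close> has the type of
    index set that \<open>quasi_contained\<close> asks for.\<close>
  define D where "D = direct_sum B C"
  define U where "U x = (\<lambda>w. if w \<in> B then \<Phi> w x else 0)" for x
  define S where "S = U ` vecs K"
  interpret D: semi_inner_space D
    unfolding D_def by (rule semi_inner_space_direct_sum[OF C.semi_inner_space_axioms])
  have U_mem: "U x \<in> vecs D" if x: "x \<in> vecs K" for x
  proof -
    have "(\<lambda>w. (hnorm C (U x w))\<^sup>2) summable_on B \<longleftrightarrow> (\<lambda>w. sq_sum (F w x) UNIV) summable_on B"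
      by (intro summable_on_cong) (simp add: U_def \<Phi>_norm x)
    then show ?thesis using sumB(1)[OF x] \<Phi>[OF x] by (simp add: D_def direct_sum_def) (simp add: U_def)
  qed
  have U_norm: "hnorm D (U x) = hnorm K x" if x: "x \<in> vecs K" for x
  proof -
    have "(hnorm D (U x))\<^sup>2 = (\<Sum>\<^sub>\<infinity>w\<in>B. (hnorm C (U x w))\<^sup>2)"
      unfolding D_def
      by (rule hnorm_direct_sum[OF C.semi_inner_space_axioms]) (use U_mem[OF x] D_def in simp)
    also have "\<dots> = (\<Sum>\<^sub>\<infinity>w\<in>B. sq_sum (F w x) UNIV)"
      by (intro infsum_cong) (simp add: U_def \<Phi>_norm x)
    finally have "(hnorm D (U x))\<^sup>2 = (hnorm K x)\<^sup>2" using sumB(2)[OF x] by simp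
    then show ?thesis using U_mem[OF x] x by simp
  qed
  have U_add: "U (x + y) = U x + U y" if "x \<in> vecs K" "y \<in> vecs K" for x y
    using that by (auto simp: U_def \<Phi>_add fun_eq_iff)
  have U_scale: "U (scaleC c x) = scaleC c (U x)" if "x \<in> vecs K" for x c
    using that by (auto simp: U_def \<Phi>_scale fun_eq_iff scaleC_fun_def)
  have U_diff: "U (x - y) = U x - U y" if "x \<in> vecs K" "y \<in> vecs K" for x y
    using U_add[of "x - y" y] that by simp
  have lin: "linear_between K D U"
    by (simp add: linear_between_def U_mem U_add U_scale)
  have iso: "isometric_between K D U"
    by (rule K.isometric_betweenI[OF D.semi_inner_space_axioms lin U_norm])
  have U_lact: "U (lact K s x) = lact D s (U x)" if x: "x \<in> vecs K" for s x
    using \<Phi>_rep[OF x, of _ "(s, 0)"] Kb.ract_zero[OF x] Cb.ract_zero[OF \<Phi>[OF x]]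
    by (auto simp: U_def D_def direct_sum_def bimod_rep_def fun_eq_iff)
  \<comment> \<open>The right action of \<open>t\<close> is the pair \<open>(0, - t)\<close>, whose
    sign cancels the inverse in \<open>bimod_rep\<close>.\<close>
  have U_ract: "U (ract K x t) = ract D (U x) t" if x: "x \<in> vecs K" for t x
    using \<Phi>_rep[OF x, of _ "(0, - t)"] Kb.lact_zero[OF Kb.ract_vecs[OF x]]
      Cb.lact_zero[OF Cb.ract_vecs[OF \<Phi>[OF x]]]
    by (auto simp: U_def D_def direct_sum_def bimod_rep_def fun_eq_iff)
  have "closed_subspace D S"
    unfolding closed_subspace_def
  proof (intro conjI allI impI)
    show "S \<subseteq> vecs D" using U_mem by (auto simp: S_def)
    show "complex_vector.subspace S"
      unfolding complex_vector.subspace_def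
    proof (intro conjI ballI allI)
      have "U 0 = 0" using U_diff[of 0 0] by simp
      then show "0 \<in> S" unfolding S_def by (metis K.zero_mem image_eqI)
      show "a + b \<in> S" if "a \<in> S" "b \<in> S" for a b
        using that U_add K.add_mem unfolding S_def by (metis (no_types, lifting) image_iff)
      show "scaleC c a \<in> S" if "a \<in> S" for a c
        using that U_scale K.scaleC_mem unfolding S_def by (metis (no_types, lifting) image_iff)
    qed
    \<comment> \<open>The isometry pulls a convergent sequence of images back to a Cauchy sequence
      in \<open>K\<close>; the image of its limit has to be \<open>y\<close>.\<close>
    fix X y assume A: "(\<forall>k. X k \<in> S) \<and> y \<in> vecs D \<and> (\<lambda>k. hnorm D (X k - y)) \<longlonglongrightarrow> 0"
    then have "\<forall>k. \<exists>x. x \<in> vecs K \<and> X k = U x" by (auto simp: S_def)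
    then obtain Y where Y: "\<And>k. Y k \<in> vecs K" and XY: "\<And>k. X k = U (Y k)" by metis
    have XD: "X k \<in> vecs D" for k using XY Y U_mem by simp
    have y: "y \<in> vecs D" and lim: "(\<lambda>k. hnorm D (X k - y)) \<longlonglongrightarrow> 0" using A by auto
    have "\<exists>N. \<forall>k\<ge>N. \<forall>l\<ge>N. hnorm K (Y k - Y l) < e" if "e > 0" for e
      using D.convergent_Cauchy[OF XD y lim that] U_norm[OF K.diff_mem[OF Y Y]] U_diff[OF Y Y] XY by simp
    then obtain x where x: "x \<in> vecs K" and limx: "(\<lambda>k. hnorm K (Y k - x)) \<longlonglongrightarrow> 0"
      using K.complete[of Y] Y by blast
    have "(\<lambda>k. hnorm D (X k - U x)) \<longlonglongrightarrow> 0"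
      using limx U_norm[OF K.diff_mem[OF Y x]] U_diff[OF Y x] XY by simp
    then have "(\<lambda>k. hnorm D (X k - y) + hnorm D (X k - U x)) \<longlonglongrightarrow> 0 + 0" by (intro tendsto_add lim)
    moreover have "hnorm D (y - U x) \<le> hnorm D (X k - y) + hnorm D (X k - U x)" for k
      using D.triangle_diff[OF y XD U_mem[OF x], of k] D.hnorm_minus_commute[OF y XD, of k] by simp
    ultimately have "hnorm D (y - U x) \<le> 0 + 0" by (intro LIMSEQ_le_const) auto
    then have "hnorm D (y - U x) = 0" using D.hnorm_nonneg[OF D.diff_mem[OF y U_mem[OF x]]] by simp
    then have "y - U x = 0"
      using direct_sum_eq_0[OF C.hilbert_space_axioms] D.diff_mem[OF y U_mem[OF x]] unfolding D_def by blast
    then show "y \<in> S" using x by (simp add: S_def)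
  qed
  moreover have "lact D s z \<in> S" "ract D z t \<in> S" if "z \<in> S" for s t z
    using that Kb.lact_vecs Kb.ract_vecs by (auto simp: S_def simp flip: U_lact U_ract)
  ultimately have sub: "subbimodule S D" by (simp add: subbimodule_def)
  have inj: "inj_on U (vecs K)"
  proof (rule inj_onI)
    fix x y assume xy: "x \<in> vecs K" "y \<in> vecs K" "U x = U y"
    then have "hnorm K (x - y) = 0" using U_norm[OF K.diff_mem[OF xy(1,2)]] U_diff[OF xy(1,2)] by simp
    then show "x = y" using K.hnorm_eq_0[OF K.diff_mem[OF xy(1,2)]] by simp
  qed
  have "bimod_iso K (D\<lparr>vecs := S\<rparr>)"
    unfolding bimod_iso_def
  proof (intro exI[of _ U] conjI allI ballI)
    show "isometric_between K (D\<lparr>vecs := S\<rparr>) U"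
      using iso by (auto simp: isometric_between_def linear_between_def S_def)
    show "bij_betw U (vecs K) (vecs (D\<lparr>vecs := S\<rparr>))" using inj by (simp add: bij_betw_def S_def)
  qed (simp_all add: U_lact U_ract)
  then show ?thesis using sub unfolding quasi_contained_def D_def by blast
qed

section \<open>Tensor powers and the coarse bimodule\<close>

lemma hilbert_space_ell2: "hilbert_space (ell2 :: ('g::group_add \<Rightarrow> complex, 'g) bimod)"
proof -
  let ?L = "l2_space (UNIV :: 'g set)"
  interpret semi_inner_space ?L by (rule l2_semi_inner_space)
  have vL: "f \<in> vecs ?L \<longleftrightarrow> sq_summable f UNIV" for f by (simp add: l2_space_def)
  have "hilbert_space ?L"
  proof
    show "f = 0" if f: "f \<in> vecs ?L" and 0: "cinner ?L f f = 0" for f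
    proof
      fix g
      have "sq_sum f UNIV = 0" using 0 f by (simp add: l2_space_def l2_inner_self)
      moreover have "(\<Sum>g\<in>{g}. (cmod (f g))\<^sup>2) \<le> sq_sum f UNIV"
        using f by (intro finite_sum_le_infsum) (auto simp: vL)
      ultimately show "f g = 0 g" by simp
    qed
    fix X :: "nat \<Rightarrow> 'g \<Rightarrow> complex"
    assume X: "\<And>k. X k \<in> vecs ?L"
      and Cauchy: "\<And>e. e > 0 \<Longrightarrow> \<exists>N. \<forall>k\<ge>N. \<forall>l\<ge>N. hnorm ?L (X k - X l) < e"
    have sqX: "sq_summable (X k) UNIV" for k using X by (simp add: vL)
    have norm: "hnorm ?L (X k - X l) = sqrt (sq_sum (\<lambda>e. X k e - X l e) UNIV)" for k l
      using hnorm_l2_space[of "X k - X l" UNIV] sq_summable_diff[OF sqX sqX] by simp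
    have "\<exists>y. (\<lambda>k. X k g) \<longlonglongrightarrow> y" for g
    proof -
      have "cmod (X k g - X l g) \<le> hnorm ?L (X k - X l)" for k l
      proof -
        have "(\<Sum>g\<in>{g}. (cmod (X k g - X l g))\<^sup>2) \<le> sq_sum (\<lambda>e. X k e - X l e) UNIV"
          by (intro finite_sum_le_infsum sq_summable_diff sqX) auto
        then show ?thesis unfolding norm by (intro real_le_rsqrt) simp
      qed
      then have "Cauchy (\<lambda>k. X k g)"
        using Cauchy unfolding Cauchy_def dist_norm by (meson le_less_trans)
      then show ?thesis by (simp add: Cauchy_convergent_iff convergent_def)
    qed
    then obtain f where lim: "\<And>g. (\<lambda>k. X k g) \<longlonglongrightarrow> f g" by metis
    have C2: "\<exists>N. \<forall>k\<ge>N. \<forall>l\<ge>N. sq_sum (\<lambda>e. X k e - X l e) UNIV < e" if e: "e > 0" for e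
      using Cauchy[of "sqrt e"] e unfolding norm by simp
    note l2 = l2_complete[OF sqX C2 lim]
    have "(\<lambda>k. hnorm ?L (X k - f)) \<longlonglongrightarrow> 0"
      using tendsto_real_sqrt[OF l2(2)] hnorm_l2_space[of "X _ - f" UNIV] sq_summable_diff[OF sqX l2(1)]
      by simp
    then show "\<exists>f\<in>vecs ?L. (\<lambda>k. hnorm ?L (X k - f)) \<longlonglongrightarrow> 0" using l2(1) vL by blast
  qed (fact subspace add_left scaleC_left commute nonneg)+
  then show ?thesis
    by (rule hilbert_space_cong) (simp_all add: ell2_def l2_space_def l2_inner_def fun_eq_iff)
qed

lemma delta_ell2: "delta g \<in> vecs ell2"
proof -
  have "(\<lambda>h. (cmod (delta g h))\<^sup>2) summable_on {g}" by simp
  then have "sq_summable (delta g) UNIV"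
    by (rule summable_on_cong_neutral[THEN iffD1, rotated -1]) (auto simp: delta_def)
  then show ?thesis by (simp add: ell2_def)
qed

lemma cinner_ell2_delta: "cinner ell2 f (delta g) = f g"
proof -
  have "(\<Sum>\<^sub>\<infinity>h. f h * cnj (delta g h)) = (\<Sum>\<^sub>\<infinity>h\<in>{g}. f h)"
    by (rule infsum_cong_neutral) (auto simp: delta_def)
  then show ?thesis by (simp add: ell2_def)
qed

lemma ell2_linear:
  shows "lact ell2 s (f + h) = lact ell2 s f + lact ell2 s h"
    and "lact ell2 s (scaleC c f) = scaleC c (lact ell2 s f)"
    and "ract ell2 (f + h) t = ract ell2 f t + ract ell2 h t"
    and "ract ell2 (scaleC c f) t = scaleC c (ract ell2 f t)"
  by (auto simp: ell2_def scaleC_fun_def fun_eq_iff)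

lemma bimodule_ell2: "bimodule (ell2 :: ('g::group_add \<Rightarrow> complex, 'g) bimod)"
proof -
  interpret hilbert_space "ell2 :: ('g \<Rightarrow> complex, 'g) bimod" by (rule hilbert_space_ell2)
  have l: "lact ell2 (- s) (lact ell2 s f) = f" and r: "ract ell2 (ract ell2 f t) (- t) = f"
    for s t :: 'g and f
    by (auto simp: ell2_def fun_eq_iff add.assoc[symmetric])
  show ?thesis
  proof
    show "isometric_between (ell2 :: ('g \<Rightarrow> complex, 'g) bimod) ell2 (lact ell2 s)" for s
      by (simp add: isometric_between_def linear_between_def ell2_lact_vecs ell2_linear
          ell2_lact_adjoint l)
    show "isometric_between (ell2 :: ('g \<Rightarrow> complex, 'g) bimod) ell2 (\<lambda>f. ract ell2 f t)" for t
      by (simp add: isometric_between_def linear_between_def ell2_ract_vecs ell2_linear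
          ell2_ract_adjoint r)
  qed (auto simp: ell2_def fun_eq_iff minus_add diff_add_eq_diff_diff_swap add.assoc[symmetric]
      add_diff_eq simp del: add_uminus_conv_diff)
qed

text \<open>A group acting by contractions acts by isometries, since the inverse is a contraction
  too; polarisation then gives the inner products.\<close>

lemma bimoduleI_contractions:
  fixes K :: "('a::complex_vector, 'g::group_add, 'm) bimod_scheme"
  assumes "hilbert_space K"
    and lin: "\<And>s. linear_between K K (lact K s)" "\<And>t. linear_between K K (\<lambda>\<xi>. ract K \<xi> t)"
    and le: "\<And>s \<xi>. \<xi> \<in> vecs K \<Longrightarrow> hnorm K (lact K s \<xi>) \<le> hnorm K \<xi>"
      "\<And>t \<xi>. \<xi> \<in> vecs K \<Longrightarrow> hnorm K (ract K \<xi> t) \<le> hnorm K \<xi>"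
    and zero: "\<And>\<xi>. \<xi> \<in> vecs K \<Longrightarrow> lact K 0 \<xi> = \<xi>" "\<And>\<xi>. \<xi> \<in> vecs K \<Longrightarrow> ract K \<xi> 0 = \<xi>"
    and add: "\<And>\<xi> s t. \<xi> \<in> vecs K \<Longrightarrow> lact K (s + t) \<xi> = lact K s (lact K t \<xi>)"
      "\<And>\<xi> s t. \<xi> \<in> vecs K \<Longrightarrow> ract K \<xi> (s + t) = ract K (ract K \<xi> s) t"
    and lr: "\<And>\<xi> s t. \<xi> \<in> vecs K \<Longrightarrow> lact K s (ract K \<xi> t) = ract K (lact K s \<xi>) t"
  shows "bimodule K"
proof -
  interpret hilbert_space K by (rule assms(1))
  have mem: "lact K s \<xi> \<in> vecs K" "ract K \<xi> t \<in> vecs K" if "\<xi> \<in> vecs K" for s t \<xi>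
    using lin that by (auto simp: linear_between_def)
  show ?thesis
  proof
    have "hnorm K (lact K s \<xi>) = hnorm K \<xi>" if \<xi>: "\<xi> \<in> vecs K" for s \<xi>
      using le(1)[OF \<xi>, of s] le(1)[OF mem(1)[OF \<xi>, of s], of "- s"] add(1)[OF \<xi>, of "- s" s] zero(1)[OF \<xi>]
      by simp
    then show "isometric_between K K (lact K s)" for s
      by (rule isometric_betweenI[OF semi_inner_space_axioms lin(1)])
    have "hnorm K (ract K \<xi> t) = hnorm K \<xi>" if \<xi>: "\<xi> \<in> vecs K" for t \<xi>
      using le(2)[OF \<xi>, of t] le(2)[OF mem(2)[OF \<xi>, of t], of "- t"] add(2)[OF \<xi>, of t "- t"] zero(2)[OF \<xi>]
      by simp
    then show "isometric_between K K (\<lambda>\<xi>. ract K \<xi> t)" for t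
      by (rule isometric_betweenI[OF semi_inner_space_axioms lin(2)])
  qed (use zero add lr in auto)
qed

section \<open>Tensor powers as bimodules\<close>

lemma map2_apply_replicate:
  "length \<eta> = n \<Longrightarrow> map2 (\<lambda>V x. V x) (map (\<lambda>H. f H) (replicate n H)) \<eta> = map (f H) \<eta>"
  by (intro nth_equalityI) auto

lemma tensor_power_simps:
  "vecs (tensor_power n H) = vecs (tensor_space (replicate n H))"
  "cinner (tensor_power n H) = cinner (tensor_space (replicate n H))"
  "lact (tensor_power n H) s \<phi> = tensor_unitary (replicate n H) (map (\<lambda>H. lact H (- s)) (replicate n H)) \<phi>"
  "ract (tensor_power n H) \<phi> t = tensor_unitary (replicate n H) (map (\<lambda>H \<eta>. ract H \<eta> (- t)) (replicate n H)) \<phi>"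
  by (simp_all add: tensor_power_def diagonal_tensor_def)

lemma tensor_power_act:
  assumes "\<eta> \<in> tuples (replicate n H)"
  shows "lact (tensor_power n H) s \<phi> \<eta> = \<phi> (map (lact H (- s)) \<eta>)"
    and "ract (tensor_power n H) \<phi> t \<eta> = \<phi> (map (\<lambda>x. ract H x (- t)) \<eta>)"
proof -
  have l: "length \<eta> = n" using assms by (simp add: mem_tuples_iff)
  show "lact (tensor_power n H) s \<phi> \<eta> = \<phi> (map (lact H (- s)) \<eta>)"
    using assms map2_apply_replicate[OF l, of "\<lambda>H. lact H (- s)" H]
    by (simp add: tensor_power_simps tensor_unitary_def)
  show "ract (tensor_power n H) \<phi> t \<eta> = \<phi> (map (\<lambda>x. ract H x (- t)) \<eta>)"
    using assms map2_apply_replicate[OF l, of "\<lambda>H x. ract H x (- t)" H]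
    by (simp add: tensor_power_simps tensor_unitary_def)
qed

lemma tensor_power_act_0:
  assumes "\<eta> \<notin> tuples (replicate n H)"
  shows "lact (tensor_power n H) s \<phi> \<eta> = 0" "ract (tensor_power n H) \<phi> t \<eta> = 0"
  using assms by (simp_all add: tensor_power_simps tensor_unitary_def)

lemma (in bimodule) bimodule_tensor_power: "bimodule (tensor_power n H)"
proof (rule bimoduleI_contractions)
  let ?Hs = "replicate n H"
  let ?T = "tensor_power n H"
  have hs: "\<And>H'. H' \<in> set ?Hs \<Longrightarrow> hilbert_space H'" using hilbert_space_axioms by simp
  show "hilbert_space ?T"
    by (rule hilbert_space_cong[OF hilbert_space_tensor_space[OF hs]]) (simp_all add: tensor_power_simps)
  have hn: "hnorm ?T = hnorm (tensor_space ?Hs)" by (simp add: hnorm_def tensor_power_simps fun_eq_iff)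
  have V: "isometric_between (?Hs ! i) (?Hs ! i) (map (\<lambda>H. lact H (- s)) ?Hs ! i)"
    "isometric_between (?Hs ! i) (?Hs ! i) (map (\<lambda>H \<eta>. ract H \<eta> (- t)) ?Hs ! i)"
    if "i < length ?Hs" for i s t
    using that lact_isometric ract_isometric by simp_all
  have len: "length (map (\<lambda>H. lact H (- s)) ?Hs) = length ?Hs"
    "length (map (\<lambda>H \<eta>. ract H \<eta> (- t)) ?Hs) = length ?Hs" for s t by simp_all
  show "linear_between ?T ?T (lact ?T s)" for s
    using linear_tensor_unitary[OF hs len(1) V(1), of s]
    by (simp add: linear_between_def tensor_power_simps)
  show "linear_between ?T ?T (\<lambda>\<xi>. ract ?T \<xi> t)" for t
    using linear_tensor_unitary[OF hs len(2) V(2), of t]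
    by (simp add: linear_between_def tensor_power_simps)
  fix \<phi> assume \<phi>: "\<phi> \<in> vecs ?T"
  then have \<phi>': "\<phi> \<in> vecs (tensor_space ?Hs)" and off: "\<eta> \<notin> tuples ?Hs \<Longrightarrow> \<phi> \<eta> = 0" for \<eta>
    by (auto simp: tensor_power_simps vecs_tensor_space)
  show "hnorm ?T (lact ?T s \<phi>) \<le> hnorm ?T \<phi>" for s
    using tensor_unitary_mem_le(2)[OF hs len(1) V(1) \<phi>', of s] by (simp add: hn tensor_power_simps(3))
  show "hnorm ?T (ract ?T \<phi> t) \<le> hnorm ?T \<phi>" for t
    using tensor_unitary_mem_le(2)[OF hs len(2) V(2) \<phi>', of t] by (simp add: hn tensor_power_simps(4))
  have el: "x \<in> vecs H" if "\<eta> \<in> tuples ?Hs" "x \<in> set \<eta>" for \<eta> x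
    using that by (auto simp: mem_tuples_iff in_set_conv_nth)
  have map_mem: "map (lact H s) \<eta> \<in> tuples ?Hs" "map (\<lambda>x. ract H x t) \<eta> \<in> tuples ?Hs"
    if "\<eta> \<in> tuples ?Hs" for s t \<eta>
    using that lact_vecs ract_vecs by (auto simp: mem_tuples_iff)
  have eq: "\<psi> = \<psi>'" if "\<And>\<eta>. \<eta> \<in> tuples ?Hs \<Longrightarrow> \<psi> \<eta> = \<psi>' \<eta>" "\<And>\<eta>. \<eta> \<notin> tuples ?Hs \<Longrightarrow> \<psi> \<eta> = \<psi>' \<eta>"
    for \<psi> \<psi>' :: "'a list \<Rightarrow> complex"
    using that by blast
  have id: "map (lact H 0) \<eta> = \<eta>" "map (\<lambda>x. ract H x 0) \<eta> = \<eta>" if "\<eta> \<in> tuples ?Hs" for \<eta>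
    using lact_zero ract_zero el[OF that] by (auto intro!: map_idI)
  show "lact ?T 0 \<phi> = \<phi>" by (rule eq) (simp_all add: tensor_power_act tensor_power_act_0 id off)
  show "ract ?T \<phi> 0 = \<phi>" by (rule eq) (simp_all add: tensor_power_act tensor_power_act_0 id off)
  \<comment> \<open>Composition of functionals reverses the order of the maps, and passing to
    inverses reverses it again, so left and right actions remain what they are.\<close>
  have ll: "map (lact H (- (s + t))) \<eta> = map (lact H (- t)) (map (lact H (- s)) \<eta>)"
    and rr: "map (\<lambda>x. ract H x (- (s + t))) \<eta> = map (\<lambda>x. ract H x (- s)) (map (\<lambda>x. ract H x (- t)) \<eta>)"
    and rl: "map (\<lambda>x. ract H x (- t)) (map (lact H (- s)) \<eta>) = map (lact H (- s)) (map (\<lambda>x. ract H x (- t)) \<eta>)"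
    if "\<eta> \<in> tuples ?Hs" for \<eta> s t
    using el[OF that] by (simp_all add: minus_add lact_add ract_add lact_ract del: add_uminus_conv_diff)
  show "lact ?T (s + t) \<phi> = lact ?T s (lact ?T t \<phi>)" for s t
    by (rule eq) (simp_all only: tensor_power_act tensor_power_act_0 map_mem ll
        not_False_eq_True)
  show "ract ?T \<phi> (s + t) = ract ?T (ract ?T \<phi> s) t" for s t
    by (rule eq) (simp_all only: tensor_power_act tensor_power_act_0 map_mem rr
        not_False_eq_True)
  show "lact ?T s (ract ?T \<phi> t) = ract ?T (lact ?T s \<phi>) t" for s t
    by (rule eq) (simp_all only: tensor_power_act tensor_power_act_0 map_mem rl
        not_False_eq_True)
qed

section \<open>The coarse bimodule and its basis\<close>

lemma tuples_ell2_ell2: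
  "\<eta> \<in> tuples [ell2, ell2] \<longleftrightarrow> (\<exists>f h. \<eta> = [f, h] \<and> f \<in> vecs ell2 \<and> h \<in> vecs ell2)"
  by (auto simp: tuples_def set_Cons_def)

lemma coarse_simps:
  "vecs coarse = vecs (tensor_space [ell2, ell2])"
  "cinner coarse = cinner (tensor_space [ell2, ell2])"
  "lact coarse s \<phi> = tensor_unitary [ell2, ell2] [lact ell2 (- s), \<lambda>f. f] \<phi>"
  "ract coarse \<phi> t = tensor_unitary [ell2, ell2] [\<lambda>f. f, \<lambda>f. ract ell2 f (- t)] \<phi>"
  by (simp_all add: coarse_def)

lemma bimodule_coarse: "bimodule (coarse :: (('g::group_add \<Rightarrow> complex) list \<Rightarrow> complex, 'g) bimod)"
proof (rule bimoduleI_contractions)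
  let ?C = "coarse :: (('g \<Rightarrow> complex) list \<Rightarrow> complex, 'g) bimod"
  let ?Hs = "[ell2, ell2] :: ('g \<Rightarrow> complex, 'g) bimod list"
  interpret ell2: bimodule "ell2 :: ('g \<Rightarrow> complex, 'g) bimod" by (rule bimodule_ell2)
  have hs: "\<And>H. H \<in> set ?Hs \<Longrightarrow> hilbert_space H" using hilbert_space_ell2 by auto
  show "hilbert_space ?C"
    by (rule hilbert_space_cong[OF hilbert_space_tensor_space[OF hs]]) (simp_all add: coarse_simps)
  have hn: "hnorm ?C = hnorm (tensor_space ?Hs)" by (simp add: hnorm_def coarse_simps fun_eq_iff)
  have id: "isometric_between ell2 ell2 (\<lambda>f. f)" by (simp add: isometric_between_def linear_between_def)
  have V: "isometric_between (?Hs ! i) (?Hs ! i) ([lact ell2 (- s), \<lambda>f. f] ! i)"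
    "isometric_between (?Hs ! i) (?Hs ! i) ([\<lambda>f. f, \<lambda>f. ract ell2 f (- t)] ! i)"
    if "i < length ?Hs" for i and s t :: 'g
    using that id ell2.lact_isometric[of "- s"] ell2.ract_isometric[of "- t"]
    by (auto simp: less_Suc_eq)
  have len: "length [lact ell2 (- s), \<lambda>f. f] = length ?Hs"
    "length [\<lambda>f. f, \<lambda>f. ract ell2 f (- t)] = length ?Hs" for s t :: 'g by simp_all
  show "linear_between ?C ?C (lact ?C s)" for s
    using linear_tensor_unitary[OF hs len(1) V(1), of s] by (simp add: linear_between_def coarse_simps)
  show "linear_between ?C ?C (\<lambda>\<xi>. ract ?C \<xi> t)" for t
    using linear_tensor_unitary[OF hs len(2) V(2), of t] by (simp add: linear_between_def coarse_simps)
  fix \<phi> assume \<phi>: "\<phi> \<in> vecs ?C"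
  then have \<phi>': "\<phi> \<in> vecs (tensor_space ?Hs)" and off: "\<eta> \<notin> tuples ?Hs \<Longrightarrow> \<phi> \<eta> = 0" for \<eta>
    by (auto simp: coarse_simps vecs_tensor_space)
  show "hnorm ?C (lact ?C s \<phi>) \<le> hnorm ?C \<phi>" for s
    using tensor_unitary_mem_le(2)[OF hs len(1) V(1) \<phi>', of s] by (simp add: hn coarse_simps(3))
  show "hnorm ?C (ract ?C \<phi> t) \<le> hnorm ?C \<phi>" for t
    using tensor_unitary_mem_le(2)[OF hs len(2) V(2) \<phi>', of t] by (simp add: hn coarse_simps(4))
  have eq: "\<psi> = \<psi>'"
    if "\<And>f h. f \<in> vecs ell2 \<Longrightarrow> h \<in> vecs ell2 \<Longrightarrow> \<psi> [f, h] = \<psi>' [f, h]"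
      "\<And>\<eta>. \<eta> \<notin> tuples ?Hs \<Longrightarrow> \<psi> \<eta> = \<psi>' \<eta>"
    for \<psi> \<psi>' :: "('g \<Rightarrow> complex) list \<Rightarrow> complex"
    using that tuples_ell2_ell2 by (metis ext)
  have act: "lact ?C s \<psi> [f, h] = \<psi> [lact ell2 (- s) f, h]" "ract ?C \<psi> t [f, h] = \<psi> [f, ract ell2 h (- t)]"
    if "f \<in> vecs ell2" "h \<in> vecs ell2" for f h s t \<psi>
    using that by (simp_all add: coarse_simps tensor_unitary_def)
  have act_0: "lact ?C s \<psi> \<eta> = 0" "ract ?C \<psi> t \<eta> = 0" if "\<eta> \<notin> tuples ?Hs" for s t \<psi> \<eta>
    using that by (simp_all add: coarse_simps tensor_unitary_def)
  note s = act act_0 off ell2.lact_vecs ell2.ract_vecs ell2.lact_zero ell2.ract_zero minus_add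
    ell2.lact_add ell2.ract_add
  show "lact ?C 0 \<phi> = \<phi>" by (rule eq) (simp_all add: s)
  show "ract ?C \<phi> 0 = \<phi>" by (rule eq) (simp_all add: s)
  show "lact ?C (s + t) \<phi> = lact ?C s (lact ?C t \<phi>)" for s t
    by (rule eq) (simp_all add: s del: add_uminus_conv_diff)
  show "ract ?C \<phi> (s + t) = ract ?C (ract ?C \<phi> s) t" for s t
    by (rule eq) (simp_all add: s del: add_uminus_conv_diff)
  show "lact ?C s (ract ?C \<phi> t) = ract ?C (lact ?C s \<phi>) t" for s t
    by (rule eq) (simp_all add: s)
qed

text \<open>The inverse on \<open>t\<close> matches the one in \<open>bimod_rep\<close>: right
  translation by the inverse of t sends \<open>delta (- t')\<close> to
  \<open>delta (- (t + t'))\<close>, so the product group permutes the basis by left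
  translation.\<close>

definition coarse_basis :: "'g::group_add \<times> 'g \<Rightarrow> ('g \<Rightarrow> complex) list \<Rightarrow> complex" where
  "coarse_basis = (\<lambda>(s, t). pure_tensor [ell2, ell2] [delta s, delta (- t)])"

lemma orthonormal_coarse_basis: "orthonormal_on coarse UNIV (coarse_basis :: 'g::group_add \<times> 'g \<Rightarrow> _)"
proof -
  let ?Hs = "[ell2, ell2] :: ('g \<Rightarrow> complex, 'g) bimod list"
  have hs: "\<And>H. H \<in> set ?Hs \<Longrightarrow> hilbert_space H" using hilbert_space_ell2 by auto
  have t: "[delta s, delta t] \<in> tuples ?Hs" for s t :: 'g by (simp add: delta_ell2)
  have "cinner (tensor_space ?Hs) (pure_tensor ?Hs [delta s, delta t]) (pure_tensor ?Hs [delta s', delta t']) =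
      (if s = s' \<and> t = t' then 1 else 0)" for s t s' t' :: 'g
  proof -
    have "cinner (tensor_space ?Hs) (pure_tensor ?Hs [delta s, delta t]) (pure_tensor ?Hs [delta s', delta t']) =
        (\<Prod>i<length ?Hs. cinner (?Hs ! i) ([delta s, delta t] ! i) ([delta s', delta t'] ! i))"
      by (rule cinner_pure_tensor[OF hs t t])
    also have "\<dots> = delta s s' * delta t t'" by (simp add: cinner_ell2_delta lessThan_Suc)
    finally show ?thesis by (simp add: delta_def)
  qed
  then show ?thesis
    using pure_tensor_mem[OF hs t]
    by (auto simp: orthonormal_on_def coarse_simps coarse_basis_def)
qed

lemma bimod_rep_coarse_basis: "bimod_rep coarse g (coarse_basis h) = coarse_basis (g + h)"
  by (cases g; cases h)
    (simp add: bimod_rep_def coarse_basis_def coarse_ract_pure coarse_lact_pure delta_ell2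
      ell2_lact_delta ell2_ract_delta minus_add)

section \<open>Coefficients in Schatten classes\<close>

lemma convex_on_power_nonneg: "convex_on {0::real..} (\<lambda>x. x ^ n)"
  using convex_power_odd[of n] convex_on_subset[OF convex_power_even[of n]] by (cases "even n") auto

lemma sum_weighted_power_le:
  fixes w x :: "'i \<Rightarrow> real"
  assumes "finite F" and w: "\<And>i. i \<in> F \<Longrightarrow> 0 \<le> w i" and x: "\<And>i. i \<in> F \<Longrightarrow> 0 \<le> x i"
    and w1: "sum w F \<le> 1" and n: "1 \<le> n"
  shows "(\<Sum>i\<in>F. w i * x i) ^ n \<le> (\<Sum>i\<in>F. w i * x i ^ n)"
proof (cases "sum w F = 0")
  case True
  then have "w i = 0" if "i \<in> F" for i using sum_nonneg_eq_0_iff[of F w] assms that by auto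
  then show ?thesis using n by (simp add: power_0_left)
next
  case False
  define W where "W = sum w F"
  have W: "0 < W" "W \<le> 1" using False w w1 sum_nonneg[of F w] by (auto simp: W_def)
  have F: "F \<noteq> {}" using False by auto
  have "(\<Sum>i\<in>F. (w i / W) *\<^sub>R x i) ^ n \<le> (\<Sum>i\<in>F. (w i / W) * x i ^ n)"
    using W w x
    by (intro convex_on_sum[OF \<open>finite F\<close> F convex_on_power_nonneg])
      (auto simp: W_def sum_divide_distrib[symmetric])
  then have "(\<Sum>i\<in>F. w i * x i) ^ n / W ^ n \<le> (\<Sum>i\<in>F. w i * x i ^ n) / W"
    by (simp add: sum_divide_distrib[symmetric] power_divide)
  then have "(\<Sum>i\<in>F. w i * x i) ^ n \<le> (\<Sum>i\<in>F. w i * x i ^ n) / W * W ^ n"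
    using W by (simp add: pos_divide_le_eq)
  also have "\<dots> = (\<Sum>i\<in>F. w i * x i ^ n) * W ^ (n - 1)"
    using W n by (simp add: power_eq_if)
  also have "\<dots> \<le> (\<Sum>i\<in>F. w i * x i ^ n) * 1"
    using W w x by (intro mult_left_mono power_le_one sum_nonneg) auto
  finally show ?thesis by simp
qed

lemma sum_power_le_power_sum:
  fixes a :: "'i \<Rightarrow> real"
  assumes "finite F" and a: "\<And>i. i \<in> F \<Longrightarrow> 0 \<le> a i" and n: "1 \<le> n"
  shows "(\<Sum>i\<in>F. a i ^ n) \<le> sum a F ^ n"
proof -
  obtain m where m: "n = Suc m" using n by (cases n) auto
  have "(\<Sum>i\<in>F. a i ^ n) \<le> (\<Sum>i\<in>F. a i * sum a F ^ m)"
    unfolding m power_Suc using assms by (intro sum_mono mult_left_mono power_mono member_le_sum) auto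
  then show ?thesis by (simp add: m sum_distrib_right)
qed

text \<open>The product is at most the n-th power of its largest factor. This pointwise bound takes
  the place of Hoelder's inequality for n factors, as only summability is asked for.\<close>

lemma prod_le_sum_power:
  fixes a :: "nat \<Rightarrow> real"
  assumes a: "\<And>i. i < n \<Longrightarrow> 0 \<le> a i" and n: "1 \<le> n"
  shows "(\<Prod>i<n. a i) \<le> (\<Sum>i<n. a i ^ n)"
proof -
  have fin: "finite (a ` {..<n})" and ne: "a ` {..<n} \<noteq> {}" using n by (auto simp: lessThan_empty_iff)
  obtain j where j: "j < n" "a j = Max (a ` {..<n})" using Max_in[OF fin ne] by auto
  have "(\<Prod>i<n. a i) \<le> (\<Prod>i<n. a j)"
    using a j fin by (intro prod_mono) auto
  also have "\<dots> = a j ^ n" by simp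
  also have "\<dots> \<le> (\<Sum>i<n. a i ^ n)" using j a by (intro member_le_sum) auto
  finally show ?thesis .
qed

text \<open>Every \<open>\<sigma> k powr p\<close> is bounded by the total sum, hence
  \<open>\<sigma> k powr (m - p)\<close> is bounded; the remaining factor
  \<open>\<sigma> k powr p\<close> is summable.\<close>

lemma summable_powr_imp_power:
  fixes \<sigma> :: "'i \<Rightarrow> real"
  assumes sm: "(\<lambda>k. \<sigma> k powr p) summable_on J" and pos: "\<And>k. k \<in> J \<Longrightarrow> 0 < \<sigma> k"
    and p: "0 < p" "p \<le> real m"
  shows "(\<lambda>k. \<sigma> k ^ m) summable_on J"
proof (rule summable_on_comparison_test)
  define P where "P = infsum (\<lambda>k. \<sigma> k powr p) J"
  show "(\<lambda>k. P powr ((real m - p) / p) * (\<sigma> k powr p)) summable_on J"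
    by (rule summable_on_cmult_right[OF sm])
  fix k assume k: "k \<in> J"
  have "(\<Sum>k\<in>{k}. \<sigma> k powr p) \<le> P"
    unfolding P_def using k by (intro finite_sum_le_infsum[OF sm]) auto
  then have "(\<sigma> k powr p) powr ((real m - p) / p) \<le> P powr ((real m - p) / p)"
    using p by (intro powr_mono2) auto
  then have "\<sigma> k powr (real m - p) \<le> P powr ((real m - p) / p)"
    using p by (simp add: powr_powr)
  then have "\<sigma> k powr (real m - p) * \<sigma> k powr p \<le> P powr ((real m - p) / p) * \<sigma> k powr p"
    by (intro mult_right_mono) auto
  then show "\<sigma> k ^ m \<le> P powr ((real m - p) / p) * \<sigma> k powr p"
    using pos[OF k] by (simp add: powr_add[symmetric] powr_realpow)
qed (use pos less_imp_le in \<open>auto intro!: zero_le_power\<close>)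

text \<open>The singular expansion gives |A \<delta>_s|^2 as the sum over k of \<sigma>_k^2
  |u_k(s)|^2, with weights |u_k(s)|^2 of total at most 1. By Jensen, |A \<delta>_s|^{2n} is at most
  the sum of \<sigma>_k^{2n} |u_k(s)|^2, and summing over s leaves the sum of \<sigma>_k^{2n}, since
  each u_k is a unit vector. Within a column, l_2 embeds into l_{2n}.\<close>

lemma schatten_entries_summable:
  fixes A :: "('g::group_add \<Rightarrow> complex) \<Rightarrow> 'g \<Rightarrow> complex"
  assumes A: "A \<in> schatten_class p ell2" and p: "0 < p" "p \<le> 2 * real n" and n: "1 \<le> n"
  shows "(\<lambda>(s, t). cmod (A (delta s) t) ^ (2 * n)) summable_on UNIV"
proof -
  let ?E = "ell2 :: ('g \<Rightarrow> complex, 'g) bimod"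
  interpret hilbert_space ?E by (rule hilbert_space_ell2)
  obtain J \<sigma> u v where sys: "singular_system ?E A J \<sigma> u v" and sm: "(\<lambda>k. \<sigma> k powr p) summable_on J"
    and bA: "bounded_operator ?E A"
    using A by (auto simp: schatten_class_def)
  have u: "orthonormal_on ?E J u" and v: "orthonormal_on ?E J v" and \<sigma>: "\<And>k. k \<in> J \<Longrightarrow> 0 < \<sigma> k"
    using sys by (auto simp: singular_system_def)
  have AE: "A f \<in> vecs ?E" if "f \<in> vecs ?E" for f
    using bA that by (auto simp: bounded_operator_def linear_between_def)
  have uE: "u k \<in> vecs ?E" "v k \<in> vecs ?E" "hnorm ?E (u k) = 1" if "k \<in> J" for k
    using u v that by (auto simp: orthonormal_on_def hnorm_def)
  have ell2_norm: "(hnorm ?E f)\<^sup>2 = sq_sum f UNIV" "sq_summable f UNIV" if "f \<in> vecs ?E" for f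
  proof -
    show sq: "sq_summable f UNIV" using that by (simp add: ell2_def)
    have "cinner ?E f f = l2_inner UNIV f f" by (simp add: ell2_def l2_inner_def)
    then show "(hnorm ?E f)\<^sup>2 = sq_sum f UNIV" using hnorm_sq[OF that] l2_inner_self[OF sq] by simp
  qed
  define M where "M = (\<Sum>\<^sub>\<infinity>k\<in>J. \<sigma> k ^ (2 * n))"
  have smM: "(\<lambda>k. \<sigma> k ^ (2 * n)) summable_on J"
    by (rule summable_powr_imp_power[OF sm \<sigma>]) (use p in auto)
  define c where "c s k = of_real (\<sigma> k) * cinner ?E (delta s) (u k)" for s k
  \<comment> \<open>Partial sums of the expansion: the estimates are made for finite
    \<open>F\<close>, where sums may be interchanged freely, and pass to the limit because the bound
    \<open>M\<close> does not depend on \<open>F\<close>.\<close>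
  define S where "S s F = (\<Sum>k\<in>F. scaleC (c s k) (v k))" for s F
  have lim: "((\<lambda>F. hnorm ?E (A (delta s) - S s F)) \<longlongrightarrow> 0) (finite_subsets_at_top J)" for s
    using sys delta_ell2[of s] by (simp add: singular_system_def S_def c_def)
  have S_mem: "S s F \<in> vecs ?E" if "F \<subseteq> J" for s F
    unfolding S_def by (intro sum_mem scaleC_mem) (use uE that in auto)
  have limn: "((\<lambda>F. hnorm ?E (S s F)) \<longlongrightarrow> hnorm ?E (A (delta s))) (finite_subsets_at_top J)" for s
  proof (rule Lim_null_comparison[THEN LIM_zero_cancel, OF _ lim])
    show "\<forall>\<^sub>F F in finite_subsets_at_top J.
        norm (hnorm ?E (S s F) - hnorm ?E (A (delta s))) \<le> hnorm ?E (A (delta s) - S s F)"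
      using hnorm_diff_ge[OF AE[OF delta_ell2[of s]] S_mem[of _ s]]
      by (intro eventually_finite_subsets_at_top_weakI) (simp add: abs_minus_commute)
  qed
  have uk: "(cmod (cinner ?E (delta s) (u k)))\<^sup>2 = (cmod (u k s))\<^sup>2" if "k \<in> J" for s k
    using commute[OF delta_ell2[of s] uE(1)[OF that]] by (simp add: cinner_ell2_delta)
  have finite_bound: "(\<Sum>s\<in>G. hnorm ?E (S s F) ^ (2 * n)) \<le> M"
    if G: "finite G" and F: "finite F" "F \<subseteq> J" for G F
  proof -
    have "hnorm ?E (S s F) ^ (2 * n) \<le> (\<Sum>k\<in>F. (cmod (u k s))\<^sup>2 * \<sigma> k ^ (2 * n))" for s
    proof -
      have "(hnorm ?E (S s F))\<^sup>2 = (\<Sum>k\<in>F. (cmod (c s k))\<^sup>2)"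
        unfolding S_def by (rule hnorm_orthonormal_sum[OF v F])
      also have "\<dots> = (\<Sum>k\<in>F. (cmod (u k s))\<^sup>2 * (\<sigma> k)\<^sup>2)"
        using F uk by (intro sum.cong refl) (auto simp: c_def norm_mult power_mult_distrib subset_iff)
      finally have "hnorm ?E (S s F) ^ (2 * n) = (\<Sum>k\<in>F. (cmod (u k s))\<^sup>2 * (\<sigma> k)\<^sup>2) ^ n"
        by (simp add: power_mult)
      also have "\<dots> \<le> (\<Sum>k\<in>F. (cmod (u k s))\<^sup>2 * ((\<sigma> k)\<^sup>2) ^ n)"
      proof (rule sum_weighted_power_le[OF F(1) _ _ _ n])
        have "(\<Sum>k\<in>F. (cmod (u k s))\<^sup>2) = (\<Sum>k\<in>F. (cmod (cinner ?E (delta s) (u k)))\<^sup>2)"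
          using F uk by (intro sum.cong refl) auto
        also have "\<dots> \<le> (hnorm ?E (delta s))\<^sup>2" by (rule bessel[OF u F delta_ell2])
        also have "\<dots> = 1" using hnorm_sq[OF delta_ell2[of s]] by (simp add: cinner_ell2_delta) (simp add: delta_def)
        finally show "(\<Sum>k\<in>F. (cmod (u k s))\<^sup>2) \<le> 1" .
      qed auto
      finally show ?thesis by (simp add: power_mult)
    qed
    then have "(\<Sum>s\<in>G. hnorm ?E (S s F) ^ (2 * n)) \<le> (\<Sum>s\<in>G. \<Sum>k\<in>F. (cmod (u k s))\<^sup>2 * \<sigma> k ^ (2 * n))"
      by (intro sum_mono)
    \<comment> \<open>The same numbers |u_k(s)|^2 are weights in k for fixed s, and squared
      coordinates of a unit vector in s for fixed k.\<close>
    also have "\<dots> = (\<Sum>k\<in>F. (\<Sum>s\<in>G. (cmod (u k s))\<^sup>2) * \<sigma> k ^ (2 * n))"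
      by (subst sum.swap) (simp add: sum_distrib_right)
    also have "\<dots> \<le> (\<Sum>k\<in>F. 1 * \<sigma> k ^ (2 * n))"
    proof (intro sum_mono mult_right_mono)
      fix k assume "k \<in> F"
      then have k: "k \<in> J" using F by auto
      show "(\<Sum>s\<in>G. (cmod (u k s))\<^sup>2) \<le> 1"
        using finite_sum_le_infsum[OF ell2_norm(2)[OF uE(1)[OF k]] G] ell2_norm(1)[OF uE(1)[OF k]] uE(3)[OF k]
        by simp
      show "0 \<le> \<sigma> k ^ (2 * n)" using \<sigma>[OF k] by simp
    qed
    also have "\<dots> \<le> M"
      unfolding M_def using F \<sigma> less_imp_le by (simp, intro finite_sum_le_infsum[OF smM]) auto
    finally show ?thesis .
  qed
  have bound: "(\<Sum>s\<in>G. hnorm ?E (A (delta s)) ^ (2 * n)) \<le> M" if G: "finite G" for G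
  proof (rule tendsto_upperbound)
    show "((\<lambda>F. \<Sum>s\<in>G. hnorm ?E (S s F) ^ (2 * n)) \<longlongrightarrow> (\<Sum>s\<in>G. hnorm ?E (A (delta s)) ^ (2 * n)))
        (finite_subsets_at_top J)"
      by (intro tendsto_intros limn)
    show "\<forall>\<^sub>F F in finite_subsets_at_top J. (\<Sum>s\<in>G. hnorm ?E (S s F) ^ (2 * n)) \<le> M"
      using finite_bound[OF G] by (intro eventually_finite_subsets_at_top_weakI)
  qed simp
  show ?thesis
  proof (rule nonneg_bounded_summable(1)[where b = M])
    fix F :: "('g \<times> 'g) set" assume F: "finite F"
    have "(\<Sum>(s, t)\<in>F. cmod (A (delta s) t) ^ (2 * n)) \<le>
        (\<Sum>(s, t)\<in>fst ` F \<times> snd ` F. cmod (A (delta s) t) ^ (2 * n))"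
      using F by (intro sum_mono2) (auto simp: rev_image_eqI)
    also have "\<dots> = (\<Sum>s\<in>fst ` F. \<Sum>t\<in>snd ` F. ((cmod (A (delta s) t))\<^sup>2) ^ n)"
      by (simp add: sum.cartesian_product power_mult)
    also have "\<dots> \<le> (\<Sum>s\<in>fst ` F. ((hnorm ?E (A (delta s)))\<^sup>2) ^ n)"
    proof (rule sum_mono)
      fix s
      have "(\<Sum>t\<in>snd ` F. ((cmod (A (delta s) t))\<^sup>2) ^ n) \<le> (\<Sum>t\<in>snd ` F. (cmod (A (delta s) t))\<^sup>2) ^ n"
        using F n by (intro sum_power_le_power_sum) auto
      also have "\<dots> \<le> ((hnorm ?E (A (delta s)))\<^sup>2) ^ n"
        unfolding ell2_norm(1)[OF AE[OF delta_ell2]]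
        using F by (intro power_mono finite_sum_le_infsum ell2_norm(2) AE delta_ell2 sum_nonneg) auto
      finally show "(\<Sum>t\<in>snd ` F. ((cmod (A (delta s) t))\<^sup>2) ^ n) \<le> ((hnorm ?E (A (delta s)))\<^sup>2) ^ n" .
    qed
    also have "\<dots> \<le> M" using bound[of "fst ` F"] F by (simp add: power_mult)
    finally show "(\<Sum>i\<in>F. case i of (s, t) \<Rightarrow> cmod (A (delta s) t) ^ (2 * n)) \<le> M" .
  qed auto
qed

text \<open>In the convolution at the identity only the pair of \<open>- t\<close> and
  \<open>t\<close> survives. Hence the trace against a group element reads off a single value of
  \<open>f\<close>.\<close>

lemma lookup_mult_single:
  fixes f :: "'g::group_add \<Rightarrow>\<^sub>0 complex"
  shows "Poly_Mapping.lookup (f * Poly_Mapping.single t 1) 0 = Poly_Mapping.lookup f (- t)"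
proof -
  have "(\<Sum>q. Poly_Mapping.lookup (Poly_Mapping.single t (1::complex)) q when 0 = l + q) = (1 when l = - t)" for l
  proof -
    have "(0 = l + q) = (q = - l)" for q :: 'g
      using eq_neg_iff_add_eq_0[of l q] by (metis minus_minus)
    then have "(\<Sum>q. Poly_Mapping.lookup (Poly_Mapping.single t (1::complex)) q when 0 = l + q) =
        (\<Sum>q. Poly_Mapping.lookup (Poly_Mapping.single t (1::complex)) q when q = - l)" by simp
    also have "\<dots> = Poly_Mapping.lookup (Poly_Mapping.single t (1::complex)) (- l)" by simp
    also have "\<dots> = (1 when l = - t)" by (auto simp: lookup_single when_def)
    finally show ?thesis .
  qed
  then have "Poly_Mapping.lookup (f * Poly_Mapping.single t 1) 0 = (\<Sum>l. Poly_Mapping.lookup f l * (1 when l = - t))"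
    by (simp add: lookup_mult)
  also have "\<dots> = (\<Sum>l. Poly_Mapping.lookup f l when l = - t)" by (simp add: when_def if_distrib cong: if_cong)
  finally show ?thesis by simp
qed

lemma coefficient_summable:
  fixes H :: "('a::complex_vector, 'g::group_add, 'm) bimod_scheme"
  assumes H: "bimodule H" and \<xi>: "\<xi> \<in> vecs H" and co: "coefficient_in_schatten p H \<xi>"
    and p: "0 < p" "p \<le> 2 * real n" and n: "1 \<le> n"
  shows "(\<lambda>g. cmod (cinner H \<xi> (bimod_rep H g \<xi>)) ^ (2 * n)) summable_on UNIV"
proof -
  interpret bimodule H by (rule H)
  obtain T A where T: "is_coefficient H \<xi> T" and A: "A \<in> schatten_class p (ell2 :: ('g \<Rightarrow> complex, 'g) bimod)"
    and AT: "\<And>x. A (alg_to_ell2 x) = alg_to_ell2 (T x)"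
    using co by (auto simp: coefficient_in_schatten_def)
  have "cmod (cinner H \<xi> (bimod_rep H (s, t) \<xi>)) = cmod (A (delta s) t)" for s t
  proof -
    \<comment> \<open>The inverse of \<open>t\<close> serves two ends: it is the one in
      \<open>bimod_rep\<close>, and under the trace it reads off the value at \<open>t\<close>
      itself.\<close>
    let ?x = "Poly_Mapping.single s (1::complex)" and ?y = "Poly_Mapping.single (- t) (1::complex)"
    have d: "alg_to_ell2 ?x = delta s"
      by (auto simp: alg_to_ell2_eq_lookup lookup_single delta_def when_def fun_eq_iff)
    have tr: "alg_trace z = Poly_Mapping.lookup z 0" for z :: "'g \<Rightarrow>\<^sub>0 complex"
      unfolding alg_trace_def cinner_ell2_delta using alg_to_ell2_eq_lookup[of z] by (simp add: alg_to_ell2_def)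
    have "cinner H (ralg H (lalg H ?x \<xi>) ?y) \<xi> = alg_trace (T ?x * ?y)"
      using T by (simp add: is_coefficient_def)
    also have "\<dots> = alg_to_ell2 (T ?x) t" by (simp add: tr lookup_mult_single alg_to_ell2_eq_lookup)
    also have "\<dots> = A (delta s) t" by (simp add: AT[symmetric] d)
    finally have "cinner H (ract H (lact H s \<xi>) (- t)) \<xi> = A (delta s) t"
      by (simp add: lalg_def ralg_def scaleC_one)
    moreover have "ract H (lact H s \<xi>) (- t) = bimod_rep H (s, t) \<xi>"
      using lact_ract[OF \<xi>] by (simp add: bimod_rep_def)
    ultimately show ?thesis
      using commute[of \<xi> "bimod_rep H (s, t) \<xi>"] \<xi> lact_vecs ract_vecs by (simp add: bimod_rep_def)
  qed
  then have "(\<lambda>g. cmod (cinner H \<xi> (bimod_rep H g \<xi>)) ^ (2 * n)) = (\<lambda>(s, t). cmod (A (delta s) t) ^ (2 * n))"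
    by auto
  then show ?thesis using schatten_entries_summable[OF A p n] by simp
qed

text \<open>If \<open>w\<close> is orthogonal to \<open>D\<close>, then |w|^2 = <w, w - d> for each
  d in \<open>D\<close>; a d closer to \<open>w\<close> than the norm of \<open>w\<close>
  contradicts Cauchy-Schwarz.\<close>

lemma (in hilbert_space) dense_in_separating:
  assumes "dense_in H D"
  shows "separating H D"
  unfolding separating_def
proof (intro conjI ballI impI)
  show "D \<subseteq> vecs H" using assms by (simp add: dense_in_def)
  fix w assume w: "w \<in> vecs H" and 0: "\<forall>b\<in>D. cinner H w b = 0"
  show "w = 0"
  proof (rule ccontr)
    assume "w \<noteq> 0"
    then have n: "hnorm H w > 0" using hnorm_eq_0[OF w] hnorm_nonneg[OF w] by linarith
    then obtain d where d: "d \<in> D" "hnorm H (w - d) < hnorm H w"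
      using assms w unfolding dense_in_def by blast
    have dv: "d \<in> vecs H" using d assms by (auto simp: dense_in_def)
    have "(hnorm H w)\<^sup>2 = Re (cinner H w (w - d))" using w dv 0 d(1) by (simp add: diff_right hnorm_sq)
    also have "\<dots> \<le> hnorm H w * hnorm H (w - d)"
      by (rule order_trans[OF complex_Re_le_cmod cauchy_schwarz]) (use w dv in auto)
    also have "\<dots> < hnorm H w * hnorm H w" using d n by simp
    finally show False by (simp add: power2_eq_square)
  qed
qed

lemma summable_on_finite_sum:
  fixes f :: "'j \<Rightarrow> 'i \<Rightarrow> real"
  assumes "finite J" "\<And>j. j \<in> J \<Longrightarrow> f j summable_on A"
  shows "(\<lambda>x. \<Sum>j\<in>J. f j x) summable_on A"
  using assms by (induction J rule: finite_induct) (auto intro: summable_on_add)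

lemma listset_replicate: "listset (replicate n D) = {\<xi>. length \<xi> = n \<and> set \<xi> \<subseteq> D}"
  by (induction n) (auto simp: set_Cons_def length_Suc_conv)

theorem proposition3p7:
  fixes H :: "('a::complex_vector, 'g::group_add) bimod"
    and p :: real and n :: nat and D :: "'a set"
  assumes "1 \<le> p"
    and "bimodule H"
    and "dense_in H D"
    and "\<And>\<xi>. \<xi> \<in> D \<Longrightarrow> coefficient_in_schatten p H \<xi>"
    and "1 \<le> n" and "p / 2 \<le> real n"
  shows "quasi_contained (tensor_power n H) (coarse :: (('g \<Rightarrow> complex) list \<Rightarrow> complex, 'g) bimod)"
proof (rule quasi_containedI[OF bimodule.bimodule_tensor_power[OF assms(2)] bimodule_coarse
      orthonormal_coarse_basis bimod_rep_coarse_basis])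
  interpret bimodule H by (rule assms(2))
  let ?Hs = "replicate n H" and ?K = "tensor_power n H"
  have hs: "\<And>H'. H' \<in> set ?Hs \<Longrightarrow> hilbert_space H'" using hilbert_space_axioms by simp
  fix \<eta> assume "\<eta> \<in> vecs ?K" and n0: "\<eta> \<noteq> 0"
  then have \<eta>: "\<eta> \<in> vecs (tensor_space ?Hs)" by (simp add: tensor_power_simps)
  have Ds: "list_all2 separating ?Hs (replicate n D)"
    using dense_in_separating[OF assms(3)] by (simp add: list_all2_conv_all_nth)
  \<comment> \<open>As \<open>\<eta>\<close> is itself a functional on tuples, a tuple where it does
    not vanish is a pure tensor not orthogonal to it.\<close>
  have "\<exists>\<xi>\<in>listset (replicate n D). \<eta> \<xi> \<noteq> 0"
  proof (rule ccontr)
    assume "\<not> ?thesis"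
    then have "\<eta> = 0"
      using \<eta> bounded_multi_antilinear_eq_0[OF hs Ds]
      by (intro tensor_ext[OF hs \<eta>]) (auto simp: vecs_tensor_space)
    then show False using n0 by simp
  qed
  then obtain \<xi> where len: "length \<xi> = n" and \<xi>D: "set \<xi> \<subseteq> D" and \<eta>\<xi>: "\<eta> \<xi> \<noteq> 0"
    by (auto simp: listset_replicate)
  have DH: "D \<subseteq> vecs H" using assms(3) by (simp add: dense_in_def)
  have \<xi>i: "\<xi> ! i \<in> D" "\<xi> ! i \<in> vecs H" if "i < n" for i
    using subsetD[OF \<xi>D nth_mem[of i \<xi>]] subsetD[OF DH, of "\<xi> ! i"] len that by blast+
  have \<xi>: "\<xi> \<in> tuples ?Hs" using len \<xi>i by (simp add: mem_tuples_iff)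
  let ?P = "pure_tensor ?Hs \<xi>"
  have P: "?P \<in> vecs ?K" using pure_tensor_mem[OF hs \<xi>] by (simp add: tensor_power_simps)
  have "cinner ?K \<eta> ?P \<noteq> 0"
    using cinner_pure_tensor_right[OF hs \<eta> \<xi>] \<eta>\<xi> by (simp add: tensor_power_simps)
  moreover have "sq_summable (\<lambda>g. cinner ?K ?P (bimod_rep ?K g ?P)) UNIV"
  \<comment> \<open>The coefficient of a pure tensor is the product of n coefficients in
    \<open>H\<close>. Its square is a product of n squares, at most the sum of their n-th powers,
    and these powers of exponent 2n are summable.\<close>
  proof (rule summable_on_comparison_test)
    show "(\<lambda>g. \<Sum>i<n. cmod (cinner H (\<xi> ! i) (bimod_rep H g (\<xi> ! i))) ^ (2 * n)) summable_on UNIV"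
      using assms(1,5,6) \<xi>i assms(4)
      by (intro summable_on_finite_sum coefficient_summable[OF assms(2), where p = p]) auto
    fix g :: "'g \<times> 'g"
    obtain s t where g: "g = (s, t)" by (cases g)
    have rt: "map (\<lambda>x. ract H x (- t)) \<xi> \<in> tuples ?Hs"
      using len \<xi>i ract_vecs by (simp add: mem_tuples_iff)
    have "bimod_rep ?K g ?P = pure_tensor ?Hs (map (lact H s) (map (\<lambda>x. ract H x (- t)) \<xi>))"
      by (simp only: g bimod_rep_def prod.case tensor_power_ract_pure[OF \<xi>] tensor_power_lact_pure[OF rt])
    also have "map (lact H s) (map (\<lambda>x. ract H x (- t)) \<xi>) = map (bimod_rep H g) \<xi>"
      by (simp add: g bimod_rep_def)
    finally have rep: "bimod_rep ?K g ?P = pure_tensor ?Hs (map (bimod_rep H g) \<xi>)" .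
    have gt: "map (bimod_rep H g) \<xi> \<in> tuples ?Hs"
      using len \<xi>i ract_vecs lact_vecs by (simp add: mem_tuples_iff g bimod_rep_def)
    have "cinner ?K ?P (bimod_rep ?K g ?P) = (\<Prod>i<n. cinner H (\<xi> ! i) (bimod_rep H g (\<xi> ! i)))"
      using cinner_pure_tensor[OF hs \<xi> gt] len by (simp add: rep tensor_power_simps)
    then have "(cmod (cinner ?K ?P (bimod_rep ?K g ?P)))\<^sup>2 =
        (\<Prod>i<n. (cmod (cinner H (\<xi> ! i) (bimod_rep H g (\<xi> ! i))))\<^sup>2)"
      by (simp add: prod_norm[symmetric] prod_power_distrib)
    also have "\<dots> \<le> (\<Sum>i<n. ((cmod (cinner H (\<xi> ! i) (bimod_rep H g (\<xi> ! i))))\<^sup>2) ^ n)"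
      using assms(5) by (intro prod_le_sum_power) auto
    finally show "(cmod (cinner ?K ?P (bimod_rep ?K g ?P)))\<^sup>2 \<le>
        (\<Sum>i<n. cmod (cinner H (\<xi> ! i) (bimod_rep H g (\<xi> ! i))) ^ (2 * n))"
      by (simp add: power_mult)
  qed simp
  ultimately show "\<exists>\<xi>\<in>vecs ?K. cinner ?K \<eta> \<xi> \<noteq> 0 \<and>
      sq_summable (\<lambda>g. cinner ?K \<xi> (bimod_rep ?K g \<xi>)) UNIV"
    using P by blast
qed

end
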